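(* Let $(\mathcal X,d,\mu)$ be a space of homogeneous type and let $\mathcal T=\{T_t\}_{t>0}$ be a semigroup of bounded linear operators on $\mathbb B$. Assume there exist $\tilde p,\tilde q$ with $1\le\tilde p<\tilde q\le\infty$ such that $T_t\in\mathcal O(L^{\tilde p}(\mu)-L^{\tilde q}(\mu))$. Then there exists a unique subset of $[1,\infty]$, denoted $\mathcal J(\mathcal T)$, such that for all $p,q\in[1,\infty]$ with $p<q$, $$T_t\in\mathcal O(L^p(\mu)-L^q(\mu))\iff p,q\in\mathcal J(\mathcal T).$$ This set is an interval, contains $[\tilde p,\tilde q]$, and satisfies $\mathcal J(\mathcal T)\subset\widetilde{\mathcal J}(\mathcal T)$ and $\operatorname{Int}\mathcal J(\mathcal T)=\operatorname{Int}\widetilde{\mathcal J}(\mathcal T)$.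
   Context: A space of homogeneous type $(\mathcal X,d,\mu)$ is a nonempty set $\mathcal X$ with a distance $d$ and a nonnegative Borel measure $\mu$ such that for some $C_0$, $\mu(B(x,2r))\le C_0\,\mu(B(x,r))<\infty$ for all $x\in\mathcal X$, $r>0$, where $B(x,r)=\{y:d(x,y)<r\}$. For a ball $B=B(x_B,r_B)$ write $\lambda B=B(x_B,\lambda r_B)$ and $C_j(B)=2^{j+1}B\setminus 2^jB$ for $j\ge2$. $\Upsilon(s)=\max\{s,s^{-1}\}$ for $s>0$; $\chi_E$ is the indicator function of $E$. $\mathbb B$ is a Banach space of measurable functions on $\mathcal X$ stable under truncation by indicator functions of measurable sets and containing all simple functions (finite combinations of indicators of measurable sets of finite measure). A semigroup on $\mathbb B$: each $T_t$ is a bounded linear operator on $\mathbb B$ and $T_s\circ T_t=T_{s+t}$ for $s,t>0$. For $1\le p\le q\le\infty$, $T_t\in\mathcal O(L^p(\mu)-L^q(\mu))$ (off-diagonal estimates on balls) means: there exist $\theta_1,\theta_2>0$, $c>0$ and $C>0$ such that for every $t>0$, every ball $B$ with radius $r=r_B$, and all $f\in L^p(\mu)\cap\mathbb B$, $$\Big(\tfrac1{\mu(B)}\int_B|T_t(\chi_Bf)|^q d\mu\Big)^{1/q}\le C\,\Upsilon\big(\tfrac r{\sqrt t}\big)^{\theta_2}\Big(\tfrac1{\mu(B)}\int_B|f|^pd\mu\Big)^{1/p},$$ and for all $j\ge2$ $$\Big(\tfrac1{\mu(B)}\int_B|T_t(\chi_{C_j(B)}f)|^q d\mu\Big)^{1/q}\le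 C\,2^{j\theta_1}\Upsilon\big(\tfrac{2^jr}{\sqrt t}\big)^{\theta_2}e^{-\frac{c4^jr^2}{t}}\Big(\tfrac1{\mu(2^{j+1}B)}\int_{C_j(B)}|f|^pd\mu\Big)^{1/p},$$ $$\Big(\tfrac1{\mu(2^{j+1}B)}\int_{C_j(B)}|T_t(\chi_{B}f)|^q d\mu\Big)^{1/q}\le C\,2^{j\theta_1}\Upsilon\big(\tfrac{2^jr}{\sqrt t}\big)^{\theta_2}e^{-\frac{c4^jr^2}{t}}\Big(\tfrac1{\mu(B)}\int_{B}|f|^pd\mu\Big)^{1/p},$$ with essential suprema for infinite exponents. $\widetilde{\mathcal J}(\mathcal T)$ is the interval of all $p\in[1,\infty]$ such that $T_t$ is bounded on $L^p(\mu)$ uniformly in $t>0$ (i.e. $\|T_tf\|_p\le C\|f\|_p$ for $f\in\mathbb B\cap L^p(\mu)$, $C$ independent of $t$). For $E\subset[1,\infty]$ with lower and upper bounds $a,b$, $\operatorname{Int}E=(a,b)=\{s\in\mathbb R:a<s<b\}$.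
   Formalization: The formal version adds that for every t, ball B, p in [1,∞] and f in L^p∩𝔹, T_t(χ_{2^kB}f) tends to T_t f locally in measure as k→∞; without it the claim fails, e.g. on 𝔹=L^∞(ℝ) for the heat semigroup plus Λ(f)·1 with a suitable singular functional Λ. *)

theory Defs
  imports "HOL-Probability.Essential_Supremum"
begin

locale homogeneous_type =
  fixes M :: "'a::metric_space measure"
  assumes sets_borel: "sets M = sets borel"
    and finite_ball: "r > 0 \<Longrightarrow> emeasure M (ball x r) < \<infinity>"
    and doubling: "\<exists>C0::real. \<forall>x. \<forall>r>0. emeasure M (ball x (2 * r)) \<le> ennreal C0 * emeasure M (ball x r)"

definition annulus :: "nat \<Rightarrow> 'a::metric_space \<Rightarrow> real \<Rightarrow> 'a set" where
  "annulus j x r = ball x (2 ^ (j + 1) * r) - ball x (2 ^ j * r)"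

definition Upsilon :: "real \<Rightarrow> real" where
  "Upsilon s = max s (inverse s)"

definition trunc :: "'a set \<Rightarrow> ('a \<Rightarrow> complex) \<Rightarrow> 'a \<Rightarrow> complex" where
  "trunc E f = (\<lambda>x. indicator E x * f x)"

text \<open>Exponents are extended reals in \<open>{1..\<infinity>}\<close>. Norms take values in \<^typ>\<open>ennreal\<close>, and \<open>epowr\<close> is the
  power with a real exponent \<open>a > 0\<close>.\<close>

definition epowr :: "ennreal \<Rightarrow> real \<Rightarrow> ennreal" where
  "epowr x a = (if x = \<infinity> then \<infinity> else ennreal (enn2real x powr a))"

definition Lp_norm :: "'a measure \<Rightarrow> ereal \<Rightarrow> ('a \<Rightarrow> complex) \<Rightarrow> ennreal" where
  "Lp_norm M p f =
     (if p = \<infinity> then esssup M (\<lambda>x. ennreal (norm (f x)))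
      else epowr (\<integral>\<^sup>+x. ennreal (norm (f x) powr real_of_ereal p) \<partial>M) (1 / real_of_ereal p))"

definition Lp :: "'a measure \<Rightarrow> ereal \<Rightarrow> ('a \<Rightarrow> complex) set" where
  "Lp M p = {f \<in> borel_measurable M. Lp_norm M p f < \<infinity>}"

text \<open>\<open>Lp_avg M p A E f\<close> is \<open>(1/\<mu>(A) \<integral>\<^bsub>E\<^esub> |f|\<^sup>p d\<mu>)\<^bsup>1/p\<^esup>\<close>, used with \<open>E \<subseteq> A\<close>. For \<open>p = \<infinity>\<close> it is the
  essential supremum of \<open>|f|\<close> over \<open>E\<close>; extending \<open>|f|\<close> by \<open>0\<close>, the least element of
  \<^typ>\<open>ennreal\<close>, outside \<open>E\<close> does not affect it. If \<open>\<mu>(A) = 0\<close> then the average is \<open>0\<close>,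
  since \<open>0 / 0 = 0\<close> in \<^typ>\<open>ennreal\<close>.\<close>

definition Lp_avg :: "'a measure \<Rightarrow> ereal \<Rightarrow> 'a set \<Rightarrow> 'a set \<Rightarrow> ('a \<Rightarrow> complex) \<Rightarrow> ennreal" where
  "Lp_avg M p A E f =
     (if p = \<infinity> then esssup M (\<lambda>x. ennreal (norm (f x)) * indicator E x)
      else epowr ((\<integral>\<^sup>+x\<in>E. ennreal (norm (f x) powr real_of_ereal p) \<partial>M) / emeasure M A)
             (1 / real_of_ereal p))"

text \<open>As usual for function spaces over a measure space, functions are identified when they agree
  almost everywhere: \<open>\<B>\<close> is the set of all representatives, \<open>N\<close> is the norm read on
  representatives, and identities between operators hold almost everywhere.\<close>

locale banach_function_space =
  fixes M :: "'a measure" and \<B> :: "('a \<Rightarrow> complex) set" and N :: "('a \<Rightarrow> complex) \<Rightarrow> real"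
  assumes measurable: "f \<in> \<B> \<Longrightarrow> f \<in> borel_measurable M"
    and AE_closed: "f \<in> \<B> \<Longrightarrow> g \<in> borel_measurable M \<Longrightarrow> (AE x in M. f x = g x) \<Longrightarrow> g \<in> \<B>"
    and add_closed: "f \<in> \<B> \<Longrightarrow> g \<in> \<B> \<Longrightarrow> (\<lambda>x. f x + g x) \<in> \<B>"
    and scale_closed: "f \<in> \<B> \<Longrightarrow> (\<lambda>x. c * f x) \<in> \<B>"
    and norm_nonneg: "f \<in> \<B> \<Longrightarrow> N f \<ge> 0"
    and norm_zero_iff: "f \<in> \<B> \<Longrightarrow> N f = 0 \<longleftrightarrow> (AE x in M. f x = 0)"
    and norm_scale: "f \<in> \<B> \<Longrightarrow> N (\<lambda>x. c * f x) = cmod c * N f"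
    and norm_triangle: "f \<in> \<B> \<Longrightarrow> g \<in> \<B> \<Longrightarrow> N (\<lambda>x. f x + g x) \<le> N f + N g"
    and complete: "(\<And>n. F n \<in> \<B>) \<Longrightarrow>
      (\<forall>e>0. \<exists>K. \<forall>m\<ge>K. \<forall>n\<ge>K. N (\<lambda>x. F m x - F n x) < e) \<Longrightarrow>
      \<exists>f\<in>\<B>. (\<lambda>n. N (\<lambda>x. F n x - f x)) \<longlonglongrightarrow> 0"
    and trunc_closed: "f \<in> \<B> \<Longrightarrow> E \<in> sets M \<Longrightarrow> trunc E f \<in> \<B>"
    and simple_mem: "simple_bochner_integrable M f \<Longrightarrow> f \<in> \<B>"

definition bounded_operator ::
    "'a measure \<Rightarrow> ('a \<Rightarrow> complex) set \<Rightarrow> (('a \<Rightarrow> complex) \<Rightarrow> real)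
      \<Rightarrow> (('a \<Rightarrow> complex) \<Rightarrow> 'a \<Rightarrow> complex) \<Rightarrow> bool" where
  "bounded_operator M \<B> N S \<longleftrightarrow>
     (\<forall>f\<in>\<B>. S f \<in> \<B>) \<and>
     (\<forall>f\<in>\<B>. \<forall>g\<in>\<B>. AE x in M. S (\<lambda>y. f y + g y) x = S f x + S g x) \<and>
     (\<forall>c. \<forall>f\<in>\<B>. AE x in M. S (\<lambda>y. c * f y) x = c * S f x) \<and>
     (\<exists>C. \<forall>f\<in>\<B>. N (S f) \<le> C * N f)"

locale operator_semigroup = banach_function_space M \<B> N
  for M :: "'a measure" and \<B> N +
  fixes T :: "real \<Rightarrow> ('a \<Rightarrow> complex) \<Rightarrow> 'a \<Rightarrow> complex"
  assumes bounded: "t > 0 \<Longrightarrow> bounded_operator M \<B> N (T t)"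
    and semigroup: "s > 0 \<Longrightarrow> t > 0 \<Longrightarrow> f \<in> \<B> \<Longrightarrow> AE x in M. T s (T t f) x = T (s + t) f x"

definition tendsto_locally_in_measure ::
    "'a measure \<Rightarrow> (nat \<Rightarrow> 'a \<Rightarrow> complex) \<Rightarrow> ('a \<Rightarrow> complex) \<Rightarrow> bool" where
  "tendsto_locally_in_measure M F g \<longleftrightarrow>
     (\<forall>A\<in>sets M. emeasure M A < \<infinity> \<longrightarrow>
        (\<forall>e>0. (\<lambda>n. emeasure M {x \<in> A. norm (F n x - g x) \<ge> e}) \<longlonglongrightarrow> 0))"

text \<open>\<open>T\<^sub>t f = T\<^sub>t (\<chi>\<^bsub>4B\<^esub> f) + \<Sum>\<^bsub>j\<ge>2\<^esub> T\<^sub>t (\<chi>\<^bsub>C\<^sub>j(B)\<^esub> f)\<close> for every ball \<open>B\<close>, stated through the partial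
  sums \<open>T\<^sub>t (\<chi>\<^bsub>2\<^sup>k B\<^esub> f)\<close>. Off-diagonal estimates on balls only involve functions of bounded support,
  and boundedness of \<open>T\<^sub>t\<close> on \<open>\<B>\<close> does not by itself determine \<open>T\<^sub>t f\<close> for other \<open>f\<close>: on
  \<open>\<B> = L\<^sup>\<infinity>(\<real>)\<close> take \<open>T\<^sub>t f = e\<^bsup>t\<Delta>\<^esup> f + \<Lambda>(f) 1\<close>, where the continuous linear functional \<open>\<Lambda>\<close> vanishes
  on bounded uniformly continuous functions and on boundedly supported functions, but not on all
  of \<open>L\<^sup>1 \<inter> L\<^sup>\<infinity>\<close>. The expansion holds whenever \<open>\<chi>\<^bsub>2\<^sup>k B\<^esub> f\<close> tends to \<open>f\<close> in \<open>\<B>\<close> and convergence in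
  \<open>\<B>\<close> implies local convergence in measure, as for \<open>\<B> = L\<^sup>s(\<mu>)\<close> with \<open>s < \<infinity>\<close>.\<close>

definition annular_expansion ::
    "'a::metric_space measure \<Rightarrow> ('a \<Rightarrow> complex) set
      \<Rightarrow> (real \<Rightarrow> ('a \<Rightarrow> complex) \<Rightarrow> 'a \<Rightarrow> complex) \<Rightarrow> bool" where
  "annular_expansion M \<B> T \<longleftrightarrow>
     (\<forall>t>0. \<forall>x. \<forall>r>0. \<forall>p\<in>{1..\<infinity>}. \<forall>f\<in>Lp M p \<inter> \<B>.
        tendsto_locally_in_measure M (\<lambda>k. T t (trunc (ball x (2 ^ k * r)) f)) (T t f))"

definition off_diagonal ::
    "'a::metric_space measure \<Rightarrow> ('a \<Rightarrow> complex) set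
      \<Rightarrow> (real \<Rightarrow> ('a \<Rightarrow> complex) \<Rightarrow> 'a \<Rightarrow> complex) \<Rightarrow> ereal \<Rightarrow> ereal \<Rightarrow> bool" where
  "off_diagonal M \<B> T p q \<longleftrightarrow>
     (\<exists>\<theta>1>0. \<exists>\<theta>2>0. \<exists>c>0. \<exists>C>0. \<forall>t>0. \<forall>x. \<forall>r>0. \<forall>f\<in>Lp M p \<inter> \<B>.
        Lp_avg M q (ball x r) (ball x r) (T t (trunc (ball x r) f))
          \<le> ennreal (C * Upsilon (r / sqrt t) powr \<theta>2) * Lp_avg M p (ball x r) (ball x r) f \<and>
        (\<forall>j\<ge>2.
          Lp_avg M q (ball x r) (ball x r) (T t (trunc (annulus j x r) f))
            \<le> ennreal (C * 2 powr (real j * \<theta>1) * Upsilon (2 ^ j * r / sqrt t) powr \<theta>2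
                        * exp (- (c * 4 ^ j * r\<^sup>2 / t)))
               * Lp_avg M p (ball x (2 ^ (j + 1) * r)) (annulus j x r) f \<and>
          Lp_avg M q (ball x (2 ^ (j + 1) * r)) (annulus j x r) (T t (trunc (ball x r) f))
            \<le> ennreal (C * 2 powr (real j * \<theta>1) * Upsilon (2 ^ j * r / sqrt t) powr \<theta>2
                        * exp (- (c * 4 ^ j * r\<^sup>2 / t)))
               * Lp_avg M p (ball x r) (ball x r) f))"

definition is_off_diagonal_set ::
    "'a::metric_space measure \<Rightarrow> ('a \<Rightarrow> complex) set
      \<Rightarrow> (real \<Rightarrow> ('a \<Rightarrow> complex) \<Rightarrow> 'a \<Rightarrow> complex) \<Rightarrow> ereal set \<Rightarrow> bool" where
  "is_off_diagonal_set M \<B> T J \<longleftrightarrow>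
     J \<subseteq> {1..\<infinity>} \<and>
     (\<forall>p\<in>{1..\<infinity>}. \<forall>q\<in>{1..\<infinity>}. p < q \<longrightarrow> (off_diagonal M \<B> T p q \<longleftrightarrow> p \<in> J \<and> q \<in> J))"

definition uniformly_bounded_exponents ::
    "'a measure \<Rightarrow> ('a \<Rightarrow> complex) set
      \<Rightarrow> (real \<Rightarrow> ('a \<Rightarrow> complex) \<Rightarrow> 'a \<Rightarrow> complex) \<Rightarrow> ereal set" where
  "uniformly_bounded_exponents M \<B> T =
     {p \<in> {1..\<infinity>}. \<exists>C::real. \<forall>t>0. \<forall>f\<in>\<B> \<inter> Lp M p. Lp_norm M p (T t f) \<le> ennreal C * Lp_norm M p f}"

text \<open>The open interval between the bounds of \<open>E\<close>, as a set of reals (also when \<open>\<infinity> \<in> E\<close>).\<close>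

definition exponent_interior :: "ereal set \<Rightarrow> real set" where
  "exponent_interior E = {s. Inf E < ereal s \<and> ereal s < Sup E}"

end

theory Submission
  imports Defs
begin

text \<open>Off-diagonal estimates on balls are equivalent to a Gaussian bound for \<open>T\<^sub>t\<close> between balls of radius
  \<open>\<surd>t\<close>, because doubling makes covering numbers and volume ratios polynomial, hence absorbable in the
  Gaussian. In this form Jensen's inequality shrinks the pair \<open>(p, q)\<close>, a Schur test gives uniform
  boundedness on \<open>L\<^sup>p\<close> and on \<open>L\<^sup>q\<close>, and \<open>T\<^sub>2\<^sub>t = T\<^sub>t T\<^sub>t\<close> composes \<open>(p, q)\<close> with \<open>(q, r)\<close>.
  Real interpolation between \<open>(p, q)\<close> and a uniform bound on \<open>L\<^sup>s\<close> produces pairs \<open>(p', q')\<close> with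
  \<open>p' < q'\<close> closer to \<open>s\<close>; chaining finitely many of them by composition reaches every exponent
  strictly between \<open>p\<close> and \<open>s\<close>. Thus all exponents that occur in some estimate are linked to
  \<open>(p\<^sub>0, q\<^sub>0)\<close>, which gives both the interval and the equality of the interiors.\<close>

section \<open>Lebesgue norms\<close>

text \<open>The obstacle is that estimates control \<open>T t\<close> only on functions of bounded
  support, and no density of such functions in \<B> is available. Limits are therefore taken almost
  everywhere, with Fatou's lemma in place of norm convergence. \<open>annular_expansion\<close>
  enters at two places, the uniform bound and the composition, where \<open>T t\<close> acts on
  functions of unbounded support. In the interpolation the support stays in one ball, and
  convergence of the level truncations is derived from the estimates themselves. The elementary
  interpolation loses an arbitrarily small amount in the source exponent. The gap between p and q
  leaves room for this loss. Each step contracts the distance of reciprocal exponents to 1/s by a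
  fixed factor: exponents strictly before s are reached in finitely many steps, s itself is only
  approached, which is why the comparison of the two sets concerns interiors. If one ball is null,
  doubling makes the whole space null. This case is separated at the end; elsewhere all ball volumes
  are positive reals.\<close>

lemma exponent_cases [consumes 1, case_names real infinity]:
  assumes "p \<in> {1..(\<infinity>::ereal)}"
  obtains r where "p = ereal r" "r \<ge> 1" | "p = \<infinity>"
  using assms by (cases p) (auto simp: one_ereal_def)

lemma trunc_measurable [measurable]:
  "E \<in> sets M \<Longrightarrow> f \<in> borel_measurable M \<Longrightarrow> trunc E f \<in> borel_measurable M"
  unfolding trunc_def by (intro borel_measurable_times borel_measurable_indicator)

lemma trunc_trunc: "trunc E (trunc F f) = trunc (E \<inter> F) f"
  by (auto simp: trunc_def indicator_def fun_eq_iff)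

lemma norm_trunc_le: "norm (trunc E f x) \<le> norm (f x)"
  by (auto simp: trunc_def indicator_def)

text \<open>Turns norm bounds into integral inequalities with a real \<open>b\<close>, so that the
  estimates below need no arithmetic with \<open>epowr\<close>.\<close>

lemma Lp_norm_real_le_iff:
  assumes "r \<ge> 1" "b \<ge> 0"
  shows "Lp_norm M (ereal r) f \<le> ennreal b \<longleftrightarrow>
    (\<integral>\<^sup>+x. ennreal (norm (f x) powr r) \<partial>M) \<le> ennreal (b powr r)"
proof (cases "(\<integral>\<^sup>+x. ennreal (norm (f x) powr r) \<partial>M)" rule: ennreal_cases)
  case (real i)
  have "i powr (1 / r) \<le> b \<longleftrightarrow> i \<le> b powr r"
  proof
    assume "i powr (1 / r) \<le> b"
    then have "(i powr (1 / r)) powr r \<le> b powr r" using assms by (intro powr_mono2) auto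
    then show "i \<le> b powr r" using assms real by (simp add: powr_powr)
  next
    assume "i \<le> b powr r"
    then have "i powr (1/r) \<le> (b powr r) powr (1/r)" using assms real by (intro powr_mono2) auto
    then show "i powr (1/r) \<le> b" using assms by (simp add: powr_powr)
  qed
  then show ?thesis using real assms by (simp add: Lp_norm_def epowr_def)
next
  case top
  then show ?thesis by (simp add: Lp_norm_def epowr_def top_unique)
qed

lemma Lp_norm_infinity_le_iff:
  assumes [measurable]: "f \<in> borel_measurable M" and "b \<ge> 0"
  shows "Lp_norm M \<infinity> f \<le> ennreal b \<longleftrightarrow> (AE x in M. norm (f x) \<le> b)"
proof
  assume "Lp_norm M \<infinity> f \<le> ennreal b"
  moreover have "AE x in M. ennreal (norm (f x)) \<le> Lp_norm M \<infinity> f"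
    unfolding Lp_norm_def by (simp add: esssup_AE)
  ultimately have "AE x in M. ennreal (norm (f x)) \<le> ennreal b"
    by (auto elim: eventually_mono)
  then show "AE x in M. norm (f x) \<le> b" using assms(2) by simp
next
  assume "AE x in M. norm (f x) \<le> b"
  then show "Lp_norm M \<infinity> f \<le> ennreal b"
    unfolding Lp_norm_def using assms(2) by (auto intro!: esssup_I)
qed

text \<open>Strictly larger real bounds are positive and finite, so they may be divided by and
  raised to powers; proofs by normalization then also cover the value 0 on the right-hand
  side.\<close>

lemma le_if_le_real_upper_bounds:
  fixes x y :: ennreal
  assumes "\<And>b. b > 0 \<Longrightarrow> y < ennreal b \<Longrightarrow> x \<le> ennreal b"
  shows "x \<le> y"
proof (cases y rule: ennreal_cases)
  case (real c)
  show ?thesis unfolding real(2)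
  proof (rule ennreal_le_epsilon)
    fix e :: real assume "e > 0"
    then have "x \<le> ennreal (c + e)" using real by (intro assms) (auto simp: ennreal_lessI)
    then show "x \<le> ennreal c + ennreal e" using real \<open>e > 0\<close> by simp
  qed
qed simp

lemma Lp_norm_mono_AE:
  assumes "p \<in> {1..\<infinity>}" "f \<in> borel_measurable M" "g \<in> borel_measurable M"
    and le: "AE x in M. norm (f x) \<le> norm (g x)"
  shows "Lp_norm M p f \<le> Lp_norm M p g"
proof (rule le_if_le_real_upper_bounds)
  fix b :: real assume b: "b > 0" "Lp_norm M p g < ennreal b"
  show "Lp_norm M p f \<le> ennreal b"
    using assms(1)
  proof (cases rule: exponent_cases)
    case (real r)
    have "(\<integral>\<^sup>+x. ennreal (norm (f x) powr r) \<partial>M) \<le> (\<integral>\<^sup>+x. ennreal (norm (g x) powr r) \<partial>M)"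
      using le real by (intro nn_integral_mono_AE) (auto elim!: eventually_mono intro!: powr_mono2)
    also have "\<dots> \<le> ennreal (b powr r)"
      using b real Lp_norm_real_le_iff[of r b M g] by auto
    finally show ?thesis using real b by (simp add: Lp_norm_real_le_iff)
  next
    case infinity
    then have "AE x in M. norm (g x) \<le> b" using b assms by (simp add: Lp_norm_infinity_le_iff[symmetric])
    with le have "AE x in M. norm (f x) \<le> b" by eventually_elim auto
    then show ?thesis using infinity b assms by (simp add: Lp_norm_infinity_le_iff)
  qed
qed

lemma Lp_norm_cong_AE:
  assumes "p \<in> {1..\<infinity>}" "f \<in> borel_measurable M" "g \<in> borel_measurable M"
    and "AE x in M. f x = g x"
  shows "Lp_norm M p f = Lp_norm M p g"
  using assms by (intro antisym Lp_norm_mono_AE) (auto elim: eventually_mono)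

lemma Lp_norm_trunc_mono:
  assumes "p \<in> {1..\<infinity>}" "f \<in> borel_measurable M" "E \<in> sets M" "F \<in> sets M" "E \<subseteq> F"
  shows "Lp_norm M p (trunc E f) \<le> Lp_norm M p (trunc F f)"
  using assms by (intro Lp_norm_mono_AE) (auto simp: trunc_def indicator_def)

lemma Lp_norm_trunc_le:
  assumes "p \<in> {1..\<infinity>}" "f \<in> borel_measurable M" "E \<in> sets M"
  shows "Lp_norm M p (trunc E f) \<le> Lp_norm M p f"
  using assms by (intro Lp_norm_mono_AE) (auto simp: norm_trunc_le)

text \<open>Away from 0 this is \<open>powr_convex\<close>. If one of the two points is 0, convexity
  reduces to s powr r \<le> s for 0 < s < 1.\<close>

lemma convex_on_powr_nonneg:
  assumes "r \<ge> 1" shows "convex_on {0..} (\<lambda>x::real. x powr r)"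
proof (rule convex_onI)
  fix t x y :: real assume t: "0 < t" "t < 1" and xy: "x \<in> {0..}" "y \<in> {0..}"
  have scale: "(s * z) powr r \<le> s * z powr r" if "0 < s" "s < 1" "z \<ge> 0" for s z :: real
  proof -
    have "s powr r \<le> s powr 1" using that assms by (intro powr_mono') auto
    then show ?thesis using that by (simp add: powr_mult mult_right_mono)
  qed
  show "((1 - t) *\<^sub>R x + t *\<^sub>R y) powr r \<le> (1 - t) * x powr r + t * y powr r"
  proof (cases "x = 0 \<or> y = 0")
    case True
    then show ?thesis using scale[of t y] scale[of "1 - t" x] t xy by auto
  next
    case False
    then show ?thesis
      using convex_onD[OF powr_convex[OF assms], of t x y] t xy by auto
  qed
qed simp

lemma powr_convex_weighted:
  fixes u v a b r :: real
  assumes "r \<ge> 1" "u \<ge> 0" "v \<ge> 0" "a > 0" "b > 0"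
  shows "((u + v) / (a + b)) powr r \<le> a / (a + b) * (u / a) powr r + b / (a + b) * (v / b) powr r"
proof -
  have conv: "convex_on {0..} (\<lambda>x::real. x powr r)"
    using assms(1) by (rule convex_on_powr_nonneg)
  show ?thesis
    using convex_onD[OF conv, of "b / (a + b)" "u / a" "v / b"] assms
    by (simp add: field_simps add_divide_distrib[symmetric])
qed

text \<open>Minkowski's inequality by convexity instead of duality: |f + g| / (a' + b') is dominated
  by the convex combination of |f| / a' and |g| / b' with weights a' / (a' + b') and b' / (a' + b');
  after integration each normalized function contributes at most its weight.\<close>

lemma Lp_norm_triangle:
  assumes p: "p \<in> {1..\<infinity>}" and [measurable]: "f \<in> borel_measurable M" "g \<in> borel_measurable M"
  shows "Lp_norm M p (\<lambda>x. f x + g x) \<le> Lp_norm M p f + Lp_norm M p g"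
proof (cases "Lp_norm M p f + Lp_norm M p g" rule: ennreal_cases)
  case top
  then show ?thesis by (simp only: top_greatest)
next
  case (real s)
  then obtain a b where ab: "Lp_norm M p f = ennreal a" "Lp_norm M p g = ennreal b" "a \<ge> 0" "b \<ge> 0"
    by (cases "Lp_norm M p f" rule: ennreal_cases; cases "Lp_norm M p g" rule: ennreal_cases) auto
  show ?thesis
  proof (rule ennreal_le_epsilon)
    fix e :: real assume e: "e > 0"
    \<comment> \<open>The summand e / 2 makes both normalizing constants positive even when a norm
      vanishes.\<close>
    define a' b' where "a' = a + e / 2" and "b' = b + e / 2"
    have pos: "a' > 0" "b' > 0" using ab e by (auto simp: a'_def b'_def)
    have le: "Lp_norm M p f \<le> ennreal a'" "Lp_norm M p g \<le> ennreal b'"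
      using ab e by (auto simp: a'_def b'_def intro!: ennreal_leI)
    have "Lp_norm M p (\<lambda>x. f x + g x) \<le> ennreal (a' + b')"
      using p
    proof (cases rule: exponent_cases)
      case r: (real r)
      define k where "k = (a' + b') powr r"
      define k1 where "k1 = k * (a' / (a' + b')) / a' powr r"
      define k2 where "k2 = k * (b' / (a' + b')) / b' powr r"
      have k: "k > 0" "k1 \<ge> 0" "k2 \<ge> 0" using pos by (auto simp: k_def k1_def k2_def)
      have pw: "norm (f x + g x) powr r \<le> k1 * norm (f x) powr r + k2 * norm (g x) powr r" for x
      proof -
        have "norm (f x + g x) powr r \<le> (norm (f x) + norm (g x)) powr r"
          using r by (intro powr_mono2) (auto simp: norm_triangle_ineq)
        also have "\<dots> = k * ((norm (f x) + norm (g x)) / (a' + b')) powr r"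
          using pos by (simp add: k_def powr_divide)
        also have "\<dots> \<le> k * (a' / (a' + b') * (norm (f x) / a') powr r + b' / (a' + b') * (norm (g x) / b') powr r)"
          using pos k r by (intro mult_left_mono powr_convex_weighted) auto
        also have "\<dots> = k1 * norm (f x) powr r + k2 * norm (g x) powr r"
          using pos by (simp add: k1_def k2_def powr_divide distrib_left)
        finally show ?thesis .
      qed
      have "(\<integral>\<^sup>+x. ennreal (norm (f x + g x) powr r) \<partial>M)
          \<le> (\<integral>\<^sup>+x. ennreal k1 * ennreal (norm (f x) powr r) + ennreal k2 * ennreal (norm (g x) powr r) \<partial>M)"
      proof (rule nn_integral_mono)
        fix x
        show "ennreal (norm (f x + g x) powr r) \<le> ennreal k1 * ennreal (norm (f x) powr r) + ennreal k2 * ennreal (norm (g x) powr r)"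
          using pw[of x] k by (simp add: ennreal_mult[symmetric] ennreal_plus[symmetric] ennreal_leI del: ennreal_plus)
      qed
      also have "\<dots> = ennreal k1 * (\<integral>\<^sup>+x. ennreal (norm (f x) powr r) \<partial>M) + ennreal k2 * (\<integral>\<^sup>+x. ennreal (norm (g x) powr r) \<partial>M)"
        by (simp add: nn_integral_add nn_integral_cmult)
      also have "\<dots> \<le> ennreal k1 * ennreal (a' powr r) + ennreal k2 * ennreal (b' powr r)"
        using le pos r by (intro add_mono mult_left_mono) (auto simp: Lp_norm_real_le_iff)
      also have "\<dots> = ennreal k"
      proof -
        have "k1 * a' powr r + k2 * b' powr r = k"
        proof -
          have "k1 * a' powr r = k * (a' / (a' + b'))" "k2 * b' powr r = k * (b' / (a' + b'))"
            using pos by (simp_all add: k1_def k2_def)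
          then have "k1 * a' powr r + k2 * b' powr r = k * ((a' + b') / (a' + b'))"
            by (simp only: distrib_left[symmetric] add_divide_distrib)
          then show ?thesis using pos by simp
        qed
        then show ?thesis using k by (simp add: ennreal_mult[symmetric] ennreal_plus[symmetric] del: ennreal_plus)
      qed
      finally show ?thesis using r pos by (simp add: Lp_norm_real_le_iff k_def del: ennreal_plus)
    next
      case infinity
      have "AE x in M. norm (f x) \<le> a'" "AE x in M. norm (g x) \<le> b'"
        using le infinity pos by (simp_all add: Lp_norm_infinity_le_iff)
      then have "AE x in M. norm (f x + g x) \<le> a' + b'"
        by eventually_elim (use norm_triangle_le add_mono in blast)
      then show ?thesis using infinity pos by (simp add: Lp_norm_infinity_le_iff del: ennreal_plus)
    qed
    also have "ennreal (a' + b') = ennreal s + ennreal e"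
      using real ab e by (simp add: a'_def b'_def ennreal_plus[symmetric] del: ennreal_plus)
    finally show "Lp_norm M p (\<lambda>x. f x + g x) \<le> Lp_norm M p f + Lp_norm M p g + ennreal e"
      using real by simp
  qed
qed

lemma Lp_norm_zero_AE:
  assumes "p \<in> {1..\<infinity>}" and [measurable]: "f \<in> borel_measurable M" and "AE x in M. f x = 0"
  shows "Lp_norm M p f = 0"
proof -
  have "Lp_norm M p f \<le> ennreal 0"
    using assms(1)
  proof (cases rule: exponent_cases)
    case (real r)
    have "(\<integral>\<^sup>+x. ennreal (norm (f x) powr r) \<partial>M) = (\<integral>\<^sup>+x. 0 \<partial>M)"
      using assms(3) real by (intro nn_integral_cong_AE) (auto elim: eventually_mono)
    then show ?thesis unfolding real(1) using real by (subst Lp_norm_real_le_iff) auto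
  next
    case infinity
    then show ?thesis using assms by (subst infinity, subst Lp_norm_infinity_le_iff) auto
  qed
  then show ?thesis by simp
qed

lemma Lp_norm_sum_le:
  assumes p: "p \<in> {1..\<infinity>}" and "finite I" "\<And>i. i \<in> I \<Longrightarrow> F i \<in> borel_measurable M"
  shows "Lp_norm M p (\<lambda>x. \<Sum>i\<in>I. F i x) \<le> (\<Sum>i\<in>I. Lp_norm M p (F i))"
  using assms(2,3)
proof (induction I)
  case empty
  then show ?case using Lp_norm_zero_AE[OF p, of "\<lambda>x. 0" M] by simp
next
  case (insert i I)
  have "Lp_norm M p (\<lambda>x. F i x + (\<Sum>j\<in>I. F j x)) \<le> Lp_norm M p (F i) + Lp_norm M p (\<lambda>x. \<Sum>j\<in>I. F j x)"
    using insert by (intro Lp_norm_triangle p borel_measurable_sum) auto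
  also have "\<dots> \<le> Lp_norm M p (F i) + (\<Sum>j\<in>I. Lp_norm M p (F j))"
    using insert by (intro add_left_mono insert.IH) auto
  finally show ?case using insert by simp
qed

text \<open>Fatou's lemma for finite exponents, a countable union of null sets for \<infinity>. It
  carries norm bounds to a limit without convergence in norm.\<close>

lemma Lp_norm_le_of_AE_limit:
  assumes p: "p \<in> {1..\<infinity>}" and [measurable]: "\<And>n. F n \<in> borel_measurable M" "g \<in> borel_measurable M"
    and lim: "AE x in M. (\<lambda>n. F n x) \<longlonglongrightarrow> g x" and bound: "\<And>n. Lp_norm M p (F n) \<le> C"
  shows "Lp_norm M p g \<le> C"
proof (cases C rule: ennreal_cases)
  case (real b)
  show ?thesis unfolding real(2) using p
  proof (cases rule: exponent_cases)
    case r: (real r)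
    have "(\<integral>\<^sup>+x. ennreal (norm (g x) powr r) \<partial>M) = (\<integral>\<^sup>+x. liminf (\<lambda>n. ennreal (norm (F n x) powr r)) \<partial>M)"
    proof (rule nn_integral_cong_AE, use lim in eventually_elim)
      fix x assume "(\<lambda>n. F n x) \<longlonglongrightarrow> g x"
      then have "(\<lambda>n. ennreal (norm (F n x) powr r)) \<longlonglongrightarrow> ennreal (norm (g x) powr r)"
        using r by (intro tendsto_ennrealI tendsto_powr' tendsto_norm) auto
      from lim_imp_Liminf[OF _ this]
      show "ennreal (norm (g x) powr r) = liminf (\<lambda>n. ennreal (norm (F n x) powr r))" by simp
    qed
    also have "\<dots> \<le> liminf (\<lambda>n. \<integral>\<^sup>+x. ennreal (norm (F n x) powr r) \<partial>M)"
      by (intro nn_integral_liminf) auto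
    also have "\<dots> \<le> ennreal (b powr r)"
      using bound r real by (intro Liminf_le always_eventually) (auto simp: Lp_norm_real_le_iff)
    finally show "Lp_norm M p g \<le> ennreal b" using r real by (simp add: Lp_norm_real_le_iff)
  next
    case infinity
    then have "AE x in M. norm (F n x) \<le> b" for n
      using bound[of n] real by (simp add: Lp_norm_infinity_le_iff)
    then have "AE x in M. \<forall>n. norm (F n x) \<le> b" by (simp add: AE_all_countable)
    with lim have "AE x in M. norm (g x) \<le> b"
      by eventually_elim (auto intro: LIMSEQ_le_const2[OF tendsto_norm])
    then show "Lp_norm M p g \<le> ennreal b" using infinity real by (simp add: Lp_norm_infinity_le_iff)
  qed
qed simp

text \<open>F. Riesz's subsequence argument. Capping the difference by 1 on the set \<open>E\<close>
  of finite measure turns convergence in measure into convergence in L1, which has an almost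
  everywhere convergent subsequence.\<close>

lemma tendsto_locally_in_measure_imp_AE_subseq:
  assumes lim: "tendsto_locally_in_measure M F g"
    and [measurable]: "\<And>n. F n \<in> borel_measurable M" "g \<in> borel_measurable M" "E \<in> sets M"
    and fin: "emeasure M E < \<infinity>"
  shows "\<exists>s::nat \<Rightarrow> nat. strict_mono s \<and> (AE x in M. x \<in> E \<longrightarrow> (\<lambda>n. F (s n) x) \<longlonglongrightarrow> g x)"
proof -
  define h where "h n x = indicator E x * min 1 (norm (F n x - g x))" for n x
  have h_meas [measurable]: "h n \<in> borel_measurable M" for n unfolding h_def by measurable
  have h_nonneg: "h n x \<ge> 0" for n x by (auto simp: h_def)
  have h_int: "integrable M (h n)" for n
    by (rule Bochner_Integration.integrable_bound[where f="indicator E :: _ \<Rightarrow> real"])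
      (use fin in \<open>auto simp: h_def indicator_def\<close>)
  have "(\<lambda>n. \<integral>x. norm (h n x) \<partial>M) \<longlonglongrightarrow> 0"
  proof (rule LIMSEQ_I)
    fix e :: real assume e: "e > 0"
    \<comment> \<open>Chosen so that the part of \<open>E\<close> where the difference is below
      \<open>d\<close> contributes at most e / 2; the 1 in the denominator covers measure
      zero.\<close>
    define d where "d = e / (2 * (measure M E + 1))"
    have d: "d > 0" using e by (auto simp: d_def intro!: divide_pos_pos mult_pos_pos add_nonneg_pos)
    define A where "A n = {x \<in> E. norm (F n x - g x) \<ge> d}" for n
    have A_sets [measurable]: "A n \<in> sets M" for n
    proof -
      have "A n = E \<inter> {x \<in> space M. norm (F n x - g x) \<ge> d}"
        using sets.sets_into_space[OF \<open>E \<in> sets M\<close>] by (auto simp: A_def)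
      also have "\<dots> \<in> sets M" by measurable
      finally show ?thesis .
    qed
    have A_fin: "emeasure M (A n) < \<infinity>" for n
      using fin emeasure_mono[of "A n" E M] by (auto simp: A_def)
    have "(\<lambda>n. emeasure M (A n)) \<longlonglongrightarrow> 0"
      using lim fin d by (auto simp: tendsto_locally_in_measure_def A_def)
    then have "eventually (\<lambda>n. emeasure M (A n) < ennreal (e / 2)) sequentially"
      using e by (intro order_tendstoD) auto
    then obtain n0 where n0: "\<And>n. n \<ge> n0 \<Longrightarrow> emeasure M (A n) < ennreal (e / 2)"
      by (auto simp: eventually_sequentially)
    show "\<exists>n0. \<forall>n\<ge>n0. norm ((\<integral>x. norm (h n x) \<partial>M) - 0) < e"
    proof (intro exI allI impI)
      fix n assume "n \<ge> n0"
      then have "emeasure M (A n) < ennreal (e / 2)" by (rule n0)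
      moreover have "emeasure M (A n) = ennreal (measure M (A n))"
        using A_fin[of n] by (simp add: emeasure_eq_ennreal_measure)
      ultimately have mA: "measure M (A n) < e / 2" by (simp add: ennreal_less_iff)
      have "(\<integral>x. norm (h n x) \<partial>M) \<le> (\<integral>x. d * indicator E x + indicator (A n) x \<partial>M)"
      proof (rule integral_mono)
        show "integrable M (\<lambda>x. norm (h n x))" using h_int by simp
        show "integrable M (\<lambda>x. d * indicator E x + indicator (A n) x)"
          using fin A_fin by (intro Bochner_Integration.integrable_add integrable_mult_right integrable_real_indicator) auto
      qed (use d in \<open>auto simp: h_def A_def indicator_def\<close>)
      also have "\<dots> = d * measure M E + measure M (A n)"
        using fin A_fin[of n] by (subst Bochner_Integration.integral_add) auto
      also have "d * measure M E \<le> e / 2"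
      proof -
        have "measure M E / (measure M E + 1) \<le> 1" by (simp add: add_nonneg_pos)
        then have "(e / 2) * (measure M E / (measure M E + 1)) \<le> (e / 2) * 1"
          using e by (intro mult_left_mono) auto
        then show ?thesis by (simp add: d_def)
      qed
      finally have "(\<integral>x. norm (h n x) \<partial>M) < e" using mA by simp
      then show "norm ((\<integral>x. norm (h n x) \<partial>M) - 0) < e" by simp
    qed
  qed
  from tendsto_L1_AE_subseq[OF h_int this] obtain s :: "nat \<Rightarrow> nat"
    where s: "strict_mono s" "AE x in M. (\<lambda>n. h (s n) x) \<longlonglongrightarrow> 0" by auto
  from s(2) have "AE x in M. x \<in> E \<longrightarrow> (\<lambda>n. F (s n) x) \<longlonglongrightarrow> g x"
  proof (eventually_elim, intro impI)
    fix x assume *: "(\<lambda>n. h (s n) x) \<longlonglongrightarrow> 0" and "x \<in> E"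
    then have 1: "(\<lambda>n. min 1 (norm (F (s n) x - g x))) \<longlonglongrightarrow> 0" by (simp add: h_def)
    have "eventually (\<lambda>n. min 1 (norm (F (s n) x - g x)) < 1) sequentially"
      using 1 by (rule order_tendstoD) simp
    then have "eventually (\<lambda>n. min 1 (norm (F (s n) x - g x)) = norm (F (s n) x - g x)) sequentially"
      by (rule eventually_mono) (simp add: min_def split: if_splits)
    with 1 have "(\<lambda>n. norm (F (s n) x - g x)) \<longlonglongrightarrow> 0"
      by (rule Lim_transform_eventually)
    then have "(\<lambda>n. F (s n) x - g x) \<longlonglongrightarrow> 0" by (rule tendsto_norm_zero_cancel)
    then show "(\<lambda>n. F (s n) x) \<longlonglongrightarrow> g x" by (simp add: LIM_zero_iff)
  qed
  with s(1) show ?thesis by blast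
qed

text \<open>For finite exponents the integrals of |h n|^r are dominated by a convergent geometric
  series, so the pointwise series is finite almost everywhere and its terms tend to 0. Used to see
  that the tails of a level set decomposition disappear after \<open>T t\<close> is applied.\<close>

lemma AE_tendsto_0_if_Lp_norm_geometric:
  assumes p: "p \<in> {1..\<infinity>}" and [measurable]: "\<And>n. h n \<in> borel_measurable M"
    and a: "0 \<le> a" "a < 1" and K: "K \<ge> 0" and bound: "\<And>n. Lp_norm M p (h n) \<le> ennreal (K * a ^ n)"
  shows "AE x in M. (\<lambda>n. h n x) \<longlonglongrightarrow> 0"
  using p
proof (cases rule: exponent_cases)
  case (real r)
  have le: "(\<integral>\<^sup>+x. ennreal (norm (h n x) powr r) \<partial>M) \<le> ennreal (K powr r * (a powr r) ^ n)" for n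
  proof -
    have "(a ^ n) powr r = (a powr r) ^ n"
      using a by (induction n) (simp_all only: power_Suc power_0 powr_mult powr_one_eq_one zero_le_power)
    then show ?thesis
      using bound[of n, unfolded real(1)] real(2) a K by (subst (asm) Lp_norm_real_le_iff) (simp_all add: powr_mult)
  qed
  have ar: "0 \<le> a powr r" "a powr r < 1"
    using powr_less_mono2[of r a 1] a real(2) by simp_all
  have sm: "summable (\<lambda>n. K powr r * (a powr r) ^ n)"
    using ar by (intro summable_mult summable_geometric) auto
  have "(\<integral>\<^sup>+x. (\<Sum>n. ennreal (norm (h n x) powr r)) \<partial>M) = (\<Sum>n. \<integral>\<^sup>+x. ennreal (norm (h n x) powr r) \<partial>M)"
    by (intro nn_integral_suminf) auto
  also have "\<dots> \<le> (\<Sum>n. ennreal (K powr r * (a powr r) ^ n))"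
    by (rule suminf_le[OF le summableI summableI])
  also have "\<dots> = ennreal (\<Sum>n. K powr r * (a powr r) ^ n)"
    by (rule suminf_ennreal2[OF _ sm]) simp
  also have "\<dots> < \<infinity>" by simp
  finally have "AE x in M. (\<Sum>n. ennreal (norm (h n x) powr r)) \<noteq> \<infinity>"
    by (intro nn_integral_noteq_infinite borel_measurable_suminf) (simp_all add: less_top[symmetric])
  then show ?thesis
  proof eventually_elim
    fix x assume "(\<Sum>n. ennreal (norm (h n x) powr r)) \<noteq> \<infinity>"
    then have "summable (\<lambda>n. norm (h n x) powr r)"
      by (intro summable_suminf_not_top) (simp_all add: infinity_ennreal_def)
    then have "(\<lambda>n. norm (h n x) powr r) \<longlonglongrightarrow> 0" by (rule summable_LIMSEQ_zero)
    then have "(\<lambda>n. (norm (h n x) powr r) powr (1 / r)) \<longlonglongrightarrow> 0 powr (1 / r)"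
      by (rule tendsto_powr'[OF _ tendsto_const]) (use real(2) in auto)
    moreover have "(norm (h n x) powr r) powr (1 / r) = norm (h n x)" "0 powr (1 / r) = 0" for n
      using real(2) by (simp_all add: powr_powr)
    ultimately have "(\<lambda>n. norm (h n x)) \<longlonglongrightarrow> 0"
      by (simp only:)
    then show "(\<lambda>n. h n x) \<longlonglongrightarrow> 0"
      by (rule tendsto_norm_zero_cancel)
  qed
next
  case infinity
  then have "AE x in M. norm (h n x) \<le> K * a ^ n" for n
    using bound[of n] a K by (simp add: Lp_norm_infinity_le_iff)
  then have "AE x in M. \<forall>n. norm (h n x) \<le> K * a ^ n" by (simp add: AE_all_countable)
  then show ?thesis
  proof eventually_elim
    fix x assume *: "\<forall>n. norm (h n x) \<le> K * a ^ n"
    have lim: "(\<lambda>n. K * a ^ n) \<longlonglongrightarrow> 0"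
      using a by (intro tendsto_mult_right_zero LIMSEQ_power_zero) auto
    show "(\<lambda>n. h n x) \<longlonglongrightarrow> 0"
      by (rule Lim_null_comparison[OF always_eventually[OF *] lim])
  qed
qed

text \<open>Hoelder's inequality against the indicator of \<open>B\<close>, proved from Young's
  inequality. Here and below \<open>1 / real_of_ereal p\<close> is 0 for
  \<open>p = \<infinity>\<close>, since \<open>real_of_ereal \<infinity> = 0\<close> and 1 / 0 = 0;
  this agrees with the usual convention 1 / \<infinity> = 0.\<close>

lemma Lp_norm_Jensen:
  assumes p: "p \<in> {1..\<infinity>}" "1 \<le> p1" "p1 \<le> p" and [measurable]: "g \<in> borel_measurable M" "B \<in> sets M"
    and B: "emeasure M B < \<infinity>" and V: "V > 0" "measure M B \<le> V"
  shows "Lp_norm M p1 (trunc B g)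
    \<le> ennreal (V powr (1 / real_of_ereal p1 - 1 / real_of_ereal p)) * Lp_norm M p (trunc B g)"
proof (cases "p1 = p")
  case True
  then show ?thesis using V by simp
next
  case False
  then have lt: "p1 < p" using p by simp
  then obtain r1 where r1: "p1 = ereal r1" "r1 \<ge> 1"
    using p by (cases p1) (auto simp: one_ereal_def)
  define \<epsilon> where "\<epsilon> = 1 / real_of_ereal p"
  have emB: "emeasure M B \<le> ennreal V"
    using B V by (simp add: emeasure_eq_ennreal_measure ennreal_leI)
  have int_B: "(\<integral>\<^sup>+x. ennreal (norm (trunc B g x) powr r1) \<partial>M) \<le> ennreal ((b * V powr (1 / r1 - \<epsilon>)) powr r1)"
    if "b > 0" "Lp_norm M p (trunc B g) \<le> ennreal b" for b
    using p(1)
  proof (cases rule: exponent_cases)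
    case (real r)
    have \<epsilon>: "\<epsilon> = 1 / r" using real by (simp add: \<epsilon>_def)
    have rr: "r1 < r" using lt real r1 by simp
    \<comment> \<open>The average of order r that corresponds to the norm bound \<open>b\<close> on
      volume V. With u = |g| / \<beta>, Young's inequality gives u^r1 \<le> \<alpha> u^r + (1 -
      \<alpha>).\<close>
    define \<beta> where "\<beta> = b * V powr (- (1 / r))"
    define \<alpha> where "\<alpha> = r1 / r"
    have \<beta>: "\<beta> > 0" using that V by (simp add: \<beta>_def)
    have \<alpha>: "0 < \<alpha>" "\<alpha> < 1" using rr r1 by (auto simp: \<alpha>_def)
    define k1 where "k1 = \<beta> powr r1 * \<alpha> / \<beta> powr r"
    define k2 where "k2 = \<beta> powr r1 * (1 - \<alpha>)"
    have k: "k1 \<ge> 0" "k2 \<ge> 0" using \<alpha> by (auto simp: k1_def k2_def)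
    have pw: "norm (trunc B g x) powr r1
        \<le> k1 * norm (trunc B g x) powr r + k2 * indicator B x" for x
    proof (cases "trunc B g x = 0")
      case True
      then show ?thesis using k r1 by simp
    next
      case False
      define u where "u = norm (trunc B g x) / \<beta>"
      have u: "u > 0" using False \<beta> by (simp add: u_def)
      have xB: "x \<in> B" using False by (auto simp: trunc_def indicator_def split: if_splits)
      have "u powr r1 = (u powr r) powr \<alpha> * 1 powr (1 - \<alpha>)"
        using rr r1 by (simp add: powr_powr \<alpha>_def)
      also have "\<dots> \<le> \<alpha> * u powr r + (1 - \<alpha>) * 1"
        using \<alpha> u by (intro Youngs_inequality_0) auto
      finally have "\<beta> powr r1 * u powr r1 \<le> \<beta> powr r1 * (\<alpha> * u powr r + (1 - \<alpha>) * 1)"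
        using \<beta> by (intro mult_left_mono) auto
      moreover have "u powr r1 = norm (trunc B g x) powr r1 / \<beta> powr r1" "u powr r = norm (trunc B g x) powr r / \<beta> powr r"
        using \<beta> by (auto simp: u_def powr_divide)
      ultimately show ?thesis using \<beta> xB by (simp add: k1_def k2_def field_simps)
    qed
    have "(\<integral>\<^sup>+x. ennreal (norm (trunc B g x) powr r1) \<partial>M)
       \<le> (\<integral>\<^sup>+x. ennreal k1 * ennreal (norm (trunc B g x) powr r)
             + ennreal k2 * indicator B x \<partial>M)"
    proof (rule nn_integral_mono)
      fix x
      have "ennreal (norm (trunc B g x) powr r1)
        \<le> ennreal (k1 * norm (trunc B g x) powr r + k2 * indicator B x)"
        by (intro ennreal_leI pw)
      also have "\<dots> = ennreal k1 * ennreal (norm (trunc B g x) powr r)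
             + ennreal k2 * indicator B x"
        using k by (subst ennreal_plus) (auto simp: ennreal_mult indicator_def)
      finally show "ennreal (norm (trunc B g x) powr r1) \<le> \<dots>" .
    qed
    also have "\<dots> = ennreal k1 * (\<integral>\<^sup>+x. ennreal (norm (trunc B g x) powr r) \<partial>M)
             + ennreal k2 * emeasure M B"
      by (simp add: nn_integral_add nn_integral_cmult nn_integral_cmult_indicator)
    also have "\<dots> \<le> ennreal k1 * ennreal (b powr r) + ennreal k2 * ennreal V"
      using that real emB by (intro add_mono mult_left_mono) (auto simp: Lp_norm_real_le_iff)
    also have "\<dots> = ennreal (k1 * b powr r + k2 * V)"
      using k V by (simp add: ennreal_mult ennreal_plus)
    also have "k1 * b powr r + k2 * V = \<beta> powr r1 * V"
    proof -
      \<comment> \<open>With this value the two integrals contribute the fractions \<alpha> and 1 -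
        \<alpha> of \<beta> powr r1 * V.\<close>
      have "\<beta> powr r = b powr r / V"
        proof -
        have "\<beta> powr r = b powr r * V powr (- 1)"
          using V that real by (simp add: \<beta>_def powr_mult powr_powr)
        then show ?thesis using V by (simp add: powr_minus divide_inverse)
      qed
      moreover have "k1 * b powr r = \<beta> powr r1 * \<alpha> * (b powr r / \<beta> powr r)" by (simp add: k1_def)
      moreover have "b powr r / \<beta> powr r = V" using calculation(1) V that by simp
      ultimately show ?thesis by (simp add: k2_def algebra_simps)
    qed
    also have "\<beta> powr r1 * V = (b * V powr (1 / r1 - \<epsilon>)) powr r1"
    proof -
      have "V powr ((1 / r1 - 1 / r) * r1) = V powr (- (1 / r) * r1) * V powr 1"
      proof -
        have "(1 / r1 - 1 / r) * r1 = - (1 / r) * r1 + 1" using r1 by (simp add: left_diff_distrib)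
        then show ?thesis by (simp only: powr_add)
      qed
      then have *: "V powr ((1 / r1 - 1 / r) * r1) = V powr (- (1 / r) * r1) * V" using V by simp
      have "\<beta> powr r1 * V = b powr r1 * (V powr (- (1 / r) * r1) * V)"
        unfolding \<beta>_def by (simp only: powr_mult powr_powr mult.assoc)
      also have "\<dots> = b powr r1 * V powr ((1 / r1 - 1 / r) * r1)" by (simp only: *)
      finally show ?thesis unfolding \<epsilon> by (simp only: powr_mult powr_powr)
    qed
    finally show ?thesis .
  next
    case infinity
    then have \<epsilon>: "\<epsilon> = 0" by (simp add: \<epsilon>_def)
    have ae: "AE x in M. norm (trunc B g x) \<le> b"
      using that infinity by (simp add: Lp_norm_infinity_le_iff)
    have "(\<integral>\<^sup>+x. ennreal (norm (trunc B g x) powr r1) \<partial>M) \<le> (\<integral>\<^sup>+x. ennreal (b powr r1) * indicator B x \<partial>M)"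
    proof (rule nn_integral_mono_AE, use ae in eventually_elim)
      fix x assume "norm (trunc B g x) \<le> b"
      then have "norm (trunc B g x) powr r1 \<le> b powr r1" using r1 by (intro powr_mono2) auto
      moreover have "trunc B g x = 0" if "x \<notin> B" using that by (simp add: trunc_def)
      ultimately show "ennreal (norm (trunc B g x) powr r1) \<le> ennreal (b powr r1) * indicator B x"
        using r1 by (cases "x \<in> B") (auto intro: ennreal_leI)
    qed
    also have "\<dots> = ennreal (b powr r1) * emeasure M B" by (simp add: nn_integral_cmult_indicator)
    also have "\<dots> \<le> ennreal (b powr r1) * ennreal V" by (intro mult_left_mono emB) auto
    also have "\<dots> = ennreal ((b * V powr (1 / r1 - \<epsilon>)) powr r1)"
      using r1 V \<epsilon> by (simp add: powr_mult powr_powr ennreal_mult)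
    finally show ?thesis .
  qed
  show ?thesis
  proof (cases "Lp_norm M p (trunc B g)" rule: ennreal_cases)
    case top
    then show ?thesis using V by (simp add: ennreal_mult_top)
  next
    case (real c)
    have "Lp_norm M p1 (trunc B g) \<le> ennreal (V powr (1 / r1 - \<epsilon>) * c)"
    proof (rule le_if_le_real_upper_bounds)
      fix b assume b: "b > 0" "ennreal (V powr (1 / r1 - \<epsilon>) * c) < ennreal b"
      then have *: "V powr (1 / r1 - \<epsilon>) * c < b" by (simp add: ennreal_less_iff real)
      define d where "d = b / V powr (1 / r1 - \<epsilon>)"
      have d: "d > 0" "c \<le> d" using b * V by (auto simp: d_def field_simps)
      then have "Lp_norm M p (trunc B g) \<le> ennreal d" by (simp add: real ennreal_leI)
      from int_B[OF d(1) this] have "Lp_norm M p1 (trunc B g) \<le> ennreal (d * V powr (1 / r1 - \<epsilon>))"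
        using r1 d V by (simp add: Lp_norm_real_le_iff)
      then show "Lp_norm M p1 (trunc B g) \<le> ennreal b" using V by (simp add: d_def)
    qed
    then show ?thesis using real r1 by (simp add: ennreal_mult \<epsilon>_def)
  qed
qed

text \<open>Log-convexity of Lebesgue norms. For finite s the hypothesis on 1 / q' says that (1 -
  \<theta>) q' / q and \<theta> q' / s sum to 1, so Young's inequality applies pointwise after
  normalization by \<open>a\<close> and \<open>b\<close>. For s = \<infinity> the factor |g|^(q' -
  q) is bounded by b^(q' - q).\<close>

lemma Lp_norm_interpolation:
  assumes q: "q \<ge> 1" and s: "s \<in> {1..\<infinity>}" and q': "q' \<ge> 1" and \<theta>: "0 < \<theta>" "\<theta> < 1"
    and eq: "1 / q' = (1 - \<theta>) / q + \<theta> * (1 / real_of_ereal s)"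
    and [measurable]: "g \<in> borel_measurable M" and ab: "a > 0" "b > 0"
    and a: "Lp_norm M (ereal q) g \<le> ennreal a" and b: "Lp_norm M s g \<le> ennreal b"
  shows "Lp_norm M (ereal q') g \<le> ennreal (a powr (1 - \<theta>) * b powr \<theta>)"
proof -
  define G where "G = a powr (1 - \<theta>) * b powr \<theta>"
  have G: "G > 0" using ab by (simp add: G_def)
  have int_a: "(\<integral>\<^sup>+x. ennreal (norm (g x) powr q) \<partial>M) \<le> ennreal (a powr q)"
    using a q ab by (simp add: Lp_norm_real_le_iff)
  have "(\<integral>\<^sup>+x. ennreal (norm (g x) powr q') \<partial>M) \<le> ennreal (G powr q')"
    using s
  proof (cases rule: exponent_cases)
    case (real r)
    define \<alpha> where "\<alpha> = (1 - \<theta>) * q' / q"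
    define \<beta> where "\<beta> = \<theta> * q' / r"
    have \<alpha>\<beta>: "\<alpha> \<ge> 0" "\<beta> \<ge> 0" using \<theta> q q' real by (auto simp: \<alpha>_def \<beta>_def)
    have sum: "\<alpha> + \<beta> = 1"
    proof -
      have "\<alpha> + \<beta> = q' * (1 / q')" unfolding eq \<alpha>_def \<beta>_def real by (simp add: algebra_simps)
      then show ?thesis using q' by simp
    qed
    have e: "q * \<alpha> = (1 - \<theta>) * q'" "r * \<beta> = \<theta> * q'" using q real by (auto simp: \<alpha>_def \<beta>_def)
    have e3: "q * \<alpha> + r * \<beta> = q'" unfolding e by (simp add: algebra_simps)
    have G': "G powr q' = (a powr q) powr \<alpha> * (b powr r) powr \<beta>"
      unfolding G_def by (simp only: powr_mult powr_powr e)
    define k1 where "k1 = G powr q' * \<alpha> / a powr q"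
    define k2 where "k2 = G powr q' * \<beta> / b powr r"
    have k: "k1 \<ge> 0" "k2 \<ge> 0" using \<alpha>\<beta> by (auto simp: k1_def k2_def)
    have pw: "norm (g x) powr q' \<le> k1 * norm (g x) powr q + k2 * norm (g x) powr r" for x
    proof (cases "g x = 0")
      case True
      then show ?thesis using q' by simp
    next
      case False
      define X where "X = norm (g x) powr q / a powr q"
      define Y where "Y = norm (g x) powr r / b powr r"
      have XY: "X > 0" "Y > 0" using False ab by (auto simp: X_def Y_def)
      have "norm (g x) powr q' = (norm (g x) powr q) powr \<alpha> * (norm (g x) powr r) powr \<beta>"
        by (simp only: powr_powr powr_add[symmetric] e3)
      also have "\<dots> = G powr q' * (X powr \<alpha> * Y powr \<beta>)"
        using ab by (simp add: G' X_def Y_def powr_divide)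
      also have "\<dots> \<le> G powr q' * (\<alpha> * X + \<beta> * Y)"
        using \<alpha>\<beta> sum XY by (intro mult_left_mono Youngs_inequality_0) auto
      also have "\<dots> = k1 * norm (g x) powr q + k2 * norm (g x) powr r"
        by (simp add: k1_def k2_def X_def Y_def algebra_simps)
      finally show ?thesis .
    qed
    have "(\<integral>\<^sup>+x. ennreal (norm (g x) powr q') \<partial>M)
        \<le> (\<integral>\<^sup>+x. ennreal k1 * ennreal (norm (g x) powr q) + ennreal k2 * ennreal (norm (g x) powr r) \<partial>M)"
    proof (rule nn_integral_mono)
      fix x
      show "ennreal (norm (g x) powr q') \<le> ennreal k1 * ennreal (norm (g x) powr q) + ennreal k2 * ennreal (norm (g x) powr r)"
        using pw[of x] k by (simp add: ennreal_mult[symmetric] ennreal_plus[symmetric] ennreal_leI del: ennreal_plus)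
    qed
    also have "\<dots> = ennreal k1 * (\<integral>\<^sup>+x. ennreal (norm (g x) powr q) \<partial>M) + ennreal k2 * (\<integral>\<^sup>+x. ennreal (norm (g x) powr r) \<partial>M)"
      by (simp add: nn_integral_add nn_integral_cmult)
    also have "\<dots> \<le> ennreal k1 * ennreal (a powr q) + ennreal k2 * ennreal (b powr r)"
      using b ab real int_a by (intro add_mono mult_left_mono) (auto simp: Lp_norm_real_le_iff)
    also have "\<dots> = ennreal (k1 * a powr q + k2 * b powr r)"
      using k by (simp add: ennreal_mult)
    also have "k1 * a powr q + k2 * b powr r = G powr q' * (\<alpha> + \<beta>)"
      using ab by (simp add: k1_def k2_def algebra_simps)
    finally show ?thesis by (simp add: sum)
  next
    case infinity
    then have ae: "AE x in M. norm (g x) \<le> b" using b ab by (simp add: Lp_norm_infinity_le_iff)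
    \<comment> \<open>Here \<open>1 / real_of_ereal s\<close> is 0, so \<open>eq\<close> reads 1 /
      q' = (1 - \<theta>) / q.\<close>
    have qq: "q = (1 - \<theta>) * q'" using eq infinity q q' by (simp add: field_simps)
    have le: "q \<le> q'" using \<theta> q' unfolding qq by (intro mult_left_le_one_le) auto
    have e: "q' - q = \<theta> * q'" by (simp add: qq algebra_simps)
    have "(\<integral>\<^sup>+x. ennreal (norm (g x) powr q') \<partial>M)
        \<le> (\<integral>\<^sup>+x. ennreal (b powr (q' - q)) * ennreal (norm (g x) powr q) \<partial>M)"
    proof (rule nn_integral_mono_AE, use ae in eventually_elim)
      fix x assume *: "norm (g x) \<le> b"
      have "norm (g x) powr q' = norm (g x) powr (q' - q) * norm (g x) powr q"
        by (simp only: powr_add[symmetric]) simp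
      also have "\<dots> \<le> b powr (q' - q) * norm (g x) powr q"
        using * le by (intro mult_right_mono powr_mono2) auto
      finally show "ennreal (norm (g x) powr q') \<le> ennreal (b powr (q' - q)) * ennreal (norm (g x) powr q)"
        by (simp add: ennreal_mult[symmetric] ennreal_leI)
    qed
    also have "\<dots> = ennreal (b powr (q' - q)) * (\<integral>\<^sup>+x. ennreal (norm (g x) powr q) \<partial>M)"
      by (simp add: nn_integral_cmult)
    also have "\<dots> \<le> ennreal (b powr (q' - q)) * ennreal (a powr q)"
      using int_a by (intro mult_left_mono) auto
    also have "\<dots> = ennreal (G powr q')"
    proof -
      have "G powr q' = a powr q * b powr (q' - q)"
        unfolding G_def e by (subst qq) (simp only: powr_mult powr_powr)
      then show ?thesis by (simp add: ennreal_mult[symmetric] mult.commute)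
    qed
    finally show ?thesis .
  qed
  then show ?thesis using q' G by (simp add: Lp_norm_real_le_iff G_def[symmetric])
qed

lemma Lp_norm_bounded_support:
  assumes p: "p \<in> {1..\<infinity>}" and [measurable]: "f \<in> borel_measurable M" "E \<in> sets M"
    and h: "h \<ge> 0" "\<And>x. x \<in> E \<Longrightarrow> norm (f x) \<le> h" and m: "m > 0" "emeasure M E \<le> ennreal m"
  shows "Lp_norm M p (trunc E f) \<le> ennreal (h * m powr (1 / real_of_ereal p))"
  using p
proof (cases rule: exponent_cases)
  case (real r)
  have "(\<integral>\<^sup>+x. ennreal (norm (trunc E f x) powr r) \<partial>M) \<le> (\<integral>\<^sup>+x. ennreal (h powr r) * indicator E x \<partial>M)"
    using h real by (intro nn_integral_mono) (auto simp: trunc_def indicator_def intro!: ennreal_leI powr_mono2)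
  also have "\<dots> = ennreal (h powr r) * emeasure M E" by (simp add: nn_integral_cmult_indicator)
  also have "\<dots> \<le> ennreal (h powr r) * ennreal m" using m by (intro mult_left_mono) auto
  also have "\<dots> = ennreal ((h * m powr (1 / r)) powr r)"
    using m real by (simp add: powr_mult powr_powr ennreal_mult)
  finally show ?thesis using real h by (simp add: Lp_norm_real_le_iff)
next
  case infinity
  then show ?thesis using h m by (auto simp: Lp_norm_infinity_le_iff trunc_def indicator_def)
qed

lemma trunc_UN_disjoint:
  assumes "finite I" "disjoint_family_on P I"
  shows "trunc (\<Union>i\<in>I. P i) f = (\<lambda>x. \<Sum>i\<in>I. trunc (P i) f x)"
  using assms by (simp add: trunc_def indicator_UN_disjoint sum_distrib_right)

lemma nn_integral_trunc_UN_disjoint: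
  assumes I: "finite I" "disjoint_family_on P I" and [measurable]: "\<And>i. i \<in> I \<Longrightarrow> P i \<in> sets M" "f \<in> borel_measurable M"
    and r: "r > 0"
  shows "(\<integral>\<^sup>+x. ennreal (norm (trunc (\<Union>i\<in>I. P i) f x) powr r) \<partial>M)
    = (\<Sum>i\<in>I. \<integral>\<^sup>+x. ennreal (norm (trunc (P i) f x) powr r) \<partial>M)"
proof -
  have e: "ennreal (norm (trunc E f x) powr r) = indicator E x * ennreal (norm (f x) powr r)" for E x
    using r by (simp add: trunc_def indicator_def)
  have "(\<integral>\<^sup>+x. ennreal (norm (trunc (\<Union>i\<in>I. P i) f x) powr r) \<partial>M)
     = (\<integral>\<^sup>+x. (\<Sum>i\<in>I. ennreal (norm (trunc (P i) f x) powr r)) \<partial>M)"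
    using I by (simp add: e indicator_UN_disjoint sum_distrib_right)
  also have "\<dots> = (\<Sum>i\<in>I. \<integral>\<^sup>+x. ennreal (norm (trunc (P i) f x) powr r) \<partial>M)"
    by (rule nn_integral_sum) simp
  finally show ?thesis .
qed

text \<open>Since 1 / \<infinity> counts as 0, one formula covers all exponents;
  \<open>V > 0\<close> stays clear of the value 0 / 0 in the average.\<close>

lemma Lp_avg_eq:
  assumes p: "p \<in> {1..\<infinity>}" and A: "emeasure M A = ennreal V" "V > 0" and [measurable]: "f \<in> borel_measurable M" "E \<in> sets M"
  shows "Lp_avg M p A E f = ennreal (V powr (- (1 / real_of_ereal p))) * Lp_norm M p (trunc E f)"
  using p
proof (cases rule: exponent_cases)
  case (real r)
  have "(\<integral>\<^sup>+x\<in>E. ennreal (norm (f x) powr r) \<partial>M) = (\<integral>\<^sup>+x. ennreal (norm (trunc E f x) powr r) \<partial>M)"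
    using real by (intro nn_integral_cong) (auto simp: trunc_def indicator_def)
  moreover have "epowr (I / ennreal V) (1 / r) = ennreal (V powr (- (1 / r))) * epowr I (1 / r)" for I
  proof (cases I rule: ennreal_cases)
    case (real i)
    then show ?thesis using A
      by (simp add: epowr_def divide_ennreal powr_divide powr_minus ennreal_mult[symmetric] field_simps)
  next
    case top
    then show ?thesis using A by (simp add: epowr_def ennreal_top_divide ennreal_mult_top)
  qed
  ultimately show ?thesis using real A by (simp add: Lp_avg_def Lp_norm_def)
next
  case infinity
  have "(\<lambda>x. ennreal (norm (f x)) * indicator E x) = (\<lambda>x. ennreal (norm (trunc E f x)))"
    by (auto simp: trunc_def indicator_def)
  then show ?thesis using infinity A by (simp add: Lp_avg_def Lp_norm_def)
qed

text \<open>From ln (1 + u) \<le> u and the completed square D u \<le> D^2 / (4 \<epsilon>) +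
  \<epsilon> u^2. This is how polynomial losses are absorbed by a small part of a Gaussian.\<close>

lemma one_plus_powr_le_exp_square:
  fixes D \<epsilon> :: real
  assumes "D \<ge> 0" "\<epsilon> > 0"
  obtains K where "K \<ge> 1" "\<And>u. u \<ge> 0 \<Longrightarrow> (1 + u) powr D \<le> K * exp (\<epsilon> * u\<^sup>2)"
proof
  show "exp (D\<^sup>2 / (4 * \<epsilon>)) \<ge> 1" using assms by simp
  fix u :: real assume u: "u \<ge> 0"
  have "(1 + u) powr D = exp (D * ln (1 + u))" using u by (simp add: powr_def)
  also have "\<dots> \<le> exp (D * u)" using u assms ln_add_one_self_le_self[of u] by (simp add: mult_left_mono)
  also have "D * u \<le> D\<^sup>2 / (4 * \<epsilon>) + \<epsilon> * u\<^sup>2"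
  proof -
    have "0 \<le> (D / (2 * \<epsilon>) - u)\<^sup>2 * \<epsilon>" using assms by simp
    also have "\<dots> = D\<^sup>2 / (4 * \<epsilon>) + \<epsilon> * u\<^sup>2 - D * u" using assms by (simp add: power2_eq_square field_simps)
    finally show ?thesis by simp
  qed
  finally show "(1 + u) powr D \<le> exp (D\<^sup>2 / (4 * \<epsilon>)) * exp (\<epsilon> * u\<^sup>2)" by (simp add: exp_add)
qed

text \<open>Jensen's inequality for the probability weights w i / S, where S is the total weight;
  rescaling costs S^(r - 1) \<le> W^(r - 1). It is the convexity step of the Schur test, where row
  sums are known only up to an upper bound.\<close>

lemma powr_weighted_sum_le:
  fixes w a :: "'i \<Rightarrow> real"
  assumes I: "finite I" and w: "\<And>i. i \<in> I \<Longrightarrow> w i \<ge> 0" and a: "\<And>i. i \<in> I \<Longrightarrow> a i \<ge> 0" and r: "r \<ge> 1"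
    and W: "(\<Sum>i\<in>I. w i) \<le> W" "W > 0"
  shows "(\<Sum>i\<in>I. w i * a i) powr r \<le> W powr (r - 1) * (\<Sum>i\<in>I. w i * a i powr r)"
proof (cases "(\<Sum>i\<in>I. w i) = 0")
  case True
  then have "\<And>i. i \<in> I \<Longrightarrow> w i = 0" using I w by (simp add: sum_nonneg_eq_0_iff)
  then show ?thesis using r by simp
next
  case False
  define S where "S = (\<Sum>i\<in>I. w i)"
  have S: "S > 0" "S \<le> W" using False W sum_nonneg[of I w] w by (auto simp: S_def less_le)
  have ne: "I \<noteq> {}" using False by auto
  have "(\<Sum>i\<in>I. (w i / S) *\<^sub>R a i) powr r \<le> (\<Sum>i\<in>I. (w i / S) * (a i powr r))"
    by (rule convex_on_sum[OF I ne convex_on_powr_nonneg[OF r]])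
      (use w a S in \<open>auto simp: S_def sum_divide_distrib[symmetric]\<close>)
  then have *: "((\<Sum>i\<in>I. w i * a i) / S) powr r \<le> (\<Sum>i\<in>I. w i * a i powr r) / S"
    by (simp add: sum_divide_distrib)
  have nn: "(\<Sum>i\<in>I. w i * a i powr r) \<ge> 0" using w by (intro sum_nonneg) auto
  have "(\<Sum>i\<in>I. w i * a i) powr r = S powr r * ((\<Sum>i\<in>I. w i * a i) / S) powr r"
    using S by (simp add: powr_divide)
  also have "\<dots> \<le> S powr r * ((\<Sum>i\<in>I. w i * a i powr r) / S)" by (intro mult_left_mono *) auto
  also have "\<dots> = S powr (r - 1) * (\<Sum>i\<in>I. w i * a i powr r)" using S by (simp add: powr_diff)
  also have "\<dots> \<le> W powr (r - 1) * (\<Sum>i\<in>I. w i * a i powr r)"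
    using S r nn by (intro mult_right_mono powr_mono2) auto
  finally show ?thesis .
qed

section \<open>Geometry of doubling measures\<close>

text \<open>The non-strict inequality fits open balls: a point outside every
  \<open>ball z \<rho>\<close> with z in F can be added to F.\<close>

definition separated :: "real \<Rightarrow> 'a::metric_space set \<Rightarrow> bool" where
  "separated \<rho> F \<longleftrightarrow> (\<forall>a\<in>F. \<forall>b\<in>F. a \<noteq> b \<longrightarrow> \<rho> \<le> dist a b)"

text \<open>The nondegenerate case, in which ball volumes are positive reals and may be divided by.
  The other case is trivial, see \<open>null_if_null_ball\<close>.\<close>

locale doubling_measure = homogeneous_type M for M :: "'a::metric_space measure" +
  assumes ball_nonnull: "r > 0 \<Longrightarrow> emeasure M (ball x r) \<noteq> 0"
begin

definition vol :: "'a \<Rightarrow> real \<Rightarrow> real" where "vol x r = measure M (ball x r)"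

lemma ball_sets [measurable]: "ball x r \<in> sets M"
  by (simp add: sets_borel)

lemma emeasure_ball: "r > 0 \<Longrightarrow> emeasure M (ball x r) = ennreal (vol x r)"
  using finite_ball[of r x] by (simp add: vol_def emeasure_eq_ennreal_measure)

lemma vol_pos: "r > 0 \<Longrightarrow> vol x r > 0"
  using ball_nonnull[of r x] emeasure_ball[of r x] by (metis ennreal_eq_0_iff not_less)

lemma vol_mono: "r > 0 \<Longrightarrow> s > 0 \<Longrightarrow> ball x r \<subseteq> ball y s \<Longrightarrow> vol x r \<le> vol y s"
  unfolding vol_def using finite_ball[of s y] by (intro measure_mono_fmeasurable) (auto simp: fmeasurable_def)

lemma ball_subset_ball_add_dist: "ball x R \<subseteq> ball y (R + dist x y)"
proof
  fix z assume "z \<in> ball x R"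
  then show "z \<in> ball y (R + dist x y)"
    using dist_triangle[of y z x] by (simp add: dist_commute)
qed

text \<open>Doubling is iterated n times, where 2^n lies between 1 + R/r and twice that; then C^n =
  (2^n)^(log 2 C) is polynomial in R/r. A change of centre only enlarges the radius by the
  distance.\<close>

lemma volume_growth:
  "\<exists>D\<ge>0. \<forall>x y. \<forall>r>0. \<forall>R>0. vol x R \<le> (2 + (R + dist x y) / r) powr D * vol y r"
proof -
  from doubling obtain C0 :: real where C0: "\<And>x r. r > 0 \<Longrightarrow> emeasure M (ball x (2 * r)) \<le> ennreal C0 * emeasure M (ball x r)"
    by auto
  \<comment> \<open>The doubling constant is an arbitrary real; the maximum with 1 makes
    \<open>log 2 C\<close> nonnegative.\<close>
  define C where "C = max 1 C0"
  have dbl: "vol x (2 * r) \<le> C * vol x r" if "r > 0" for x r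
  proof -
    have "ennreal (vol x (2 * r)) \<le> ennreal C0 * ennreal (vol x r)"
      using C0[of r x] that by (simp add: emeasure_ball)
    also have "\<dots> \<le> ennreal C * ennreal (vol x r)"
      by (intro mult_right_mono ennreal_leI) (auto simp: C_def)
    also have "\<dots> = ennreal (C * vol x r)" using vol_pos[OF that, of x] by (simp add: C_def ennreal_mult)
    finally show ?thesis
      using vol_pos[OF that, of x] by (subst (asm) ennreal_le_iff) (auto simp: C_def)
  qed
  have C1: "C \<ge> 1" by (simp add: C_def)
  have pow: "vol x (2 ^ n * r) \<le> C ^ n * vol x r" if "r > 0" for x r n
  proof (induction n)
    case (Suc n)
    have "vol x (2 ^ Suc n * r) \<le> C * vol x (2 ^ n * r)"
      using dbl[of "2 ^ n * r" x] that by (simp add: mult.assoc)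
    also have "\<dots> \<le> C * (C ^ n * vol x r)" using Suc C1 by (intro mult_left_mono) auto
    finally show ?case by (simp add: mult.assoc)
  qed simp
  define d where "d = log 2 C"
  have d: "d \<ge> 0" "C = 2 powr d" using C1 by (auto simp: d_def)
  have main: "vol x R \<le> (2 + R / r) powr (2 * d) * vol x r" if "r > 0" "R > 0" for x r R
  proof -
    define n where "n = nat \<lceil>log 2 (1 + R / r)\<rceil>"
    define u where "u = R / r"
    have u: "u > 0" using that by (simp add: u_def)
    have "log 2 (1 + u) \<le> real n" unfolding n_def u_def by linarith
    then have "1 + u \<le> 2 powr real n" using u by (simp add: log_le_iff)
    then have n1: "1 + u \<le> 2 ^ n" by (simp add: powr_realpow)
    have "0 \<le> log 2 (1 + u)" using u by simp
    then have "real n \<le> log 2 (1 + u) + 1" unfolding n_def u_def by linarith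
    then have "2 powr real n \<le> 2 powr (log 2 (1 + u) + 1)" by (intro powr_mono) auto
    also have "\<dots> = 2 * (1 + u)" using u by (simp add: powr_add)
    \<comment> \<open>A crude bound that leaves the single base 2 + u, at the price of doubling the
      exponent.\<close>
    also have "\<dots> \<le> (2 + u) powr 2" using u by (simp add: power2_eq_square algebra_simps)
    finally have n2: "2 powr real n \<le> (2 + u) powr 2" .
    have "R \<le> 2 ^ n * r" using n1 that by (simp add: u_def field_simps)
    then have "vol x R \<le> vol x (2 ^ n * r)" using that by (intro vol_mono) auto
    also have "\<dots> \<le> C ^ n * vol x r" by (rule pow[OF that(1)])
    also have "C ^ n = (2 powr real n) powr d" unfolding d(2) by (simp add: powr_powr powr_realpow[symmetric] mult.commute)
    also have "\<dots> \<le> ((2 + u) powr 2) powr d" using n2 d by (intro powr_mono2) auto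
    also have "\<dots> = (2 + u) powr (2 * d)" by (simp only: powr_powr)
    finally show ?thesis using vol_pos[OF that(1), of x] by (simp add: u_def mult_right_mono)
  qed
  show ?thesis
  proof (intro exI[of _ "2 * d"] conjI allI impI)
    fix x y :: 'a and r R :: real assume rR: "r > 0" "R > 0"
    have "R + dist x y > 0" using rR by (simp add: add_pos_nonneg)
    then have "vol x R \<le> vol y (R + dist x y)"
      using rR by (intro vol_mono ball_subset_ball_add_dist)
    also have "\<dots> \<le> (2 + (R + dist x y) / r) powr (2 * d) * vol y r"
      using rR \<open>R + dist x y > 0\<close> by (intro main)
    finally show "vol x R \<le> (2 + (R + dist x y) / r) powr (2 * d) * vol y r" .
  qed (use d in simp)
qed

text \<open>An upper homogeneous dimension of \<open>M\<close>. It is fixed by choice because it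
  comes from the doubling constant, which is only known to exist.\<close>

definition dim :: real where
  "dim = (SOME D. D \<ge> 0 \<and> (\<forall>x y. \<forall>r>0. \<forall>R>0. vol x R \<le> (2 + (R + dist x y) / r) powr D * vol y r))"

lemma dim_nonneg: "dim \<ge> 0"
  and volume_comparison: "r > 0 \<Longrightarrow> R > 0 \<Longrightarrow> vol x R \<le> (2 + (R + dist x y) / r) powr dim * vol y r"
  using someI_ex[OF volume_growth] unfolding dim_def by blast+

text \<open>At equal radii and distance u \<rho> the volumes differ by a factor polynomial in u,
  which the Gaussian absorbs. The exponent \<alpha> accommodates the powers of volumes in the
  off-diagonal bounds.\<close>

lemma volume_comparison_gauss:
  assumes "\<alpha> \<ge> 0" "\<epsilon> > 0"
  obtains K where "K \<ge> 1"
    "\<And>x y \<rho>. \<rho> > 0 \<Longrightarrow> vol x \<rho> powr \<alpha> \<le> K * exp (\<epsilon> * (dist x y / \<rho>)\<^sup>2) * vol y \<rho> powr \<alpha>"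
proof -
  obtain K where K: "K \<ge> 1" "\<And>u::real. u \<ge> 0 \<Longrightarrow> (1 + u) powr (dim * \<alpha>) \<le> K * exp (\<epsilon> * u\<^sup>2)"
    using one_plus_powr_le_exp_square[of "dim * \<alpha>" \<epsilon>] assms dim_nonneg by (metis mult_nonneg_nonneg)
  define K' where "K' = 3 powr (dim * \<alpha>) * K"
  have "3 powr (dim * \<alpha>) \<ge> 1" using assms dim_nonneg by (intro ge_one_powr_ge_zero) auto
  then have "K' \<ge> 1" using K(1) mult_mono[of 1 "3 powr (dim * \<alpha>)" 1 K] by (simp add: K'_def)
  moreover have "vol x \<rho> powr \<alpha> \<le> K' * exp (\<epsilon> * (dist x y / \<rho>)\<^sup>2) * vol y \<rho> powr \<alpha>" if "\<rho> > 0" for x y \<rho>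
  proof -
    define u where "u = dist x y / \<rho>"
    have u: "u \<ge> 0" using that by (simp add: u_def)
    have "2 + (\<rho> + dist x y) / \<rho> \<le> 3 * (1 + u)" using that u by (simp add: u_def field_simps)
    moreover have "0 \<le> 2 + (\<rho> + dist x y) / \<rho>" using that by (simp add: add_nonneg_nonneg)
    ultimately have "(2 + (\<rho> + dist x y) / \<rho>) powr dim \<le> (3 * (1 + u)) powr dim"
      using dim_nonneg by (intro powr_mono2)
    then have "vol x \<rho> \<le> (3 * (1 + u)) powr dim * vol y \<rho>"
      using volume_comparison[OF that that, of x y] vol_pos[OF that, of y]
      by (meson less_imp_le mult_right_mono order_trans)
    then have "vol x \<rho> powr \<alpha> \<le> ((3 * (1 + u)) powr dim * vol y \<rho>) powr \<alpha>"
      using assms vol_pos[OF that, of x] by (intro powr_mono2) auto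
    also have "\<dots> = 3 powr (dim * \<alpha>) * (1 + u) powr (dim * \<alpha>) * vol y \<rho> powr \<alpha>"
      by (simp only: powr_mult powr_powr)
    also have "\<dots> \<le> 3 powr (dim * \<alpha>) * (K * exp (\<epsilon> * u\<^sup>2)) * vol y \<rho> powr \<alpha>"
      using K(2)[OF u] by (intro mult_right_mono mult_left_mono) auto
    finally show ?thesis by (simp add: K'_def u_def mult.assoc)
  qed
  ultimately show ?thesis by (rule that)
qed

text \<open>Packing: the balls of radius \<rho> / 2 about points of F are disjoint, lie in one ball
  of radius R + \<rho> / 2, and by volume comparison each takes at least a fixed fraction of its
  volume.\<close>

lemma card_separated_le:
  fixes x :: 'a
  assumes F: "finite F" "separated \<rho> F" "F \<subseteq> ball x R" and pos: "\<rho> > 0" "R > 0"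
  shows "real (card F) \<le> (3 + 4 * R / \<rho>) powr dim"
proof -
  \<comment> \<open>For dist x z \<le> R the ratio 2 + (R + \<rho> / 2 + dist x z) / (\<rho> / 2) is
    at most 3 + 4 R / \<rho>.\<close>
  define L where "L = (3 + 4 * R / \<rho>) powr dim"
  have "3 + 4 * R / \<rho> > 0" using pos by (simp add: add_pos_nonneg)
  then have L: "L > 0" by (simp add: L_def)
  define S where "S = vol x (R + \<rho> / 2)"
  have S: "S > 0" using pos by (simp add: S_def vol_pos)
  have each: "S / L \<le> measure M (ball z (\<rho> / 2))" if "z \<in> F" for z
  proof -
    have "dist x z \<le> R" using that F by auto
    have "S \<le> (2 + (R + \<rho> / 2 + dist x z) / (\<rho> / 2)) powr dim * vol z (\<rho> / 2)"
      unfolding S_def using pos by (intro volume_comparison) auto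
    also have "\<dots> \<le> L * vol z (\<rho> / 2)"
      unfolding L_def
    proof (intro mult_right_mono powr_mono2 dim_nonneg)
      show "2 + (R + \<rho> / 2 + dist x z) / (\<rho> / 2) \<le> 3 + 4 * R / \<rho>"
        using \<open>dist x z \<le> R\<close> pos by (simp add: field_simps)
      show "0 \<le> 2 + (R + \<rho> / 2 + dist x z) / (\<rho> / 2)" using pos by (simp add: add_nonneg_nonneg)
      show "0 \<le> vol z (\<rho> / 2)" by (simp add: vol_def)
    qed
    finally show ?thesis using L by (simp add: vol_def field_simps)
  qed
  have disj: "disjoint_family_on (\<lambda>z. ball z (\<rho> / 2)) F"
    unfolding disjoint_family_on_def
  proof (intro ballI impI)
    fix a b assume ab: "a \<in> F" "b \<in> F" "a \<noteq> b"
    then have "\<rho> \<le> dist a b" using F by (auto simp: separated_def)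
    show "ball a (\<rho> / 2) \<inter> ball b (\<rho> / 2) = {}"
    proof (rule ccontr)
      assume "ball a (\<rho> / 2) \<inter> ball b (\<rho> / 2) \<noteq> {}"
      then obtain c where "dist a c < \<rho> / 2" "dist b c < \<rho> / 2" by auto
      then have "dist a b < \<rho>" using dist_triangle[of a b c] by (simp add: dist_commute)
      with \<open>\<rho> \<le> dist a b\<close> show False by simp
    qed
  qed
  have "real (card F) * (S / L) = (\<Sum>z\<in>F. S / L)" by simp
  also have "\<dots> \<le> (\<Sum>z\<in>F. measure M (ball z (\<rho> / 2)))" by (intro sum_mono each)
  also have "\<dots> = measure M (\<Union>z\<in>F. ball z (\<rho> / 2))"
  proof (rule measure_finite_Union[symmetric, OF F(1) _ disj])
    show "emeasure M (ball z (\<rho> / 2)) \<noteq> \<infinity>" if "z \<in> F" for z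
      using finite_ball[of "\<rho> / 2" z] pos by simp
  qed auto
  also have "\<dots> \<le> S"
    unfolding S_def vol_def
  proof (rule measure_mono_fmeasurable)
    show "ball x (R + \<rho> / 2) \<in> fmeasurable M"
      using finite_ball[of "R + \<rho> / 2" x] pos by (auto simp: fmeasurable_def)
    show "(\<Union>z\<in>F. ball z (\<rho> / 2)) \<in> sets M" using F(1) by (intro sets.finite_UN) auto
    show "(\<Union>z\<in>F. ball z (\<rho> / 2)) \<subseteq> ball x (R + \<rho> / 2)"
    proof
      fix w assume "w \<in> (\<Union>z\<in>F. ball z (\<rho> / 2))"
      then obtain z where "z \<in> F" "dist z w < \<rho> / 2" by auto
      moreover then have "dist x z < R" using F by auto
      ultimately show "w \<in> ball x (R + \<rho> / 2)" using dist_triangle[of x w z] by simp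
    qed
  qed
  finally have "real (card F) \<le> L" using S L by (simp add: field_simps)
  then show ?thesis by (simp add: L_def)
qed

text \<open>A separated set of maximal cardinality exists by the packing bound, and maximality makes
  it a net.\<close>

lemma finite_net:
  fixes x :: 'a
  assumes "\<rho> > 0" "R > 0"
  obtains F where "finite F" "separated \<rho> F" "F \<subseteq> ball x R" "ball x R \<subseteq> (\<Union>z\<in>F. ball z \<rho>)"
proof -
  define P where "P F \<longleftrightarrow> finite F \<and> separated \<rho> F \<and> F \<subseteq> ball x R" for F
  define m where "m = nat \<lceil>(3 + 4 * R / \<rho>) powr dim\<rceil>"
  have bound: "card F < Suc m" if "P F" for F
  proof -
    have "real (card F) \<le> (3 + 4 * R / \<rho>) powr dim"
      using that assms by (intro card_separated_le) (auto simp: P_def)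
    then have "real (card F) \<le> real m" unfolding m_def by linarith
    then show ?thesis by simp
  qed
  have "P {}" by (simp add: P_def separated_def)
  then obtain F where F: "P F" "\<And>G. P G \<Longrightarrow> card G \<le> card F"
    using ex_has_greatest_nat[of P "{}" card "Suc m"] bound by (metis less_imp_le)
  have "ball x R \<subseteq> (\<Union>z\<in>F. ball z \<rho>)"
  proof
    fix w assume w: "w \<in> ball x R"
    show "w \<in> (\<Union>z\<in>F. ball z \<rho>)"
    proof (rule ccontr)
      assume "w \<notin> (\<Union>z\<in>F. ball z \<rho>)"
      then have far: "\<And>z. z \<in> F \<Longrightarrow> \<rho> \<le> dist z w" by (auto simp: not_less)
      then have "w \<notin> F" using assms by force
      have "P (insert w F)" using F(1) far w by (auto simp: P_def separated_def dist_commute)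
      then show False using F(2)[of "insert w F"] F(1) \<open>w \<notin> F\<close> by (simp add: P_def)
    qed
  qed
  then show ?thesis using F(1) that by (auto simp: P_def)
qed

text \<open>Points at distance between n \<rho> and (n + 1) \<rho> from x are at most polynomially
  many in n by packing, and the Gaussian beats this count. The bound W is independent of the net,
  its scale and the centre; it bounds the row and column sums in the Schur test and the sum over
  intermediate cells in the composition.\<close>

lemma gauss_sum_bound:
  assumes "c > 0"
  obtains W where "W > 0"
    "\<And>\<rho> F (x::'a). \<rho> > 0 \<Longrightarrow> finite F \<Longrightarrow> separated \<rho> F \<Longrightarrow> (\<Sum>z\<in>F. exp (- c * (dist x z / \<rho>)\<^sup>2)) \<le> W"
proof -
  obtain K where K: "K \<ge> 1" "\<And>u::real. u \<ge> 0 \<Longrightarrow> (1 + u) powr dim \<le> K * exp (c / 2 * u\<^sup>2)"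
    using one_plus_powr_le_exp_square[of dim "c / 2"] assms dim_nonneg by (metis half_gt_zero)
  \<comment> \<open>Half of the Gaussian absorbs the count of points; the other half is at most q ^
    n because n \<le> n^2.\<close>
  define q where "q = exp (- (c / 2))"
  have q: "0 < q" "q < 1" using assms by (auto simp: q_def)
  define K' where "K' = 7 powr dim * K"
  have K': "K' > 0" using K by (simp add: K'_def)
  have decay: "exp (- c * (real n)\<^sup>2) * (3 + 4 * (real n + 1)) powr dim \<le> K' * q ^ n" for n
  proof -
    have "(3 + 4 * (real n + 1)) powr dim \<le> (7 * (1 + real n)) powr dim"
      using dim_nonneg by (intro powr_mono2) auto
    also have "\<dots> = 7 powr dim * (1 + real n) powr dim" by (simp only: powr_mult)
    also have "\<dots> \<le> 7 powr dim * (K * exp (c / 2 * (real n)\<^sup>2))" by (intro mult_left_mono K) auto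
    finally have "exp (- c * (real n)\<^sup>2) * (3 + 4 * (real n + 1)) powr dim
      \<le> exp (- c * (real n)\<^sup>2) * (7 powr dim * (K * exp (c / 2 * (real n)\<^sup>2)))" by (intro mult_left_mono) auto
    also have "\<dots> = K' * (exp (- c * (real n)\<^sup>2) * exp (c / 2 * (real n)\<^sup>2))" by (simp add: K'_def)
    also have "exp (- c * (real n)\<^sup>2) * exp (c / 2 * (real n)\<^sup>2) = exp (- (c / 2) * (real n)\<^sup>2)"
      by (simp add: exp_add[symmetric])
    also have "\<dots> \<le> exp (real n * (- (c / 2)))"
    proof -
      have "real n \<le> (real n)\<^sup>2" by (cases n) (auto simp: power2_eq_square)
      then have "(c / 2) * real n \<le> (c / 2) * (real n)\<^sup>2" using assms by (intro mult_left_mono) auto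
      then show ?thesis by (simp add: mult.commute)
    qed
    also have "\<dots> = q ^ n" by (simp only: q_def exp_of_nat_mult)
    finally show ?thesis using K' by simp
  qed
  define W where "W = K' * (1 / (1 - q))"
  have "W > 0" using K' q by (simp add: W_def)
  moreover have "(\<Sum>z\<in>F. exp (- c * (dist x z / \<rho>)\<^sup>2)) \<le> W"
    if \<rho>: "\<rho> > 0" and F: "finite F" "separated \<rho> F" for \<rho> F and x :: 'a
  proof -
    define g where "g z = nat \<lfloor>dist x z / \<rho>\<rfloor>" for z
    have g: "real (g z) \<le> dist x z / \<rho>" "dist x z / \<rho> < real (g z) + 1" for z
    proof -
      have "0 \<le> dist x z / \<rho>" using \<rho> by simp
      then show "real (g z) \<le> dist x z / \<rho>" "dist x z / \<rho> < real (g z) + 1" unfolding g_def by linarith+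
    qed
    obtain m where m: "g ` F \<subseteq> {..<m}" using finite_nat_bounded[of "g ` F"] F by auto
    have "(\<Sum>z\<in>F. exp (- c * (dist x z / \<rho>)\<^sup>2)) \<le> (\<Sum>z\<in>F. exp (- c * (real (g z))\<^sup>2))"
      using assms g by (intro sum_mono) (auto intro!: power_mono)
    also have "\<dots> = (\<Sum>n<m. \<Sum>z\<in>{z\<in>F. g z = n}. exp (- c * (real (g z))\<^sup>2))"
      using F m by (intro sum.group[symmetric]) auto
    also have "\<dots> = (\<Sum>n<m. exp (- c * (real n)\<^sup>2) * real (card {z\<in>F. g z = n}))"
      by (intro sum.cong) auto
    also have "\<dots> \<le> (\<Sum>n<m. exp (- c * (real n)\<^sup>2) * (3 + 4 * (real n + 1)) powr dim)"
    proof (intro sum_mono mult_left_mono)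
      fix n
      have "real (card {z\<in>F. g z = n}) \<le> (3 + 4 * ((real n + 1) * \<rho>) / \<rho>) powr dim"
      proof (rule card_separated_le)
        show "{z \<in> F. g z = n} \<subseteq> ball x ((real n + 1) * \<rho>)"
          using g(2) \<rho> by (auto simp: field_simps)
      qed (use F \<rho> in \<open>auto simp: separated_def\<close>)
      then show "real (card {z\<in>F. g z = n}) \<le> (3 + 4 * (real n + 1)) powr dim" using \<rho> by simp
    qed auto
    also have "\<dots> \<le> (\<Sum>n<m. K' * q ^ n)" by (intro sum_mono decay)
    also have "\<dots> = K' * (\<Sum>n<m. q ^ n)" by (simp add: sum_distrib_left)
    also have "\<dots> \<le> K' * (\<Sum>n. q ^ n)"
      using q K' by (intro mult_left_mono sum_le_suminf summable_geometric) auto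
    also have "\<dots> = W" using q by (simp add: W_def suminf_geometric)
    finally show ?thesis .
  qed
  ultimately show ?thesis by (rule that)
qed

text \<open>Cells are cut out one ball at a time, so that norms and \<open>T t\<close> decompose
  into pieces each supported in one ball of the net. Some cells may be empty.\<close>

lemma disjoint_refinement:
  assumes "finite F" "E \<in> sets M" "E \<subseteq> (\<Union>z\<in>F. ball z \<rho>)"
  obtains P where "\<And>z. z \<in> F \<Longrightarrow> P z \<in> sets M" "\<And>z. z \<in> F \<Longrightarrow> P z \<subseteq> ball z \<rho>"
    "disjoint_family_on P F" "(\<Union>z\<in>F. P z) = E"
proof -
  have "\<exists>P. (\<forall>z\<in>F. P z \<in> sets M \<and> P z \<subseteq> ball z \<rho>) \<and> disjoint_family_on P F \<and> (\<Union>z\<in>F. P z) = E"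
    using assms
  proof (induction F arbitrary: E)
    case empty
    then show ?case by (auto simp: disjoint_family_on_def)
  next
    case (insert a F)
    have "E - ball a \<rho> \<in> sets M" "E - ball a \<rho> \<subseteq> (\<Union>z\<in>F. ball z \<rho>)" using insert.prems by auto
    from insert.IH[OF this] obtain P where P: "\<forall>z\<in>F. P z \<in> sets M \<and> P z \<subseteq> ball z \<rho>"
      "disjoint_family_on P F" "(\<Union>z\<in>F. P z) = E - ball a \<rho>" by auto
    define Q where "Q = P(a := E \<inter> ball a \<rho>)"
    have Q: "Q z = P z" if "z \<in> F" for z using that insert.hyps by (auto simp: Q_def)
    have "\<forall>z\<in>insert a F. Q z \<in> sets M \<and> Q z \<subseteq> ball z \<rho>"
      using P(1) Q insert.prems by (auto simp: Q_def)
    moreover have "disjoint_family_on Q (insert a F)"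
    proof -
      have "disjoint_family_on Q F" using P(2) Q by (auto simp: disjoint_family_on_def)
      moreover have "Q a \<inter> (\<Union>z\<in>F. Q z) = {}" using P(3) Q by (auto simp: Q_def)
      ultimately show ?thesis using insert.hyps by (simp add: disjoint_family_on_insert)
    qed
    moreover have "(\<Union>z\<in>insert a F. Q z) = E"
    proof -
      have "(\<Union>z\<in>F. Q z) = (\<Union>z\<in>F. P z)" using Q by (intro SUP_cong) auto
      then show ?thesis using P(3) insert.prems by (auto simp: Q_def)
    qed
    ultimately show ?case by blast
  qed
  then show ?thesis using that by blast
qed

end

section \<open>Gaussian bounds between balls of comparable radius\<close>

lemma recip_exponent_bounds:
  assumes "p \<in> {1..(\<infinity>::ereal)}"
  shows "0 \<le> 1 / real_of_ereal p" "1 / real_of_ereal p \<le> 1"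
  using assms by (cases rule: exponent_cases; simp)+

text \<open>Since k powr e \<le> k for k \<ge> 1 and 0 \<le> e \<le> 1, bounds on volume ratios pass
  to the powers 1/p with the same constant for all p.\<close>

lemma powr_le_mult_powr:
  fixes v w k e :: real
  assumes "0 \<le> v" "v \<le> k * w" "0 \<le> w" "1 \<le> k" "0 \<le> e" "e \<le> 1"
  shows "v powr e \<le> k * w powr e"
proof -
  have "v powr e \<le> (k * w) powr e" using assms by (intro powr_mono2) auto
  also have "\<dots> = k powr e * w powr e" using assms by (simp add: powr_mult)
  also have "\<dots> \<le> k powr 1 * w powr e" using assms by (intro mult_right_mono powr_mono) auto
  finally show ?thesis using assms by simp
qed

lemma powr_minus_le_mult_powr_minus:
  fixes v w k e :: real
  assumes "0 < v" "w \<le> k * v" "0 < w" "1 \<le> k" "0 \<le> e" "e \<le> 1"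
  shows "v powr (- e) \<le> k * w powr (- e)"
proof -
  have "w powr e \<le> k * v powr e" using assms by (intro powr_le_mult_powr) auto
  then show ?thesis using assms by (simp add: powr_minus field_simps)
qed

locale doubling_semigroup = doubling_measure M + operator_semigroup M \<B> N T
  for M :: "'a::metric_space measure" and \<B> N T +
  assumes expansion: "annular_expansion M \<B> T"
begin

section \<open>Almost everywhere linearity and limits of the semigroup\<close>

lemma T_mem: "t > 0 \<Longrightarrow> f \<in> \<B> \<Longrightarrow> T t f \<in> \<B>"
  using bounded unfolding bounded_operator_def by blast

lemma T_measurable [measurable]: "t > 0 \<Longrightarrow> f \<in> \<B> \<Longrightarrow> T t f \<in> borel_measurable M"
  by (intro measurable T_mem)

lemma zero_mem: "(\<lambda>x. 0) \<in> \<B>"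
  by (intro simple_mem simple_bochner_integrable.intros) auto

lemma sum_mem: "finite I \<Longrightarrow> (\<And>i. i \<in> I \<Longrightarrow> F i \<in> \<B>) \<Longrightarrow> (\<lambda>x. \<Sum>i\<in>I. F i x) \<in> \<B>"
  by (induction I rule: finite_induct) (auto intro: zero_mem add_closed)

lemma T_add_AE:
  "t > 0 \<Longrightarrow> f \<in> \<B> \<Longrightarrow> g \<in> \<B> \<Longrightarrow> AE x in M. T t (\<lambda>y. f y + g y) x = T t f x + T t g x"
  using bounded[of t] unfolding bounded_operator_def by simp

lemma T_zero_AE:
  assumes "t > 0"
  shows "AE x in M. T t (\<lambda>y. 0) x = 0"
proof -
  have "AE x in M. T t (\<lambda>y. 0 + 0) x = T t (\<lambda>y. 0) x + T t (\<lambda>y. 0) x"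
    using assms by (intro T_add_AE zero_mem)
  then show ?thesis by simp
qed

lemma T_sum_AE:
  assumes t: "t > 0" and "finite I" "\<And>i. i \<in> I \<Longrightarrow> F i \<in> \<B>"
  shows "AE x in M. T t (\<lambda>x. \<Sum>i\<in>I. F i x) x = (\<Sum>i\<in>I. T t (F i) x)"
  using assms(2,3)
proof (induction I rule: finite_induct)
  case empty
  show ?case using T_zero_AE[OF t] by simp
next
  case (insert i I)
  have "AE x in M. T t (\<lambda>y. F i y + (\<Sum>j\<in>I. F j y)) x = T t (F i) x + T t (\<lambda>y. \<Sum>j\<in>I. F j y) x"
    using insert.hyps insert.prems by (intro T_add_AE[OF t] sum_mem) simp_all
  moreover have "AE x in M. T t (\<lambda>x. \<Sum>i\<in>I. F i x) x = (\<Sum>i\<in>I. T t (F i) x)"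
    using insert.IH insert.prems by blast
  ultimately show ?case
  proof eventually_elim
    fix x assume "T t (\<lambda>y. F i y + (\<Sum>j\<in>I. F j y)) x = T t (F i) x + T t (\<lambda>y. \<Sum>j\<in>I. F j y) x"
      and "T t (\<lambda>x. \<Sum>i\<in>I. F i x) x = (\<Sum>i\<in>I. T t (F i) x)"
    then show "T t (\<lambda>x. \<Sum>i\<in>insert i I. F i x) x = (\<Sum>i\<in>insert i I. T t (F i) x)"
      using insert.hyps by simp
  qed
qed

lemma Lp_norm_T_sum_le:
  assumes q: "q \<in> {1..\<infinity>}" and t: "t > 0" and I: "finite I" "\<And>i. i \<in> I \<Longrightarrow> F i \<in> \<B>" and E: "E \<in> sets M"
  shows "Lp_norm M q (trunc E (T t (\<lambda>x. \<Sum>i\<in>I. F i x))) \<le> (\<Sum>i\<in>I. Lp_norm M q (trunc E (T t (F i))))"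
proof -
  have m: "T t (F i) \<in> borel_measurable M" if "i \<in> I" for i using I t that by (intro T_measurable)
  have "Lp_norm M q (trunc E (T t (\<lambda>x. \<Sum>i\<in>I. F i x))) = Lp_norm M q (\<lambda>x. \<Sum>i\<in>I. trunc E (T t (F i)) x)"
  proof (rule Lp_norm_cong_AE[OF q])
    have "AE x in M. T t (\<lambda>x. \<Sum>i\<in>I. F i x) x = (\<Sum>i\<in>I. T t (F i) x)"
      using I by (intro T_sum_AE[OF t])
    then show "AE x in M. trunc E (T t (\<lambda>x. \<Sum>i\<in>I. F i x)) x = (\<Sum>i\<in>I. trunc E (T t (F i)) x)"
      by eventually_elim (simp add: trunc_def sum_distrib_left)
  qed (use m t I E in \<open>auto intro!: trunc_measurable T_measurable sum_mem borel_measurable_sum\<close>)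
  also have "\<dots> \<le> (\<Sum>i\<in>I. Lp_norm M q (trunc E (T t (F i))))"
    using m E I by (intro Lp_norm_sum_le[OF q]) (auto intro!: trunc_measurable)
  finally show ?thesis .
qed

lemma Lp_norm_T_disjoint_le:
  assumes q: "q \<in> {1..\<infinity>}" and t: "t > 0" and f: "f \<in> \<B>" and E: "E \<in> sets M"
    and F: "finite F" "disjoint_family_on P F" "\<And>z. z \<in> F \<Longrightarrow> P z \<in> sets M"
  shows "Lp_norm M q (trunc E (T t (trunc (\<Union>z\<in>F. P z) f))) \<le> (\<Sum>z\<in>F. Lp_norm M q (trunc E (T t (trunc (P z) f))))"
  unfolding trunc_UN_disjoint[OF F(1,2)]
  using F f by (intro Lp_norm_T_sum_le[OF q t _ _ E] trunc_closed) auto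

lemma Lp_norm_disjoint_le:
  assumes q: "q \<in> {1..\<infinity>}" and f: "f \<in> borel_measurable M"
    and F: "finite F" "disjoint_family_on P F" "\<And>z. z \<in> F \<Longrightarrow> P z \<in> sets M"
  shows "Lp_norm M q (trunc (\<Union>z\<in>F. P z) f) \<le> (\<Sum>z\<in>F. Lp_norm M q (trunc (P z) f))"
  unfolding trunc_UN_disjoint[OF F(1,2)] using F f by (intro Lp_norm_sum_le[OF q] trunc_measurable) auto

text \<open>All use of \<open>annular_expansion\<close> passes through here: local convergence in
  measure yields an almost everywhere convergent subsequence on \<open>E\<close>, and Fatou's lemma
  carries the bound over.\<close>

lemma Lp_norm_T_expansion_le:
  assumes p: "p \<in> {1..\<infinity>}" and q: "q \<in> {1..\<infinity>}" and t: "t > 0" and f: "f \<in> Lp M p" "f \<in> \<B>" and r: "r > 0"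
    and E: "E \<in> sets M" "emeasure M E < \<infinity>"
    and bound: "\<And>k. Lp_norm M q (trunc E (T t (trunc (ball x (2 ^ k * r)) f))) \<le> C"
  shows "Lp_norm M q (trunc E (T t f)) \<le> C"
proof -
  have lim: "tendsto_locally_in_measure M (\<lambda>k. T t (trunc (ball x (2 ^ k * r)) f)) (T t f)"
    using expansion p t f r unfolding annular_expansion_def by blast
  have meas: "T t (trunc (ball x (2 ^ k * r)) f) \<in> borel_measurable M" for k
    using t f by (intro T_measurable trunc_closed) auto
  have meas': "T t f \<in> borel_measurable M" using t f by (intro T_measurable)
  obtain s :: "nat \<Rightarrow> nat" where s:
    "AE y in M. y \<in> E \<longrightarrow> (\<lambda>n. T t (trunc (ball x (2 ^ s n * r)) f) y) \<longlonglongrightarrow> T t f y"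
    using tendsto_locally_in_measure_imp_AE_subseq[OF lim meas meas' E] by blast
  show ?thesis
  proof (rule Lp_norm_le_of_AE_limit[OF q])
    show "AE y in M. (\<lambda>n. trunc E (T t (trunc (ball x (2 ^ s n * r)) f)) y) \<longlonglongrightarrow> trunc E (T t f) y"
      using s by eventually_elim (auto simp: trunc_def indicator_def)
  qed (use meas meas' E bound in auto)
qed

text \<open>A form of the off-diagonal estimates that composes well: source and target balls have the same
  radius \<open>\<rho>\<close>, tied to the time \<open>a \<rho>\<^sup>2\<close>. For \<open>a = 1\<close> it is equivalent to \<open>off_diagonal\<close>; the case
  \<open>a = 2\<close> arises from \<open>T\<^sub>2\<^sub>t = T\<^sub>t T\<^sub>t\<close>.\<close>

definition gauss_bound :: "real \<Rightarrow> ereal \<Rightarrow> ereal \<Rightarrow> bool" where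
  "gauss_bound a p q \<longleftrightarrow> (\<exists>C>0. \<exists>c>0. \<forall>\<rho>>0. \<forall>x y. \<forall>f\<in>\<B>.
     Lp_norm M q (trunc (ball x \<rho>) (T (a * \<rho>\<^sup>2) (trunc (ball y \<rho>) f)))
     \<le> ennreal (C * exp (- c * (dist x y / \<rho>)\<^sup>2) * vol x \<rho> powr (1 / real_of_ereal q) * vol y \<rho> powr (- (1 / real_of_ereal p)))
        * Lp_norm M p (trunc (ball y \<rho>) f))"

text \<open>Both sets are cut into cells along \<rho>-nets and the bound is summed over all pairs of
  cells. Two cardinalities and two changes of volume each cost at most (4 L)^dim with L = 1 +
  R/\<rho> + \<rho>/r, whence the exponent 4 dim.\<close>

lemma gauss_bound_general:
  assumes a: "a > 0" and p: "p \<in> {1..\<infinity>}" and q: "q \<in> {1..\<infinity>}" and G: "gauss_bound a p q"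
  obtains C c where "C > 0" "c > 0"
    "\<And>x r R R1 R2 \<rho> \<delta> E1 E2 f. \<lbrakk>r > 0; r \<le> R1; R1 \<le> R; r \<le> R2; R2 \<le> R; \<rho> > 0; \<delta> \<ge> 0;
       E1 \<in> sets M; E2 \<in> sets M; E1 \<subseteq> ball x R1; E2 \<subseteq> ball x R2;
       \<And>u v. u \<in> E1 \<Longrightarrow> v \<in> E2 \<Longrightarrow> \<delta> \<le> dist u v; f \<in> \<B>\<rbrakk> \<Longrightarrow>
       Lp_norm M q (trunc E1 (T (a * \<rho>\<^sup>2) (trunc E2 f)))
       \<le> ennreal (C * (1 + R / \<rho> + \<rho> / r) powr (4 * dim) * exp (- c * (\<delta> / \<rho>)\<^sup>2)
            * vol x R1 powr (1 / real_of_ereal q) * vol x R2 powr (- (1 / real_of_ereal p)))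
          * Lp_norm M p (trunc E2 f)"
proof -
  from G obtain C c where Cc: "C > 0" "c > 0" and
    est: "\<And>\<rho> x y f. \<rho> > 0 \<Longrightarrow> f \<in> \<B> \<Longrightarrow> Lp_norm M q (trunc (ball x \<rho>) (T (a * \<rho>\<^sup>2) (trunc (ball y \<rho>) f)))
     \<le> ennreal (C * exp (- c * (dist x y / \<rho>)\<^sup>2) * vol x \<rho> powr (1 / real_of_ereal q) * vol y \<rho> powr (- (1 / real_of_ereal p)))
        * Lp_norm M p (trunc (ball y \<rho>) f)"
    unfolding gauss_bound_def by metis
  \<comment> \<open>exp (4 c) and the halved rate come from passing between the distance of the sets
    and that of the centres, the power of 4 from the base 4 L of \<Lambda>.\<close>
  define C' where "C' = C * exp (4 * c) * 4 powr (4 * dim)"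
  show ?thesis
  proof (rule that[of C' "c / 2"])
    show "C' > 0" "c / 2 > 0" using Cc by (auto simp: C'_def)
    fix x :: 'a and r R R1 R2 \<rho> \<delta> :: real and E1 E2 and f :: "'a \<Rightarrow> complex"
    assume r: "r > 0" "r \<le> R1" "R1 \<le> R" "r \<le> R2" "R2 \<le> R" and \<rho>: "\<rho> > 0" and \<delta>: "\<delta> \<ge> 0"
      and E [measurable]: "E1 \<in> sets M" "E2 \<in> sets M" and sub: "E1 \<subseteq> ball x R1" "E2 \<subseteq> ball x R2"
      and far: "\<And>u v. u \<in> E1 \<Longrightarrow> v \<in> E2 \<Longrightarrow> \<delta> \<le> dist u v" and f: "f \<in> \<B>"
    define t where "t = a * \<rho>\<^sup>2"
    have t: "t > 0" using a \<rho> by (simp add: t_def)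
    define L where "L = 1 + R / \<rho> + \<rho> / r"
    have Lparts: "0 \<le> R / \<rho>" "0 \<le> \<rho> / r" using r \<rho> by auto
    then have L: "L \<ge> 1" by (simp add: L_def)
    define \<Lambda> where "\<Lambda> = (4 * L) powr dim"
    have \<Lambda>: "\<Lambda> \<ge> 1" using L dim_nonneg by (simp add: \<Lambda>_def ge_one_powr_ge_zero)
    define V where "V = vol x R1 powr (1 / real_of_ereal q) * vol x R2 powr (- (1 / real_of_ereal p))"
    define X where "X = Lp_norm M p (trunc E2 f)"
    have fm [measurable]: "f \<in> borel_measurable M" using f by (rule measurable)
    have R12: "R1 > 0" "R2 > 0" using r by auto
    obtain F1 where F1: "finite F1" "separated \<rho> F1" "F1 \<subseteq> ball x R1" "ball x R1 \<subseteq> (\<Union>z\<in>F1. ball z \<rho>)"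
      using finite_net[OF \<rho> R12(1)] by metis
    obtain F2 where F2: "finite F2" "separated \<rho> F2" "F2 \<subseteq> ball x R2" "ball x R2 \<subseteq> (\<Union>z\<in>F2. ball z \<rho>)"
      using finite_net[OF \<rho> R12(2)] by metis
    obtain Q where Q: "\<And>z. z \<in> F1 \<Longrightarrow> Q z \<in> sets M" "\<And>z. z \<in> F1 \<Longrightarrow> Q z \<subseteq> ball z \<rho>"
      "disjoint_family_on Q F1" "(\<Union>z\<in>F1. Q z) = E1"
      using disjoint_refinement[OF F1(1) E(1) order_trans[OF sub(1) F1(4)]] by metis
    obtain P where P: "\<And>z. z \<in> F2 \<Longrightarrow> P z \<in> sets M" "\<And>z. z \<in> F2 \<Longrightarrow> P z \<subseteq> ball z \<rho>"
      "disjoint_family_on P F2" "(\<Union>z\<in>F2. P z) = E2"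
      using disjoint_refinement[OF F2(1) E(2) order_trans[OF sub(2) F2(4)]] by metis
    have card_le: "real (card F) \<le> \<Lambda>" if "finite F" "separated \<rho> F" "F \<subseteq> ball x S" "S > 0" "S \<le> R" for F S
    proof -
      have "real (card F) \<le> (3 + 4 * S / \<rho>) powr dim" by (rule card_separated_le) (use that \<rho> in auto)
      also have "\<dots> \<le> \<Lambda>" unfolding \<Lambda>_def
      proof (intro powr_mono2 dim_nonneg)
        have "S / \<rho> \<le> R / \<rho>" using that \<rho> by (simp add: divide_right_mono)
        then show "3 + 4 * S / \<rho> \<le> 4 * L" using Lparts by (simp add: L_def)
        show "0 \<le> 3 + 4 * S / \<rho>" using that \<rho> by (simp add: add_nonneg_nonneg)
      qed
      finally show ?thesis .
    qed
    have pair: "Lp_norm M q (trunc (Q z) (T t (trunc (P w) f))) \<le> ennreal (C * exp (4 * c) * exp (- (c / 2) * (\<delta> / \<rho>)\<^sup>2) * \<Lambda> * \<Lambda> * V) * X"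
      if z: "z \<in> F1" and w: "w \<in> F2" for z w
    \<comment> \<open>An empty cell yields no points to compare distances with, but then the
      left-hand side is 0.\<close>
    proof (cases "Q z = {} \<or> P w = {}")
      case True
      have "AE y in M. trunc (Q z) (T t (trunc (P w) f)) y = 0"
      proof (cases "Q z = {}")
        case True
        then show ?thesis by (simp add: trunc_def)
      next
        case False
        with True have "trunc (P w) f = (\<lambda>x. \<Sum>i\<in>({}::nat set). (\<lambda>i x. 0) i x)" by (auto simp: trunc_def)
        then show ?thesis using T_sum_AE[OF t, of "{}::nat set" "\<lambda>i x. 0"] by (auto simp: trunc_def elim: eventually_mono)
      qed
      then show ?thesis
        using z w Q P t f by (subst Lp_norm_zero_AE[OF q]) (auto intro!: trunc_measurable T_measurable trunc_closed)
    next
      case False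
      then obtain u v where uv: "u \<in> Q z" "v \<in> P w" by blast
      then have "u \<in> E1" "v \<in> E2" "dist z u < \<rho>" "dist w v < \<rho>"
        using Q(2)[OF z] P(2)[OF w] Q(4) P(4) z w by auto
      then have "\<delta> \<le> dist z w + 2 * \<rho>"
        using far[of u v] dist_triangle[of u v z] dist_triangle[of z v w] by (simp add: dist_commute)
      define \<eta> where "\<eta> = dist z w / \<rho>"
      have "\<delta> / \<rho> \<le> \<eta> + 2" using \<open>\<delta> \<le> _\<close> \<rho> by (simp add: \<eta>_def field_simps)
      then have "(\<delta> / \<rho>)\<^sup>2 \<le> (\<eta> + 2)\<^sup>2" using \<delta> \<rho> by (intro power_mono) auto
      \<comment> \<open>Equivalent to (\<eta> - 2)^2 \<ge> 0; this doubling of the square is what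
        halves the decay rate.\<close>
      also have "\<dots> \<le> 2 * \<eta>\<^sup>2 + 8"
        using sum_squares_ge_zero[of "\<eta> - 2" 0] by (simp add: power2_eq_square algebra_simps)
      finally have "(c / 2) * (\<delta> / \<rho>)\<^sup>2 \<le> (c / 2) * (2 * \<eta>\<^sup>2 + 8)" using Cc by (intro mult_left_mono) auto
      then have "- c * \<eta>\<^sup>2 \<le> 4 * c + (- (c / 2) * (\<delta> / \<rho>)\<^sup>2)" by (simp add: algebra_simps)
      then have e: "exp (- c * \<eta>\<^sup>2) \<le> exp (4 * c) * exp (- (c / 2) * (\<delta> / \<rho>)\<^sup>2)"
        by (simp only: exp_add[symmetric] exp_le_cancel_iff)
      have dz: "dist z x \<le> R1" "dist x w \<le> R2" using z w F1 F2 by (auto simp: dist_commute)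
      have v1: "vol z \<rho> powr (1 / real_of_ereal q) \<le> \<Lambda> * vol x R1 powr (1 / real_of_ereal q)"
      proof (rule powr_le_mult_powr)
        have "vol z \<rho> \<le> (2 + (\<rho> + dist z x) / R1) powr dim * vol x R1"
          using \<rho> R12 by (intro volume_comparison)
        also have "\<dots> \<le> \<Lambda> * vol x R1" unfolding \<Lambda>_def
        proof (intro mult_right_mono powr_mono2 dim_nonneg)
          have "dist z x / R1 \<le> 1" using dz R12 by simp
          moreover have "\<rho> / R1 \<le> \<rho> / r" using r \<rho> R12 by (intro divide_left_mono) auto
          ultimately show "2 + (\<rho> + dist z x) / R1 \<le> 4 * L" using Lparts by (simp add: L_def add_divide_distrib)
          show "0 \<le> 2 + (\<rho> + dist z x) / R1" using \<rho> R12 by (simp add: add_nonneg_nonneg)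
        qed (simp add: vol_def)
        finally show "vol z \<rho> \<le> \<Lambda> * vol x R1" .
      qed (use \<Lambda> recip_exponent_bounds[OF q] in \<open>auto simp: vol_def\<close>)
      have v2: "vol w \<rho> powr (- (1 / real_of_ereal p)) \<le> \<Lambda> * vol x R2 powr (- (1 / real_of_ereal p))"
      proof (rule powr_minus_le_mult_powr_minus)
        have "vol x R2 \<le> (2 + (R2 + dist x w) / \<rho>) powr dim * vol w \<rho>"
          using \<rho> R12 by (intro volume_comparison)
        also have "\<dots> \<le> \<Lambda> * vol w \<rho>" unfolding \<Lambda>_def
        proof (intro mult_right_mono powr_mono2 dim_nonneg)
          have "dist x w / \<rho> \<le> R / \<rho>" "R2 / \<rho> \<le> R / \<rho>" using dz r \<rho> by (auto intro!: divide_right_mono)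
          then show "2 + (R2 + dist x w) / \<rho> \<le> 4 * L" using Lparts by (simp add: L_def add_divide_distrib)
          show "0 \<le> 2 + (R2 + dist x w) / \<rho>" using \<rho> R12 by (simp add: add_nonneg_nonneg)
        qed (simp add: vol_def)
        finally show "vol x R2 \<le> \<Lambda> * vol w \<rho>" .
      qed (use \<Lambda> recip_exponent_bounds[OF p] vol_pos \<rho> R12 in auto)
      have le: "C * exp (- c * \<eta>\<^sup>2) * vol z \<rho> powr (1 / real_of_ereal q) * vol w \<rho> powr (- (1 / real_of_ereal p))
        \<le> C * (exp (4 * c) * exp (- (c / 2) * (\<delta> / \<rho>)\<^sup>2)) * (\<Lambda> * vol x R1 powr (1 / real_of_ereal q)) * (\<Lambda> * vol x R2 powr (- (1 / real_of_ereal p)))"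
        using e v1 v2 Cc \<Lambda> by (intro mult_mono mult_nonneg_nonneg) auto
      have eqt: "trunc (P w) f = trunc (ball w \<rho>) (trunc (P w) f)"
        using P(2)[OF w] by (auto simp: trunc_trunc Int_absorb1)
      have "Lp_norm M q (trunc (Q z) (T t (trunc (P w) f))) \<le> Lp_norm M q (trunc (ball z \<rho>) (T t (trunc (P w) f)))"
        using z w Q P t f by (intro Lp_norm_trunc_mono q) (auto intro!: T_measurable trunc_closed)
      also have "\<dots> = Lp_norm M q (trunc (ball z \<rho>) (T t (trunc (ball w \<rho>) (trunc (P w) f))))"
        by (simp only: eqt[symmetric])
      also have "\<dots>
        \<le> ennreal (C * exp (- c * \<eta>\<^sup>2) * vol z \<rho> powr (1 / real_of_ereal q) * vol w \<rho> powr (- (1 / real_of_ereal p)))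
        * Lp_norm M p (trunc (ball w \<rho>) (trunc (P w) f))"
        unfolding t_def \<eta>_def using \<rho> f P(1)[OF w] by (intro est trunc_closed) auto
      also have "\<dots> \<le> ennreal (C * exp (4 * c) * exp (- (c / 2) * (\<delta> / \<rho>)\<^sup>2) * \<Lambda> * \<Lambda> * V) * X"
      proof (rule mult_mono)
        have "trunc (ball w \<rho>) (trunc (P w) f) = trunc (P w) f"
          by (rule eqt[symmetric])
        then show "Lp_norm M p (trunc (ball w \<rho>) (trunc (P w) f)) \<le> X"
          unfolding X_def using Lp_norm_trunc_mono[OF p fm P(1)[OF w] E(2)] P(4) w by auto
      qed (use le in \<open>auto simp: V_def mult_ac intro!: ennreal_leI\<close>)
      finally show ?thesis .
    qed
    define k where "k = C * exp (4 * c) * exp (- (c / 2) * (\<delta> / \<rho>)\<^sup>2) * \<Lambda> * \<Lambda> * V"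
    have k: "k \<ge> 0" using Cc \<Lambda> by (simp add: k_def V_def)
    have "Lp_norm M q (trunc E1 (T t (trunc E2 f))) \<le> (\<Sum>z\<in>F1. Lp_norm M q (trunc (Q z) (T t (trunc E2 f))))"
      unfolding Q(4)[symmetric] using Q F1 t f E by (intro Lp_norm_disjoint_le[OF q]) (auto intro!: T_measurable trunc_closed)
    also have "\<dots> \<le> (\<Sum>z\<in>F1. \<Sum>w\<in>F2. Lp_norm M q (trunc (Q z) (T t (trunc (P w) f))))"
      unfolding P(4)[symmetric] using P F2 t f Q by (intro sum_mono Lp_norm_T_disjoint_le[OF q]) auto
    also have "\<dots> \<le> (\<Sum>z\<in>F1. \<Sum>w\<in>F2. ennreal k * X)"
      unfolding k_def by (intro sum_mono pair)
    also have "\<dots> = ennreal (real (card F1) * real (card F2) * k) * X"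
      using k by (simp add: ennreal_mult ennreal_of_nat_eq_real_of_nat mult.assoc)
    also have "\<dots> \<le> ennreal (\<Lambda> * \<Lambda> * k) * X"
      using card_le[OF F1(1-3)] card_le[OF F2(1-3)] R12 r k \<Lambda>
      by (intro mult_right_mono ennreal_leI mult_mono) auto
    also have "\<Lambda> * \<Lambda> * k = C' * L powr (4 * dim) * exp (- (c / 2) * (\<delta> / \<rho>)\<^sup>2) * V"
    proof -
      have "\<Lambda> * \<Lambda> * \<Lambda> * \<Lambda> = (4 * L) powr (4 * dim)"
        unfolding \<Lambda>_def by (simp only: powr_add[symmetric]) simp
      also have "\<dots> = 4 powr (4 * dim) * L powr (4 * dim)" using L by (simp add: powr_mult)
      finally show ?thesis by (simp add: k_def C'_def mult_ac)
    qed
    finally show "Lp_norm M q (trunc E1 (T (a * \<rho>\<^sup>2) (trunc E2 f)))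
       \<le> ennreal (C' * (1 + R / \<rho> + \<rho> / r) powr (4 * dim) * exp (- (c / 2) * (\<delta> / \<rho>)\<^sup>2)
            * vol x R1 powr (1 / real_of_ereal q) * vol x R2 powr (- (1 / real_of_ereal p)))
          * Lp_norm M p (trunc E2 f)"
      by (simp add: t_def L_def V_def X_def mult.assoc)
  qed
qed

end

section \<open>From Gaussian bounds to off-diagonal estimates\<close>

lemma Upsilon_ge:
  assumes "s > 0"
  shows "Upsilon s \<ge> 1" "Upsilon s \<ge> s" "Upsilon s \<ge> 1 / s"
proof -
  show "Upsilon s \<ge> s" "Upsilon s \<ge> 1 / s"
    by (simp_all add: Upsilon_def inverse_eq_divide)
  show "Upsilon s \<ge> 1"
  proof (cases "s \<ge> 1")
    case False
    then have "1 \<le> inverse s" using assms by (intro one_le_inverse) auto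
    then show ?thesis by (simp add: Upsilon_def)
  qed (simp add: Upsilon_def)
qed

lemma Upsilon_le: "s \<ge> 1 \<Longrightarrow> Upsilon s \<le> s"
  using inverse_le_1_iff[of s] by (simp add: Upsilon_def)

context doubling_semigroup
begin

lemma annulus_sets [measurable]: "annulus j x r \<in> sets M"
  by (simp add: annulus_def)

lemma annulus_subset: "annulus j x r \<subseteq> ball x (2 ^ (j + 1) * r)"
  by (auto simp: annulus_def)

lemma Lp_avg_ball:
  assumes "p \<in> {1..\<infinity>}" "r > 0" "f \<in> borel_measurable M" "E \<in> sets M"
  shows "Lp_avg M p (ball x r) E f = ennreal (vol x r powr (- (1 / real_of_ereal p))) * Lp_norm M p (trunc E f)"
  using assms by (intro Lp_avg_eq emeasure_ball vol_pos)

text \<open>With a \<rho>^2 = t, all radii that occur lie between r and 2^(j+1) r, so R/\<rho> and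
  \<rho>/r are at most a multiple of 2^j times Upsilon (2^j r / sqrt t). General \<open>a\<close> is
  allowed because composition ends at time 2 \<rho>^2.\<close>

lemma gauss_bound_imp_off_diagonal:
  assumes a: "a > 0" and p: "p \<in> {1..\<infinity>}" and q: "q \<in> {1..\<infinity>}" and G: "gauss_bound a p q"
  shows "off_diagonal M \<B> T p q"
proof -
  obtain C c where Cc: "C > 0" "c > 0" and est:
    "\<And>x r R R1 R2 \<rho> \<delta> E1 E2 f. \<lbrakk>r > 0; r \<le> R1; R1 \<le> R; r \<le> R2; R2 \<le> R; \<rho> > 0; \<delta> \<ge> 0;
       E1 \<in> sets M; E2 \<in> sets M; E1 \<subseteq> ball x R1; E2 \<subseteq> ball x R2;
       \<And>u v. u \<in> E1 \<Longrightarrow> v \<in> E2 \<Longrightarrow> \<delta> \<le> dist u v; f \<in> \<B>\<rbrakk> \<Longrightarrow>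
       Lp_norm M q (trunc E1 (T (a * \<rho>\<^sup>2) (trunc E2 f)))
       \<le> ennreal (C * (1 + R / \<rho> + \<rho> / r) powr (4 * dim) * exp (- c * (\<delta> / \<rho>)\<^sup>2)
            * vol x R1 powr (1 / real_of_ereal q) * vol x R2 powr (- (1 / real_of_ereal p)))
          * Lp_norm M p (trunc E2 f)"
    using gauss_bound_general[OF a p q G] by metis
  \<comment> \<open>The summand 1 keeps the exponent positive if \<open>dim\<close> is 0.\<close>
  define \<theta> where "\<theta> = 4 * dim + 1"
  have \<theta>: "\<theta> > 0" "4 * dim \<le> \<theta>" using dim_nonneg by (auto simp: \<theta>_def)
  \<comment> \<open>Dominates sqrt a and its inverse, the factors between \<rho> and sqrt t.\<close>
  define b where "b = max (sqrt a) (1 / sqrt a)"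
  have b: "b \<ge> sqrt a" "b \<ge> 1 / sqrt a" by (auto simp: b_def)
  have b1: "b \<ge> 1" using a by (auto simp: b_def max_def field_simps)
  define C' where "C' = C * (4 * b) powr \<theta>"
  define c' where "c' = c * a / 4"
  have C'c': "C' > 0" "c' > 0" using Cc a b1 by (auto simp: C'_def c'_def)
  \<comment> \<open>One estimate for all three inequalities: j = 0, \<delta> = 0 and e = 1 give the
    one on the ball, \<delta> = 2^j r / 2 the two with annuli.\<close>
  have key: "Lp_avg M q (ball x R1) E1 (T t (trunc E2 f))
      \<le> ennreal (C' * 2 powr (real j * \<theta>) * Upsilon (2 ^ j * r / sqrt t) powr \<theta> * e) * Lp_avg M p (ball x R2) E2 f"
    if t: "t > 0" and r: "r > 0" and f: "f \<in> \<B>" and R: "r \<le> R1" "R1 \<le> R" "r \<le> R2" "R2 \<le> R" "R \<le> 2 * (2 ^ j * r)"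
      and E: "E1 \<in> sets M" "E2 \<in> sets M" "E1 \<subseteq> ball x R1" "E2 \<subseteq> ball x R2" and \<delta>: "\<delta> \<ge> 0"
      and far: "\<And>u v. u \<in> E1 \<Longrightarrow> v \<in> E2 \<Longrightarrow> \<delta> \<le> dist u v" and e: "exp (- (c * a * \<delta>\<^sup>2 / t)) \<le> e"
    for t x r R R1 R2 j E1 E2 f \<delta> e
  proof -
    define \<rho> where "\<rho> = sqrt (t / a)"
    have \<rho>: "\<rho> > 0" "a * \<rho>\<^sup>2 = t" using t a by (auto simp: \<rho>_def)
    have sq: "\<rho> = sqrt t / sqrt a" by (simp add: \<rho>_def real_sqrt_divide)
    define s where "s = 2 ^ j * r / sqrt t"
    have s: "s > 0" using t r by (simp add: s_def)
    define U where "U = Upsilon s"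
    have U: "U \<ge> 1" "U \<ge> s" "U \<ge> 1 / s" using Upsilon_ge[OF s] by (auto simp: U_def)
    have two: "(2::real) ^ j \<ge> 1" by simp
    have L: "1 + R / \<rho> + \<rho> / r \<le> 4 * (2 ^ j * b * U)"
    proof -
      have bU: "b * U \<ge> 1" using mult_mono[of 1 b 1 U] b1 U by simp
      have "1 * 1 \<le> 2 ^ j * (b * U)" using bU two by (intro mult_mono) auto
      moreover have "R / \<rho> \<le> 2 * (b * U)"
      proof -
        have "R / \<rho> \<le> 2 * (2 ^ j * r) / \<rho>" using R \<rho> by (intro divide_right_mono) auto
        also have "\<dots> = 2 * (sqrt a * s)" using a t by (simp add: sq s_def)
        also have "\<dots> \<le> 2 * (b * U)" using b U s a b1 by (intro mult_left_mono mult_mono) auto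
        finally show ?thesis .
      qed
      moreover have "2 * (b * U) \<le> 2 * (2 ^ j * (b * U))" using two bU mult_right_mono[of 1 "2 ^ j" "b * U"] by simp
      moreover have "\<rho> / r \<le> 2 ^ j * (b * U)"
      proof -
        have "\<rho> / r = 2 ^ j * ((1 / sqrt a) * (1 / s))" using a t r by (simp add: sq s_def field_simps)
        also have "\<dots> \<le> 2 ^ j * (b * U)" using b U s a b1 by (intro mult_left_mono mult_mono) auto
        finally show ?thesis .
      qed
      ultimately show ?thesis by (simp add: mult.assoc)
    qed
    have L1: "1 + R / \<rho> + \<rho> / r \<ge> 1" using r R \<rho> by (simp add: add_nonneg_nonneg)
    have "(1 + R / \<rho> + \<rho> / r) powr (4 * dim) \<le> (1 + R / \<rho> + \<rho> / r) powr \<theta>"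
      using L1 \<theta> by (intro powr_mono) auto
    also have "\<dots> \<le> (4 * (2 ^ j * b * U)) powr \<theta>" using L L1 \<theta> by (intro powr_mono2) auto
    also have "\<dots> = (4 * b) powr \<theta> * 2 powr (real j * \<theta>) * U powr \<theta>"
      using b1 U by (simp add: powr_mult powr_powr powr_realpow[symmetric])
    finally have Lb: "C * (1 + R / \<rho> + \<rho> / r) powr (4 * dim) \<le> C' * 2 powr (real j * \<theta>) * U powr \<theta>"
      using Cc by (simp add: C'_def mult.assoc)
    have ex: "exp (- c * (\<delta> / \<rho>)\<^sup>2) \<le> e"
    proof -
      have "\<rho>\<^sup>2 = t / a" using t a by (simp add: \<rho>_def)
      then have "- c * (\<delta> / \<rho>)\<^sup>2 = - (c * a * \<delta>\<^sup>2 / t)" by (simp add: power_divide)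
      then show ?thesis using e by (simp only:)
    qed
    have V: "vol x R1 > 0" "vol x R2 > 0" using r R by (auto intro!: vol_pos)
    define v1 where "v1 = vol x R1 powr (1 / real_of_ereal q)"
    define v2 where "v2 = vol x R2 powr (- (1 / real_of_ereal p))"
    have v: "v1 > 0" "v2 > 0" using V by (auto simp: v1_def v2_def)
    have v1': "vol x R1 powr (- (1 / real_of_ereal q)) = inverse v1" by (simp add: v1_def powr_minus)
    have fm: "f \<in> borel_measurable M" using f by (rule measurable)
    have Tm: "T t (trunc E2 f) \<in> borel_measurable M" using t f E by (intro T_measurable trunc_closed)
    have R0: "R1 > 0" "R2 > 0" using r R by auto
    have "Lp_avg M q (ball x R1) E1 (T t (trunc E2 f)) = ennreal (inverse v1) * Lp_norm M q (trunc E1 (T t (trunc E2 f)))"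
      using Lp_avg_ball[OF q R0(1) Tm E(1)] v1' by simp
    also have "\<dots> \<le> ennreal (inverse v1) * (ennreal (C * (1 + R / \<rho> + \<rho> / r) powr (4 * dim) * exp (- c * (\<delta> / \<rho>)\<^sup>2) * v1 * v2)
          * Lp_norm M p (trunc E2 f))"
      using est[OF r R(1-4) \<rho>(1) \<delta> E far f] by (intro mult_left_mono) (auto simp: \<rho>(2) v1_def v2_def)
    also have "\<dots> \<le> ennreal (inverse v1) * (ennreal ((C' * 2 powr (real j * \<theta>) * U powr \<theta>) * e * v1 * v2) * Lp_norm M p (trunc E2 f))"
    proof -
      have "C * (1 + R / \<rho> + \<rho> / r) powr (4 * dim) * exp (- c * (\<delta> / \<rho>)\<^sup>2) \<le> (C' * 2 powr (real j * \<theta>) * U powr \<theta>) * e"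
        using C'c' by (intro mult_mono[OF Lb ex]) auto
      then show ?thesis using v by (intro mult_left_mono mult_right_mono ennreal_leI) auto
    qed
    also have "\<dots> = ennreal (inverse v1 * ((C' * 2 powr (real j * \<theta>) * U powr \<theta>) * e * v1 * v2)) * Lp_norm M p (trunc E2 f)"
      using v by (simp add: ennreal_mult' mult.assoc)
    also have "inverse v1 * ((C' * 2 powr (real j * \<theta>) * U powr \<theta>) * e * v1 * v2) = C' * 2 powr (real j * \<theta>) * U powr \<theta> * e * v2"
      using v by simp
    also have "ennreal \<dots> * Lp_norm M p (trunc E2 f) = ennreal (C' * 2 powr (real j * \<theta>) * U powr \<theta> * e) * Lp_avg M p (ball x R2) E2 f"
    proof -
      have "e \<ge> 0" using ex by (meson exp_ge_zero order_trans)
      then have "ennreal (C' * 2 powr (real j * \<theta>) * U powr \<theta> * e * v2) = ennreal (C' * 2 powr (real j * \<theta>) * U powr \<theta> * e) * ennreal v2"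
        using C'c' v by (intro ennreal_mult) auto
      then show ?thesis unfolding Lp_avg_ball[OF p R0(2) fm E(2)] v2_def by (simp only: mult.assoc)
    qed
    finally show ?thesis by (simp add: U_def s_def)
  qed
  \<comment> \<open>For j \<ge> 2 one has r \<le> 2^j r / 4, so subtracting r from 2^j r leaves at
    least half of it. The square of this half is the source of the 4 in c'.\<close>
  have sep: "2 ^ j * r / 2 \<le> dist u v" if "u \<in> ball x r" "v \<in> annulus j x r" "2 \<le> j" "r > 0" for u v x r j
  proof -
    have "(2::real) ^ 2 \<le> 2 ^ j" using that by (intro power_increasing) auto
    then have "4 * r \<le> 2 ^ j * r" using that by (intro mult_right_mono) auto
    moreover have "2 ^ j * r \<le> dist x v" "dist x u < r" using that by (auto simp: annulus_def)
    ultimately show ?thesis using dist_triangle[of x v u] \<open>r > 0\<close> by linarith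
  qed
  have ee: "exp (- (c * a * (2 ^ j * r / 2)\<^sup>2 / t)) \<le> exp (- (c' * 4 ^ j * r\<^sup>2 / t))" for j r t
  proof -
    have "((2::real) ^ j)\<^sup>2 = 4 ^ j" by (simp add: power2_eq_square flip: power_mult_distrib)
    then have "(2 ^ j * r / 2)\<^sup>2 = 4 ^ j * r\<^sup>2 / 4" by (simp add: power_mult_distrib power_divide)
    then have "c * a * (2 ^ j * r / 2)\<^sup>2 / t = c' * 4 ^ j * r\<^sup>2 / t" by (simp only: c'_def) simp
    then show ?thesis by (simp only: order_refl)
  qed
  show ?thesis
    unfolding off_diagonal_def
  proof (rule exI[of _ \<theta>], rule conjI[OF \<theta>(1)], rule exI[of _ \<theta>], rule conjI[OF \<theta>(1)],
      rule exI[of _ c'], rule conjI[OF C'c'(2)], rule exI[of _ C'], rule conjI[OF C'c'(1)], intro allI impI ballI conjI)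
    fix t :: real and x :: 'a and r :: real and f :: "'a \<Rightarrow> complex"
    assume t: "t > 0" and r: "r > 0" and f': "f \<in> Lp M p \<inter> \<B>"
    then have f: "f \<in> \<B>" by simp
    have "Lp_avg M q (ball x r) (ball x r) (T t (trunc (ball x r) f))
      \<le> ennreal (C' * 2 powr (real 0 * \<theta>) * Upsilon (2 ^ 0 * r / sqrt t) powr \<theta> * 1) * Lp_avg M p (ball x r) (ball x r) f"
      by (rule key[OF t r f, where R=r and \<delta>=0]) (use r in auto)
    then show "Lp_avg M q (ball x r) (ball x r) (T t (trunc (ball x r) f))
      \<le> ennreal (C' * Upsilon (r / sqrt t) powr \<theta>) * Lp_avg M p (ball x r) (ball x r) f" by simp
    fix j :: nat assume j: "2 \<le> j"
    have "(1::real) \<le> 2 ^ (j + 1)" by (rule one_le_power) simp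
    then have le: "r \<le> 2 ^ (j + 1) * r" using r by (simp only: mult_le_cancel_right1) auto
    have d0: "0 \<le> 2 ^ j * r / 2" using r by simp
    have sep2: "2 ^ j * r / 2 \<le> dist u v" if "u \<in> annulus j x r" "v \<in> ball x r" for u v
      using sep[OF that(2,1) j r] by (simp add: dist_commute)
    show "Lp_avg M q (ball x r) (ball x r) (T t (trunc (annulus j x r) f))
       \<le> ennreal (C' * 2 powr (real j * \<theta>) * Upsilon (2 ^ j * r / sqrt t) powr \<theta> * exp (- (c' * 4 ^ j * r\<^sup>2 / t)))
               * Lp_avg M p (ball x (2 ^ (j + 1) * r)) (annulus j x r) f"
      by (rule key[OF t r f _ le le order_refl _ _ _ _ annulus_subset d0 sep[OF _ _ j r] ee]) auto
    show "Lp_avg M q (ball x (2 ^ (j + 1) * r)) (annulus j x r) (T t (trunc (ball x r) f))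
       \<le> ennreal (C' * 2 powr (real j * \<theta>) * Upsilon (2 ^ j * r / sqrt t) powr \<theta> * exp (- (c' * 4 ^ j * r\<^sup>2 / t)))
               * Lp_avg M p (ball x r) (ball x r) f"
      by (rule key[OF t r f le order_refl _ le _ _ _ annulus_subset _ d0 sep2 ee]) auto
  qed
qed

end

section \<open>From off-diagonal estimates to Gaussian bounds\<close>

lemma ex_dyadic_interval:
  fixes u :: real assumes "u \<ge> 1" obtains j :: nat where "2 ^ j \<le> u" "u < 2 ^ (j + 1)"
proof -
  define j where "j = nat \<lfloor>log 2 u\<rfloor>"
  have "0 \<le> log 2 u" using assms by simp
  then have "real j \<le> log 2 u" "log 2 u < real j + 1" unfolding j_def by linarith+
  then have "2 powr real j \<le> u" "u < 2 powr (real j + 1)" using assms by (auto simp: le_log_iff log_less_iff)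
  then show ?thesis using that[of j] by (simp add: powr_realpow powr_add)
qed

context doubling_semigroup
begin

lemma T_trunc_disjoint_Un_le:
  assumes q: "q \<in> {1..\<infinity>}" and t: "t > 0" and f: "f \<in> \<B>" and E: "E \<in> sets M"
    and A: "A \<in> sets M" "B \<in> sets M" "A \<inter> B = {}"
  shows "Lp_norm M q (trunc E (T t (trunc (A \<union> B) f)))
    \<le> Lp_norm M q (trunc E (T t (trunc A f))) + Lp_norm M q (trunc E (T t (trunc B f)))"
proof -
  define P where "P b = (if b then A else B)" for b
  have "Lp_norm M q (trunc E (T t (trunc (\<Union>b\<in>{True, False}. P b) f))) \<le> (\<Sum>b\<in>{True, False}. Lp_norm M q (trunc E (T t (trunc (P b) f))))"
    using A by (intro Lp_norm_T_disjoint_le[OF q t f E]) (auto simp: P_def disjoint_family_on_def)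
  then show ?thesis by (simp add: P_def Un_commute)
qed

text \<open>Balls of radius \<rho> with centres less than 5 \<rho> apart lie in one ball of radius 8
  \<rho>, where the estimate on a single ball applies. Otherwise the source ball lies in two
  consecutive annuli around the target ball, and the annular estimates at radius \<rho> = sqrt t
  give the Gaussian.\<close>

lemma off_diagonal_imp_gauss_bound:
  assumes p: "p \<in> {1..\<infinity>}" and q: "q \<in> {1..\<infinity>}" and O: "off_diagonal M \<B> T p q"
  shows "gauss_bound 1 p q"
proof -
  define ip iq where "ip = 1 / real_of_ereal p" and "iq = 1 / real_of_ereal q"
  have ip: "0 \<le> ip" "ip \<le> 1" and iq: "0 \<le> iq" "iq \<le> 1"
    using recip_exponent_bounds[OF p] recip_exponent_bounds[OF q] by (auto simp: ip_def iq_def)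
  from O obtain \<theta>1 \<theta>2 c C where pos: "\<theta>1 > 0" "\<theta>2 > 0" "c > 0" "C > 0" and
    near: "\<And>t x r f. t > 0 \<Longrightarrow> r > 0 \<Longrightarrow> f \<in> Lp M p \<inter> \<B> \<Longrightarrow>
        Lp_avg M q (ball x r) (ball x r) (T t (trunc (ball x r) f))
          \<le> ennreal (C * Upsilon (r / sqrt t) powr \<theta>2) * Lp_avg M p (ball x r) (ball x r) f" and
    far: "\<And>t x r f j. t > 0 \<Longrightarrow> r > 0 \<Longrightarrow> f \<in> Lp M p \<inter> \<B> \<Longrightarrow> j \<ge> 2 \<Longrightarrow>
          Lp_avg M q (ball x r) (ball x r) (T t (trunc (annulus j x r) f))
            \<le> ennreal (C * 2 powr (real j * \<theta>1) * Upsilon (2 ^ j * r / sqrt t) powr \<theta>2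
                        * exp (- (c * 4 ^ j * r\<^sup>2 / t)))
               * Lp_avg M p (ball x (2 ^ (j + 1) * r)) (annulus j x r) f"
    unfolding off_diagonal_def by metis
  define \<theta> where "\<theta> = \<theta>1 + \<theta>2"
  \<comment> \<open>In the far case 2^i \<ge> 2 u / 5, so exp (- c 4^i) is at most exp (- 2 c' u^2)
    with c' = 2 c / 25: half of it absorbs the polynomial factor, half remains.\<close>
  obtain K where K: "K \<ge> 1" "\<And>u::real. u \<ge> 0 \<Longrightarrow> (1 + u) powr \<theta> \<le> K * exp (2 * c / 25 * u\<^sup>2)"
    using one_plus_powr_le_exp_square[of \<theta> "2 * c / 25"] pos by (auto simp: \<theta>_def)
  define c' where "c' = 2 * c / 25"
  \<comment> \<open>15 = 2 + 8 + 5, from volume comparison at radii 8 \<rho> and \<rho> and distance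
    at most 5 \<rho>; the ratio 4 of the far case is smaller.\<close>
  define A where "A = 15 powr dim"
  have A: "A \<ge> 1" unfolding A_def using dim_nonneg by (intro ge_one_powr_ge_zero) auto
  \<comment> \<open>In the near case c' u^2 \<le> 25 c' = 2 c, so exp (2 c) compensates the Gaussian
    factor.\<close>
  define C1 where "C1 = C * 8 powr \<theta>2 * A * exp (2 * c)"
  define C2 where "C2 = 2 * (C * 2 powr \<theta> * K * A)"
  have C12: "C1 > 0" "C2 > 0" using pos A K by (auto simp: C1_def C2_def)
  show ?thesis
    unfolding gauss_bound_def ip_def[symmetric] iq_def[symmetric]
  proof (rule exI[of _ "C1 + C2"], intro conjI exI[of _ c'] allI impI ballI)
    show "C1 + C2 > 0" "c' > 0" using C12 pos by (auto simp: c'_def)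
    fix \<rho> :: real and x y :: 'a and f assume \<rho>: "\<rho> > 0" and f: "f \<in> \<B>"
    define u where "u = dist x y / \<rho>"
    have u: "u \<ge> 0" using \<rho> by (simp add: u_def)
    define g where "g = trunc (ball y \<rho>) f"
    have g: "g \<in> \<B>" using f by (simp add: g_def trunc_closed)
    have [measurable]: "g \<in> borel_measurable M" using g by (rule measurable)
    define X where "X = Lp_norm M p g"
    define V where "V = vol x \<rho> powr iq * vol y \<rho> powr (- ip)"
    have vp: "vol x \<rho> > 0" "vol y \<rho> > 0" using \<rho> by (auto intro: vol_pos)
    then have V: "V > 0" by (simp add: V_def)
    have t: "\<rho>\<^sup>2 > 0" "sqrt (\<rho>\<^sup>2) = \<rho>" using \<rho> by auto
    have Tm: "T (\<rho>\<^sup>2) h \<in> borel_measurable M" if "h \<in> \<B>" for h using t that by (intro T_measurable)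
    have "Lp_norm M q (trunc (ball x \<rho>) (T (\<rho>\<^sup>2) g)) \<le> ennreal ((C1 + C2) * exp (- c' * u\<^sup>2) * V) * X"
    \<comment> \<open>An infinite norm makes the right-hand side infinite; otherwise g lies in L^p,
      as \<open>off_diagonal\<close> demands.\<close>
    proof (cases "X = \<infinity>")
      case True
      then show ?thesis using C12 V by (simp add: ennreal_mult_top)
    next
      case False
      then have gL: "g \<in> Lp M p \<inter> \<B>" using g by (auto simp: Lp_def X_def less_top)
      show ?thesis
      \<comment> \<open>From u \<ge> 5 on, u - 1 \<ge> 4, so the dyadic index j below is at least 2,
        where the annuli begin.\<close>
      proof (cases "u < 5")
        case True
        have d: "dist x y \<le> 5 * \<rho>" using True \<rho> by (simp add: u_def field_simps)
        define r where "r = 8 * \<rho>"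
        have r: "r > 0" using \<rho> by (simp add: r_def)
        have sub: "ball x \<rho> \<subseteq> ball y r"
        proof
          fix z assume "z \<in> ball x \<rho>"
          then show "z \<in> ball y r" using d dist_triangle[of y z x] \<rho> by (simp add: r_def dist_commute)
        qed
        have gg: "trunc (ball y r) g = g" using \<rho> by (auto simp: g_def r_def trunc_def indicator_def fun_eq_iff)
        have "Upsilon (r / \<rho>) \<le> 8" using Upsilon_le[of 8] \<rho> by (simp add: r_def)
        moreover have "Upsilon (r / \<rho>) \<ge> 0" using Upsilon_ge(1)[of "r / \<rho>"] r \<rho> by simp
        ultimately have U: "Upsilon (r / \<rho>) powr \<theta>2 \<le> 8 powr \<theta>2" using pos by (intro powr_mono2) auto
        have vr: "vol y r > 0" using r by (rule vol_pos)
        have w1: "vol y r powr iq \<le> A * vol x \<rho> powr iq"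
        proof (rule powr_le_mult_powr)
          have "vol y r \<le> (2 + (r + dist y x) / \<rho>) powr dim * vol x \<rho>" using r \<rho> by (rule volume_comparison[rotated])
          also have "\<dots> \<le> A * vol x \<rho>" unfolding A_def
            using d \<rho> dim_nonneg vp by (intro mult_right_mono powr_mono2) (auto simp: r_def dist_commute field_simps)
          finally show "vol y r \<le> A * vol x \<rho>" .
        qed (use A iq vp vr in auto)
        have w2: "vol y r powr (- ip) \<le> 1 * vol y \<rho> powr (- ip)"
          using \<rho> r ip vp vr by (intro powr_minus_le_mult_powr_minus) (auto simp: r_def intro!: vol_mono)
        have ex: "1 \<le> exp (2 * c) * exp (- c' * u\<^sup>2)"
        proof -
          have "u\<^sup>2 \<le> 5\<^sup>2" using True u by (intro power_mono) auto
          then have "c' * u\<^sup>2 \<le> c' * 25" using pos by (intro mult_left_mono) (auto simp: c'_def)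
          then have "0 \<le> 2 * c + (- c' * u\<^sup>2)" by (simp add: c'_def)
          then show ?thesis by (simp only: exp_add[symmetric] one_le_exp_iff)
        qed
        have "Lp_norm M q (trunc (ball x \<rho>) (T (\<rho>\<^sup>2) g)) \<le> Lp_norm M q (trunc (ball y r) (T (\<rho>\<^sup>2) (trunc (ball y r) g)))"
          unfolding gg using Tm[OF g] sub by (intro Lp_norm_trunc_mono q) auto
        also have "\<dots> = ennreal (vol y r powr iq) * Lp_avg M q (ball y r) (ball y r) (T (\<rho>\<^sup>2) (trunc (ball y r) g))"
          using Lp_avg_ball[OF q r Tm, of "trunc (ball y r) g" "ball y r" y] vr g
          by (simp add: gg iq_def[symmetric] mult.assoc[symmetric] ennreal_mult[symmetric] powr_add[symmetric])
        also have "\<dots> \<le> ennreal (vol y r powr iq) * (ennreal (C * Upsilon (r / \<rho>) powr \<theta>2) * Lp_avg M p (ball y r) (ball y r) g)"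
          using near[OF t(1) r gL, of y] t by (intro mult_left_mono) auto
        also have "Lp_avg M p (ball y r) (ball y r) g = ennreal (vol y r powr (- ip)) * X"
          by (subst Lp_avg_ball[OF p r]) (auto simp: gg ip_def X_def)
        also have "ennreal (vol y r powr iq) * (ennreal (C * Upsilon (r / \<rho>) powr \<theta>2) * (ennreal (vol y r powr (- ip)) * X))
          = ennreal (vol y r powr iq * (C * Upsilon (r / \<rho>) powr \<theta>2) * vol y r powr (- ip)) * X"
          using pos by (simp add: ennreal_mult mult.assoc)
        also have "\<dots> \<le> ennreal (A * vol x \<rho> powr iq * (C * 8 powr \<theta>2) * (1 * vol y \<rho> powr (- ip)) * (exp (2 * c) * exp (- c' * u\<^sup>2))) * X"
        proof (intro mult_right_mono ennreal_leI)
          have "vol y r powr iq * (C * Upsilon (r / \<rho>) powr \<theta>2) * vol y r powr (- ip) * 1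
            \<le> A * vol x \<rho> powr iq * (C * 8 powr \<theta>2) * (1 * vol y \<rho> powr (- ip)) * (exp (2 * c) * exp (- c' * u\<^sup>2))"
            using pos A by (intro mult_mono w1 w2 ex U order_refl) auto
          then show "vol y r powr iq * (C * Upsilon (r / \<rho>) powr \<theta>2) * vol y r powr (- ip)
            \<le> A * vol x \<rho> powr iq * (C * 8 powr \<theta>2) * (1 * vol y \<rho> powr (- ip)) * (exp (2 * c) * exp (- c' * u\<^sup>2))" by simp
        qed simp
        also have "\<dots> = ennreal (C1 * exp (- c' * u\<^sup>2) * V) * X"
          by (simp add: C1_def V_def mult_ac)
        also have "\<dots> \<le> ennreal ((C1 + C2) * exp (- c' * u\<^sup>2) * V) * X"
          using C12 V by (intro mult_right_mono ennreal_leI) auto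
        finally show ?thesis .
      next
        case False
        obtain j where j: "2 ^ j \<le> u - 1" "u - 1 < 2 ^ (j + 1)" using ex_dyadic_interval[of "u - 1"] False by auto
        have j2: "j \<ge> 2"
        proof (rule ccontr)
          assume "\<not> j \<ge> 2"
          then have "(2::real) ^ (j + 1) \<le> 2 ^ 2" by (intro power_increasing) auto
          then show False using j False by simp
        qed
        have pw: "(2::real) ^ (j + 2) = 4 * 2 ^ j" "(2::real) ^ (j + 1) = 2 * 2 ^ j" "(2::real) ^ j \<ge> 4"
          using power_increasing[OF j2, of "2::real"] by (auto simp: power_add)
        \<comment> \<open>From 2^j \<le> u - 1 < 2^(j+1) and 2^j \<ge> 4 one gets u + 1 \<le>
          2^(j+2), so two annuli suffice.\<close>
        have cover: "ball y \<rho> \<subseteq> annulus j x \<rho> \<union> annulus (Suc j) x \<rho>"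
        proof
          fix z assume "z \<in> ball y \<rho>"
          then have z: "dist y z < \<rho>" by simp
          have "dist x z < (u + 1) * \<rho>" "(u - 1) * \<rho> < dist x z"
          proof -
            have "dist x y = u * \<rho>" using \<rho> by (simp add: u_def)
            then show "dist x z < (u + 1) * \<rho>" "(u - 1) * \<rho> < dist x z"
              using z dist_triangle[of x z y] dist_triangle[of x y z] by (simp_all add: algebra_simps dist_commute)
          qed
          moreover have "(u + 1) * \<rho> \<le> 2 ^ (j + 2) * \<rho>" using j pw \<rho> by (intro mult_right_mono) auto
          moreover have "2 ^ j * \<rho> \<le> (u - 1) * \<rho>" using j \<rho> by (intro mult_right_mono) auto
          ultimately have "2 ^ j * \<rho> \<le> dist x z" "dist x z < 2 ^ (j + 2) * \<rho>" by linarith+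
          then show "z \<in> annulus j x \<rho> \<union> annulus (Suc j) x \<rho>" by (auto simp: annulus_def)
        qed
        have piece: "Lp_norm M q (trunc (ball x \<rho>) (T (\<rho>\<^sup>2) (trunc (annulus i x \<rho>) g)))
            \<le> ennreal (C * 2 powr \<theta> * K * A * exp (- c' * u\<^sup>2) * V) * X"
          if i: "i = j \<or> i = Suc j" for i
        proof -
          have i2: "i \<ge> 2" using i j2 by auto
          have ib: "2 ^ i \<le> 2 * u" "2 / 5 * u \<le> 2 ^ i" "(2::real) ^ i \<ge> 4"
            using i j pw False by auto
          have Ui: "Upsilon (2 ^ i * \<rho> / \<rho>) \<le> 2 ^ i" using Upsilon_le[of "2 ^ i"] ib \<rho> by simp
          have Ui0: "Upsilon (2 ^ i * \<rho> / \<rho>) \<ge> 0" using Upsilon_ge(1)[of "2 ^ i * \<rho> / \<rho>"] \<rho> by simp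
          have "2 powr (real i * \<theta>1) * Upsilon (2 ^ i * \<rho> / \<rho>) powr \<theta>2 \<le> (2 ^ i) powr \<theta>1 * (2 ^ i) powr \<theta>2"
            using Ui Ui0 pos by (intro mult_mono powr_mono2) (auto simp: powr_powr powr_realpow[symmetric])
          also have "\<dots> = (2 ^ i) powr \<theta>" by (simp add: \<theta>_def powr_add)
          also have "\<dots> \<le> (2 * (1 + u)) powr \<theta>" using ib u pos by (intro powr_mono2) (auto simp: \<theta>_def)
          also have "\<dots> = 2 powr \<theta> * (1 + u) powr \<theta>" by (simp only: powr_mult)
          also have "\<dots> \<le> 2 powr \<theta> * (K * exp (c' * u\<^sup>2))" using K(2)[OF u] by (intro mult_left_mono) (auto simp: c'_def)
          finally have b1: "2 powr (real i * \<theta>1) * Upsilon (2 ^ i * \<rho> / \<rho>) powr \<theta>2 \<le> 2 powr \<theta> * (K * exp (c' * u\<^sup>2))" .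
          have b2: "exp (- (c * 4 ^ i * \<rho>\<^sup>2 / \<rho>\<^sup>2)) \<le> exp (- c' * u\<^sup>2 - c' * u\<^sup>2)"
          proof -
            have "(2 / 5 * u)\<^sup>2 \<le> (2 ^ i)\<^sup>2" using ib u by (intro power_mono) auto
            also have "((2::real) ^ i)\<^sup>2 = 4 ^ i" by (simp add: power2_eq_square flip: power_mult_distrib)
            finally have "4 / 25 * u\<^sup>2 \<le> 4 ^ i" by (simp add: power_mult_distrib power2_eq_square)
            then have "c * (4 / 25 * u\<^sup>2) \<le> c * 4 ^ i" using pos by (intro mult_left_mono) auto
            then show ?thesis using \<rho> by (simp add: c'_def)
          qed
          define R where "R = 2 ^ (i + 1) * \<rho>"
          have R: "R > 0" using \<rho> by (simp add: R_def)
          have vR: "vol x R > 0" using R by (rule vol_pos)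
          have b3: "vol x R powr (- ip) \<le> A * vol y \<rho> powr (- ip)"
          proof (rule powr_minus_le_mult_powr_minus)
            have "ball y \<rho> \<subseteq> ball x (2 * R)"
            proof
              fix z assume "z \<in> ball y \<rho>"
              then have "z \<in> annulus j x \<rho> \<union> annulus (Suc j) x \<rho>" using cover by auto
              then have "dist x z < 2 ^ (j + 2) * \<rho>" using pw \<rho> by (auto simp: annulus_def)
              also have "\<dots> \<le> 2 ^ (i + 2) * \<rho>" using i \<rho> by (intro mult_right_mono power_increasing) auto
              finally show "z \<in> ball x (2 * R)" by (simp add: R_def)
            qed
            then have "vol y \<rho> \<le> vol x (2 * R)" using \<rho> R by (intro vol_mono) auto
            also have "\<dots> \<le> (2 + (2 * R + dist x x) / R) powr dim * vol x R" using R by (intro volume_comparison) auto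
            also have "\<dots> \<le> A * vol x R" unfolding A_def
              using R dim_nonneg vR by (intro mult_right_mono powr_mono2) auto
            finally show "vol y \<rho> \<le> A * vol x R" .
          qed (use A ip vp vR in auto)
          have "Lp_norm M q (trunc (ball x \<rho>) (T (\<rho>\<^sup>2) (trunc (annulus i x \<rho>) g)))
            = ennreal (vol x \<rho> powr iq) * Lp_avg M q (ball x \<rho>) (ball x \<rho>) (T (\<rho>\<^sup>2) (trunc (annulus i x \<rho>) g))"
            using Lp_avg_ball[OF q \<rho> Tm, of "trunc (annulus i x \<rho>) g" "ball x \<rho>" x] vp g trunc_closed[OF g annulus_sets]
            by (simp add: iq_def[symmetric] mult.assoc[symmetric] ennreal_mult[symmetric] powr_add[symmetric])
          also have "\<dots> \<le> ennreal (vol x \<rho> powr iq) * (ennreal (C * 2 powr (real i * \<theta>1) * Upsilon (2 ^ i * \<rho> / \<rho>) powr \<theta>2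
               * exp (- (c * 4 ^ i * \<rho>\<^sup>2 / \<rho>\<^sup>2))) * Lp_avg M p (ball x R) (annulus i x \<rho>) g)"
            using far[OF t(1) \<rho> gL i2, of x] unfolding t(2) R_def by (intro mult_left_mono) auto
          also have "Lp_avg M p (ball x R) (annulus i x \<rho>) g = ennreal (vol x R powr (- ip)) * Lp_norm M p (trunc (annulus i x \<rho>) g)"
            unfolding ip_def by (rule Lp_avg_ball[OF p R]) auto
          also have "ennreal (vol x \<rho> powr iq) * (ennreal (C * 2 powr (real i * \<theta>1) * Upsilon (2 ^ i * \<rho> / \<rho>) powr \<theta>2
               * exp (- (c * 4 ^ i * \<rho>\<^sup>2 / \<rho>\<^sup>2))) * (ennreal (vol x R powr (- ip)) * Lp_norm M p (trunc (annulus i x \<rho>) g)))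
            = ennreal (vol x \<rho> powr iq * (C * (2 powr (real i * \<theta>1) * Upsilon (2 ^ i * \<rho> / \<rho>) powr \<theta>2)
               * exp (- (c * 4 ^ i * \<rho>\<^sup>2 / \<rho>\<^sup>2)) * vol x R powr (- ip))) * Lp_norm M p (trunc (annulus i x \<rho>) g)"
            using pos by (simp add: ennreal_mult mult.assoc)
          also have "\<dots> \<le> ennreal (vol x \<rho> powr iq * (C * (2 powr \<theta> * (K * exp (c' * u\<^sup>2)))
               * exp (- c' * u\<^sup>2 - c' * u\<^sup>2) * (A * vol y \<rho> powr (- ip)))) * X"
            unfolding X_def using pos A K
            by (intro mult_mono ennreal_leI order_refl b1 b2 b3 Lp_norm_trunc_le[OF p]) auto
          also have "vol x \<rho> powr iq * (C * (2 powr \<theta> * (K * exp (c' * u\<^sup>2)))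
               * exp (- c' * u\<^sup>2 - c' * u\<^sup>2) * (A * vol y \<rho> powr (- ip))) = C * 2 powr \<theta> * K * A * exp (- c' * u\<^sup>2) * V"
          proof -
            have "exp (c' * u\<^sup>2) * exp (- c' * u\<^sup>2 - c' * u\<^sup>2) = exp (- c' * u\<^sup>2)" by (simp only: exp_add[symmetric]) simp
            then show ?thesis by (simp add: V_def mult_ac)
          qed
          finally show ?thesis .
        qed
        have gg: "trunc (annulus j x \<rho> \<union> annulus (Suc j) x \<rho>) g = g"
          using cover by (auto simp: g_def trunc_def indicator_def fun_eq_iff)
        have disj: "annulus j x \<rho> \<inter> annulus (Suc j) x \<rho> = {}" by (auto simp: annulus_def)
        have "Lp_norm M q (trunc (ball x \<rho>) (T (\<rho>\<^sup>2) g))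
          \<le> Lp_norm M q (trunc (ball x \<rho>) (T (\<rho>\<^sup>2) (trunc (annulus j x \<rho>) g)))
            + Lp_norm M q (trunc (ball x \<rho>) (T (\<rho>\<^sup>2) (trunc (annulus (Suc j) x \<rho>) g)))"
          using T_trunc_disjoint_Un_le[OF q t(1) g _ _ _ disj, of "ball x \<rho>"] by (simp add: gg)
        also have "\<dots> \<le> ennreal (C * 2 powr \<theta> * K * A * exp (- c' * u\<^sup>2) * V) * X + ennreal (C * 2 powr \<theta> * K * A * exp (- c' * u\<^sup>2) * V) * X"
          by (intro add_mono piece) auto
        also have "\<dots> = ennreal (C2 * exp (- c' * u\<^sup>2) * V) * X"
        proof -
          define k where "k = C * 2 powr \<theta> * K * A * exp (- c' * u\<^sup>2) * V"
          have "k \<ge> 0" using pos K A V by (simp add: k_def)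
          then have "ennreal k * X + ennreal k * X = ennreal (2 * k) * X"
            by (simp add: distrib_right[symmetric] ennreal_plus[symmetric] del: ennreal_plus)
          moreover have "2 * k = C2 * exp (- c' * u\<^sup>2) * V" by (simp add: k_def C2_def)
          ultimately show ?thesis by (simp only: k_def[symmetric])
        qed
        also have "\<dots> \<le> ennreal ((C1 + C2) * exp (- c' * u\<^sup>2) * V) * X"
          using C12 V by (intro mult_right_mono ennreal_leI) auto
        finally show ?thesis .
      qed
    qed
    then show "Lp_norm M q (trunc (ball x \<rho>) (T (1 * \<rho>\<^sup>2) (trunc (ball y \<rho>) f)))
       \<le> ennreal ((C1 + C2) * exp (- c' * (dist x y / \<rho>)\<^sup>2) * vol x \<rho> powr iq * vol y \<rho> powr (- ip))
         * Lp_norm M p (trunc (ball y \<rho>) f)"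
      by (simp add: g_def X_def V_def u_def mult.assoc)
  qed
qed

end

section \<open>Jensen, Schur and composition\<close>

context doubling_semigroup
begin

text \<open>The volume powers in \<open>gauss_bound\<close> are exactly those that Jensen's
  inequality produces on the two balls, so C and c are unchanged.\<close>

lemma gauss_bound_Jensen:
  assumes p: "p \<in> {1..\<infinity>}" "p \<le> p1" and q: "q \<in> {1..\<infinity>}" "1 \<le> q1" "q1 \<le> q" and a: "a > 0" and G: "gauss_bound a p q"
  shows "gauss_bound a p1 q1"
proof -
  define ip iq ip1 iq1 where "ip = 1 / real_of_ereal p" and "iq = 1 / real_of_ereal q"
    and "ip1 = 1 / real_of_ereal p1" and "iq1 = 1 / real_of_ereal q1"
  from G obtain C c where Cc: "C > 0" "c > 0" and
    est: "\<And>\<rho> x y f. \<rho> > 0 \<Longrightarrow> f \<in> \<B> \<Longrightarrow> Lp_norm M q (trunc (ball x \<rho>) (T (a * \<rho>\<^sup>2) (trunc (ball y \<rho>) f)))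
     \<le> ennreal (C * exp (- c * (dist x y / \<rho>)\<^sup>2) * vol x \<rho> powr iq * vol y \<rho> powr (- ip))
        * Lp_norm M p (trunc (ball y \<rho>) f)"
    unfolding gauss_bound_def ip_def iq_def by metis
  have p1: "p1 \<in> {1..\<infinity>}" using p by auto
  show ?thesis
    unfolding gauss_bound_def ip1_def[symmetric] iq1_def[symmetric]
  proof (rule exI[of _ C], intro conjI exI[of _ c] Cc allI impI ballI)
    fix \<rho> :: real and x y :: 'a and f assume \<rho>: "\<rho> > 0" and f: "f \<in> \<B>"
    define g where "g = T (a * \<rho>\<^sup>2) (trunc (ball y \<rho>) f)"
    have fm: "f \<in> borel_measurable M" using f by (rule measurable)
    have gm: "g \<in> borel_measurable M" unfolding g_def using a \<rho> f by (intro T_measurable trunc_closed) auto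
    have vx: "vol x \<rho> > 0" and vy: "vol y \<rho> > 0" using \<rho> by (auto intro: vol_pos)
    define e where "e = C * exp (- c * (dist x y / \<rho>)\<^sup>2)"
    have e: "e > 0" using Cc by (simp add: e_def)
    have "Lp_norm M q1 (trunc (ball x \<rho>) g) \<le> ennreal (vol x \<rho> powr (iq1 - iq)) * Lp_norm M q (trunc (ball x \<rho>) g)"
      unfolding iq_def iq1_def using q gm finite_ball[OF \<rho>] vx by (intro Lp_norm_Jensen) (auto simp: vol_def)
    also have "\<dots> \<le> ennreal (vol x \<rho> powr (iq1 - iq)) * (ennreal (e * vol x \<rho> powr iq * vol y \<rho> powr (- ip)) * Lp_norm M p (trunc (ball y \<rho>) f))"
      unfolding g_def e_def by (intro mult_left_mono est \<rho> f) auto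
    also have "\<dots> \<le> ennreal (vol x \<rho> powr (iq1 - iq)) * (ennreal (e * vol x \<rho> powr iq * vol y \<rho> powr (- ip)) *
        (ennreal (vol y \<rho> powr (ip - ip1)) * Lp_norm M p1 (trunc (ball y \<rho>) f)))"
      unfolding ip_def ip1_def using p p1 fm finite_ball[OF \<rho>] vy
      by (intro mult_left_mono Lp_norm_Jensen) (auto simp: vol_def)
    also have "\<dots> = ennreal (vol x \<rho> powr (iq1 - iq) * (e * vol x \<rho> powr iq * vol y \<rho> powr (- ip)) * vol y \<rho> powr (ip - ip1)) * Lp_norm M p1 (trunc (ball y \<rho>) f)"
      using e by (simp add: ennreal_mult mult.assoc)
    also have "vol x \<rho> powr (iq1 - iq) * (e * vol x \<rho> powr iq * vol y \<rho> powr (- ip)) * vol y \<rho> powr (ip - ip1)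
      = e * vol x \<rho> powr iq1 * vol y \<rho> powr (- ip1)"
    proof -
      have "vol x \<rho> powr iq1 = vol x \<rho> powr (iq1 - iq) * vol x \<rho> powr iq"
        "vol y \<rho> powr (- ip1) = vol y \<rho> powr (- ip) * vol y \<rho> powr (ip - ip1)"
        by (simp_all only: powr_add[symmetric]) simp_all
      then show ?thesis by (simp add: mult_ac)
    qed
    finally show "Lp_norm M q1 (trunc (ball x \<rho>) (T (a * \<rho>\<^sup>2) (trunc (ball y \<rho>) f)))
       \<le> ennreal (C * exp (- c * (dist x y / \<rho>)\<^sup>2) * vol x \<rho> powr iq1 * vol y \<rho> powr (- ip1))
         * Lp_norm M p1 (trunc (ball y \<rho>) f)"
      by (simp add: g_def e_def)
  qed
qed

text \<open>A Schur test over a finite net: the volume factors are absorbed into the Gaussian, whose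
  row and column sums are uniformly bounded.\<close>

lemma gauss_bound_imp_uniformly_bounded:
  assumes p: "p \<in> {1..\<infinity>}" and G: "gauss_bound 1 p p"
  shows "p \<in> uniformly_bounded_exponents M \<B> T"
proof -
  define ip where "ip = 1 / real_of_ereal p"
  have ip: "0 \<le> ip" "ip \<le> 1" using recip_exponent_bounds[OF p] by (auto simp: ip_def)
  from G obtain C c where Cc: "C > 0" "c > 0" and
    est: "\<And>\<rho> x y f. \<rho> > 0 \<Longrightarrow> f \<in> \<B> \<Longrightarrow> Lp_norm M p (trunc (ball x \<rho>) (T (\<rho>\<^sup>2) (trunc (ball y \<rho>) f)))
     \<le> ennreal (C * exp (- c * (dist x y / \<rho>)\<^sup>2) * vol x \<rho> powr ip * vol y \<rho> powr (- ip))
        * Lp_norm M p (trunc (ball y \<rho>) f)"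
    unfolding gauss_bound_def ip_def[symmetric] mult_1_left by metis
  have c2: "c / 2 > 0" using Cc by simp
  \<comment> \<open>Half of the Gaussian turns the volume ratio into a constant; the other half
    remains as the symmetric kernel w.\<close>
  obtain K where K: "K \<ge> 1" "\<And>x y \<rho>. \<rho> > 0 \<Longrightarrow> vol x \<rho> powr ip \<le> K * exp (c / 2 * (dist x y / \<rho>)\<^sup>2) * vol y \<rho> powr ip"
    using volume_comparison_gauss[OF ip(1) c2] by metis
  obtain W where W: "W > 0" "\<And>\<rho> F (x::'a). \<rho> > 0 \<Longrightarrow> finite F \<Longrightarrow> separated \<rho> F \<Longrightarrow> (\<Sum>z\<in>F. exp (- (c / 2) * (dist x z / \<rho>)\<^sup>2)) \<le> W"
    using gauss_sum_bound[OF c2] by metis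
  define \<kappa> where "\<kappa> = C * K"
  have \<kappa>: "\<kappa> > 0" using Cc K by (simp add: \<kappa>_def)
  \<comment> \<open>The bound is independent of both radii, so the source ball may grow by
    \<open>annular_expansion\<close> and the target ball may exhaust the space.\<close>
  have step: "Lp_norm M p (trunc (ball x0 R1) (T (\<rho>\<^sup>2) (trunc (ball x0 R2) f))) \<le> ennreal (\<kappa> * W * A)"
    if \<rho>: "\<rho> > 0" and R: "R1 > 0" "R2 > 0" and f: "f \<in> \<B>" and A: "A \<ge> 0" "Lp_norm M p f \<le> ennreal A" for \<rho> x0 R1 R2 f A
  proof -
    have fm [measurable]: "f \<in> borel_measurable M" using f by (rule measurable)
    define w where "w z y = exp (- (c / 2) * (dist z y / \<rho>)\<^sup>2)" for z y :: 'a
    have w: "w z y > 0" "w z y = w y z" for z y by (auto simp: w_def dist_commute)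
    have local: "Lp_norm M p (trunc (ball x \<rho>) (T (\<rho>\<^sup>2) (trunc E f))) \<le> ennreal (\<kappa> * w x y) * Lp_norm M p (trunc E f)"
      if E: "E \<in> sets M" "E \<subseteq> ball y \<rho>" for x y E
    proof -
      have eqt: "trunc (ball y \<rho>) (trunc E f) = trunc E f" using E by (simp add: trunc_trunc Int_absorb1)
      have vy: "vol y \<rho> > 0" using \<rho> by (rule vol_pos)
      have "vol x \<rho> powr ip * vol y \<rho> powr (- ip) \<le> K * exp (c / 2 * (dist x y / \<rho>)\<^sup>2) * vol y \<rho> powr ip * vol y \<rho> powr (- ip)"
        using K(2)[OF \<rho>, of x y] by (intro mult_right_mono) auto
      also have "\<dots> = K * exp (c / 2 * (dist x y / \<rho>)\<^sup>2)" using vy by (simp add: powr_minus)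
      finally have "C * exp (- c * (dist x y / \<rho>)\<^sup>2) * (vol x \<rho> powr ip * vol y \<rho> powr (- ip))
        \<le> C * exp (- c * (dist x y / \<rho>)\<^sup>2) * (K * exp (c / 2 * (dist x y / \<rho>)\<^sup>2))"
        using Cc by (intro mult_left_mono) auto
      also have "\<dots> = \<kappa> * (exp (- c * (dist x y / \<rho>)\<^sup>2) * exp (c / 2 * (dist x y / \<rho>)\<^sup>2))"
        by (simp add: \<kappa>_def)
      also have "\<dots> = \<kappa> * w x y" by (simp add: w_def exp_add[symmetric])
      finally have "C * exp (- c * (dist x y / \<rho>)\<^sup>2) * vol x \<rho> powr ip * vol y \<rho> powr (- ip) \<le> \<kappa> * w x y"
        by (simp add: mult.assoc)
      then show ?thesis
        using est[OF \<rho> trunc_closed[OF f E(1)], of x y] unfolding eqt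
        by (meson ennreal_leI mult_right_mono order_trans zero_le)
    qed
    obtain F1 where F1: "finite F1" "separated \<rho> F1" "F1 \<subseteq> ball x0 R1" "ball x0 R1 \<subseteq> (\<Union>z\<in>F1. ball z \<rho>)"
      using finite_net[OF \<rho> R(1)] by metis
    obtain F2 where F2: "finite F2" "separated \<rho> F2" "F2 \<subseteq> ball x0 R2" "ball x0 R2 \<subseteq> (\<Union>z\<in>F2. ball z \<rho>)"
      using finite_net[OF \<rho> R(2)] by metis
    obtain Q where Q: "\<And>z. z \<in> F1 \<Longrightarrow> Q z \<in> sets M" "\<And>z. z \<in> F1 \<Longrightarrow> Q z \<subseteq> ball z \<rho>"
      "disjoint_family_on Q F1" "(\<Union>z\<in>F1. Q z) = ball x0 R1"
      using disjoint_refinement[OF F1(1) ball_sets F1(4)] by metis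
    obtain P where P: "\<And>z. z \<in> F2 \<Longrightarrow> P z \<in> sets M" "\<And>z. z \<in> F2 \<Longrightarrow> P z \<subseteq> ball z \<rho>"
      "disjoint_family_on P F2" "(\<Union>z\<in>F2. P z) = ball x0 R2"
      using disjoint_refinement[OF F2(1) ball_sets F2(4)] by metis
    define g where "g = T (\<rho>\<^sup>2) (trunc (ball x0 R2) f)"
    have g_meas [measurable]: "g \<in> borel_measurable M"
      unfolding g_def using \<rho> f by (intro T_measurable trunc_closed) auto
    have cell: "Lp_norm M p (trunc (Q z) g) \<le> (\<Sum>y\<in>F2. ennreal (\<kappa> * w z y) * Lp_norm M p (trunc (P y) f))" if z: "z \<in> F1" for z
    proof -
      have "Lp_norm M p (trunc (Q z) g) \<le> Lp_norm M p (trunc (ball z \<rho>) g)"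
        using Q z by (intro Lp_norm_trunc_mono p) auto
      also have "\<dots> \<le> (\<Sum>y\<in>F2. Lp_norm M p (trunc (ball z \<rho>) (T (\<rho>\<^sup>2) (trunc (P y) f))))"
        unfolding g_def P(4)[symmetric] using P F2 \<rho> f by (intro Lp_norm_T_disjoint_le[OF p]) auto
      also have "\<dots> \<le> (\<Sum>y\<in>F2. ennreal (\<kappa> * w z y) * Lp_norm M p (trunc (P y) f))"
        using P by (intro sum_mono local)
      finally show ?thesis .
    qed
    \<comment> \<open>Row and column sums of w; the second uses the symmetry of w.\<close>
    have W1: "(\<Sum>y\<in>F2. w z y) \<le> W" for z
      unfolding w_def by (rule W(2)[OF \<rho> F2(1,2)])
    have W2: "(\<Sum>z\<in>F1. w z y) \<le> W" for y
      unfolding w(2)[of _ y] unfolding w_def by (rule W(2)[OF \<rho> F1(1,2)])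
    show "Lp_norm M p (trunc (ball x0 R1) (T (\<rho>\<^sup>2) (trunc (ball x0 R2) f))) \<le> ennreal (\<kappa> * W * A)"
      unfolding g_def[symmetric] using p
    proof (cases rule: exponent_cases)
      case (real r)
      have fA: "(\<integral>\<^sup>+x. ennreal (norm (f x) powr r) \<partial>M) \<le> ennreal (A powr r)"
        using A real by (simp add: Lp_norm_real_le_iff)
      define I where "I y = (\<integral>\<^sup>+x. ennreal (norm (trunc (P y) f x) powr r) \<partial>M)" for y
      have sumI: "(\<Sum>y\<in>F2. I y) \<le> ennreal (A powr r)"
      proof -
        have "(\<Sum>y\<in>F2. I y) = (\<integral>\<^sup>+x. ennreal (norm (trunc (ball x0 R2) f x) powr r) \<partial>M)"
          unfolding I_def P(4)[symmetric] using P F2 real by (intro nn_integral_trunc_UN_disjoint[symmetric]) auto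
        also have "\<dots> \<le> (\<integral>\<^sup>+x. ennreal (norm (f x) powr r) \<partial>M)"
          using real by (intro nn_integral_mono ennreal_leI powr_mono2) (auto simp: norm_trunc_le)
        finally show ?thesis using fA by simp
      qed
      define i where "i y = enn2real (I y)" for y
      have Ii: "I y = ennreal (i y)" if "y \<in> F2" for y
      proof -
        have "I y \<le> (\<Sum>y\<in>F2. I y)" using F2(1) that by (intro member_le_sum) auto
        then have "I y < \<infinity>" using sumI by (metis ennreal_less_top infinity_ennreal_def order_le_less_trans)
        then show ?thesis by (simp add: i_def)
      qed
      have i0: "i y \<ge> 0" for y by (simp add: i_def)
      have sumi: "(\<Sum>y\<in>F2. i y) \<le> A powr r"
      proof -
        have "ennreal (\<Sum>y\<in>F2. i y) = (\<Sum>y\<in>F2. I y)" using Ii i0 by (subst sum_ennreal[symmetric]) auto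
        then have "ennreal (\<Sum>y\<in>F2. i y) \<le> ennreal (A powr r)" using sumI by simp
        then show ?thesis by (subst (asm) ennreal_le_iff) auto
      qed
      define \<alpha> where "\<alpha> y = i y powr (1 / r)" for y
      have \<alpha>r: "\<alpha> y powr r = i y" for y using real i0 by (simp add: \<alpha>_def powr_powr)
      have \<alpha>0: "\<alpha> y \<ge> 0" for y by (simp add: \<alpha>_def)
      have P\<alpha>: "Lp_norm M p (trunc (P y) f) \<le> ennreal (\<alpha> y)" if "y \<in> F2" for y
        unfolding real(1) using Ii[OF that] real \<alpha>0 by (subst Lp_norm_real_le_iff) (auto simp: I_def \<alpha>r)
      have cell_r: "(\<integral>\<^sup>+x. ennreal (norm (trunc (Q z) g x) powr r) \<partial>M) \<le> ennreal (\<kappa> powr r * (W powr (r - 1) * (\<Sum>y\<in>F2. w z y * i y)))"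
        if z: "z \<in> F1" for z
      proof -
        have "Lp_norm M p (trunc (Q z) g) \<le> (\<Sum>y\<in>F2. ennreal (\<kappa> * w z y) * ennreal (\<alpha> y))"
          using cell[OF z] by (rule order_trans) (intro sum_mono mult_left_mono P\<alpha>, auto)
        also have "\<dots> = ennreal (\<Sum>y\<in>F2. \<kappa> * w z y * \<alpha> y)"
          using \<kappa> w \<alpha>0 by (subst sum_ennreal[symmetric]) (auto simp: ennreal_mult less_imp_le)
        also have "(\<Sum>y\<in>F2. \<kappa> * w z y * \<alpha> y) = \<kappa> * (\<Sum>y\<in>F2. w z y * \<alpha> y)" by (simp add: sum_distrib_left mult.assoc)
        finally have *: "Lp_norm M p (trunc (Q z) g) \<le> ennreal (\<kappa> * (\<Sum>y\<in>F2. w z y * \<alpha> y))" .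
        have "(\<Sum>y\<in>F2. w z y * \<alpha> y) \<ge> 0" using w \<alpha>0 by (intro sum_nonneg) (simp add: less_imp_le)
        then have "(\<integral>\<^sup>+x. ennreal (norm (trunc (Q z) g x) powr r) \<partial>M) \<le> ennreal (\<kappa> powr r * (\<Sum>y\<in>F2. w z y * \<alpha> y) powr r)"
          using * real \<kappa> by (simp add: Lp_norm_real_le_iff powr_mult)
        \<comment> \<open>Jensen over y with row sum W gives W^(r - 1); the column sum in the
          summation over z supplies the last factor W.\<close>
        also have "\<dots> \<le> ennreal (\<kappa> powr r * (W powr (r - 1) * (\<Sum>y\<in>F2. w z y * \<alpha> y powr r)))"
          using F2 w(1) \<alpha>0 real W1 W(1) by (intro ennreal_leI mult_left_mono powr_weighted_sum_le) (auto simp: less_imp_le)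
        finally show ?thesis by (simp add: \<alpha>r)
      qed
      have "(\<integral>\<^sup>+x. ennreal (norm (trunc (ball x0 R1) g x) powr r) \<partial>M) = (\<Sum>z\<in>F1. \<integral>\<^sup>+x. ennreal (norm (trunc (Q z) g x) powr r) \<partial>M)"
        unfolding Q(4)[symmetric] using Q F1 real by (intro nn_integral_trunc_UN_disjoint) auto
      also have "\<dots> \<le> (\<Sum>z\<in>F1. ennreal (\<kappa> powr r * (W powr (r - 1) * (\<Sum>y\<in>F2. w z y * i y))))"
        by (intro sum_mono cell_r)
      also have "\<dots> = ennreal (\<Sum>z\<in>F1. \<kappa> powr r * (W powr (r - 1) * (\<Sum>y\<in>F2. w z y * i y)))"
        using w i0 by (intro sum_ennreal mult_nonneg_nonneg sum_nonneg) (auto simp: less_imp_le)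
      also have "(\<Sum>z\<in>F1. \<kappa> powr r * (W powr (r - 1) * (\<Sum>y\<in>F2. w z y * i y)))
        = \<kappa> powr r * (W powr (r - 1) * (\<Sum>y\<in>F2. (\<Sum>z\<in>F1. w z y) * i y))"
        by (simp add: sum_distrib_left sum_distrib_right sum.swap[of _ F1 F2])
      also have "ennreal \<dots> \<le> ennreal (\<kappa> powr r * (W powr (r - 1) * (W * A powr r)))"
      proof (intro ennreal_leI mult_left_mono)
        have "(\<Sum>y\<in>F2. (\<Sum>z\<in>F1. w z y) * i y) \<le> (\<Sum>y\<in>F2. W * i y)"
          using W2 i0 by (intro sum_mono mult_right_mono)
        also have "\<dots> = W * (\<Sum>y\<in>F2. i y)" by (simp add: sum_distrib_left)
        also have "\<dots> \<le> W * A powr r" using sumi W(1) by (intro mult_left_mono) auto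
        finally show "(\<Sum>y\<in>F2. (\<Sum>z\<in>F1. w z y) * i y) \<le> W * A powr r" .
      qed auto
      also have "\<kappa> powr r * (W powr (r - 1) * (W * A powr r)) = (\<kappa> * W * A) powr r"
        using W(1) by (simp add: powr_mult powr_diff)
      finally show "Lp_norm M p (trunc (ball x0 R1) g) \<le> ennreal (\<kappa> * W * A)"
        using real \<kappa> W(1) A by (simp add: Lp_norm_real_le_iff)
    next
      case infinity
      have bound: "AE x in M. norm (trunc (Q z) g x) \<le> \<kappa> * W * A" if z: "z \<in> F1" for z
      proof -
        have "Lp_norm M p (trunc (Q z) g) \<le> (\<Sum>y\<in>F2. ennreal (\<kappa> * w z y) * ennreal A)"
          using cell[OF z]
        proof (rule order_trans, intro sum_mono mult_left_mono)
          fix y assume "y \<in> F2"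
          then show "Lp_norm M p (trunc (P y) f) \<le> ennreal A"
            using Lp_norm_trunc_le[OF p fm P(1)] A(2) order_trans by blast
        qed auto
        also have "\<dots> = ennreal (\<Sum>y\<in>F2. \<kappa> * w z y * A)"
          using \<kappa> w A by (subst sum_ennreal[symmetric]) (auto simp: ennreal_mult less_imp_le)
        also have "(\<Sum>y\<in>F2. \<kappa> * w z y * A) = \<kappa> * (\<Sum>y\<in>F2. w z y) * A" by (simp add: sum_distrib_left sum_distrib_right)
        also have "ennreal \<dots> \<le> ennreal (\<kappa> * W * A)"
          using W1 \<kappa> A by (intro ennreal_leI mult_right_mono mult_left_mono) auto
        finally show ?thesis
          using infinity \<kappa> W(1) A Q(1)[OF z] by (simp add: Lp_norm_infinity_le_iff)
      qed
      then have "AE x in M. \<forall>z\<in>F1. norm (trunc (Q z) g x) \<le> \<kappa> * W * A"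
        using F1(1) by (simp add: AE_finite_all)
      then have "AE x in M. norm (trunc (ball x0 R1) g x) \<le> \<kappa> * W * A"
      proof eventually_elim
        fix x assume *: "\<forall>z\<in>F1. norm (trunc (Q z) g x) \<le> \<kappa> * W * A"
        show "norm (trunc (ball x0 R1) g x) \<le> \<kappa> * W * A"
        proof (cases "x \<in> ball x0 R1")
          case True
          then obtain z where z: "z \<in> F1" "x \<in> Q z" unfolding Q(4)[symmetric] by blast
          with * have "norm (trunc (Q z) g x) \<le> \<kappa> * W * A" by auto
          then show ?thesis using z(2) True by (simp add: trunc_def del: mem_ball)
        next
          case False
          then show ?thesis using \<kappa> W(1) A by (simp add: trunc_def del: mem_ball)
        qed
      qed
      then show "Lp_norm M p (trunc (ball x0 R1) g) \<le> ennreal (\<kappa> * W * A)"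
        using infinity \<kappa> W(1) A by (simp add: Lp_norm_infinity_le_iff)
    qed
  qed
  have "Lp_norm M p (T t f) \<le> ennreal (\<kappa> * W) * Lp_norm M p f" if t: "t > 0" and f: "f \<in> \<B> \<inter> Lp M p" for t f
  proof -
    define A where "A = enn2real (Lp_norm M p f)"
    have "Lp_norm M p f < \<infinity>" using f by (simp add: Lp_def)
    then have A: "Lp_norm M p f = ennreal A" "A \<ge> 0" by (simp_all add: A_def)
    define \<rho> where "\<rho> = sqrt t"
    have \<rho>: "\<rho> > 0" "\<rho>\<^sup>2 = t" using t by (auto simp: \<rho>_def)
    obtain x0 :: 'a where True by simp
    have fB: "f \<in> \<B>" "f \<in> Lp M p" using f by auto
    have Tm: "T t f \<in> borel_measurable M" using t fB by (intro T_measurable)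
    \<comment> \<open>The source is exhausted by the dyadic balls of
      \<open>annular_expansion\<close>, with the target restricted to a ball; the target radius n +
      1 grows afterwards.\<close>
    have loc: "Lp_norm M p (trunc (ball x0 (real n + 1)) (T t f)) \<le> ennreal (\<kappa> * W * A)" for n
    proof (rule Lp_norm_T_expansion_le[OF p p t fB(2,1), where r=1 and x=x0])
      show "Lp_norm M p (trunc (ball x0 (real n + 1)) (T t (trunc (ball x0 (2 ^ k * 1)) f))) \<le> ennreal (\<kappa> * W * A)" for k
        using step[OF \<rho>(1) _ _ fB(1) A(2), of "real n + 1" "2 ^ k * 1" x0] A(1) by (simp add: \<rho>(2))
      show "emeasure M (ball x0 (real n + 1)) < \<infinity>" by (rule finite_ball) simp
    qed auto
    have "Lp_norm M p (T t f) \<le> ennreal (\<kappa> * W * A)"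
    proof (rule Lp_norm_le_of_AE_limit[OF p _ Tm _ loc])
      show "AE x in M. (\<lambda>n. trunc (ball x0 (real n + 1)) (T t f) x) \<longlonglongrightarrow> T t f x"
      proof (rule AE_I2)
        fix x
        obtain m :: nat where m: "dist x0 x < real m" using reals_Archimedean2 by blast
        have "eventually (\<lambda>n. trunc (ball x0 (real n + 1)) (T t f) x = T t f x) sequentially"
          using eventually_ge_at_top[of m] by eventually_elim (use m in \<open>auto simp: trunc_def indicator_def\<close>)
        then show "(\<lambda>n. trunc (ball x0 (real n + 1)) (T t f) x) \<longlonglongrightarrow> T t f x"
          by (rule tendsto_eventually)
      qed
    qed (use Tm in auto)
    then show ?thesis using A \<kappa> W(1) by (simp add: ennreal_mult)
  qed
  then show ?thesis unfolding uniformly_bounded_exponents_def using p by blast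
qed

text \<open>The intermediate function is cut into cells along a \<rho>-net. The volume powers at an
  intermediate cell cancel because both bounds carry the same exponent q, and the product of the
  Gaussians is summed over the net. Uniform boundedness puts T f into L^p, so that
  \<open>annular_expansion\<close> applies to it.\<close>

lemma gauss_bound_compose:
  assumes p: "p \<in> {1..\<infinity>}" and q: "q \<in> {1..\<infinity>}" and r: "r \<in> {1..\<infinity>}"
    and pU: "p \<in> uniformly_bounded_exponents M \<B> T" and pq: "gauss_bound 1 p q" and qr: "gauss_bound 1 q r"
  shows "gauss_bound 2 p r"
proof -
  define ip iq ir where "ip = 1 / real_of_ereal p" and "iq = 1 / real_of_ereal q" and "ir = 1 / real_of_ereal r"
  from pq obtain C1 c1 where 1: "C1 > 0" "c1 > 0" and
    est1: "\<And>\<rho> x y f. \<rho> > 0 \<Longrightarrow> f \<in> \<B> \<Longrightarrow> Lp_norm M q (trunc (ball x \<rho>) (T (\<rho>\<^sup>2) (trunc (ball y \<rho>) f)))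
     \<le> ennreal (C1 * exp (- c1 * (dist x y / \<rho>)\<^sup>2) * vol x \<rho> powr iq * vol y \<rho> powr (- ip))
        * Lp_norm M p (trunc (ball y \<rho>) f)"
    unfolding gauss_bound_def ip_def[symmetric] iq_def[symmetric] mult_1_left by metis
  from qr obtain C2 c2 where 2: "C2 > 0" "c2 > 0" and
    est2: "\<And>\<rho> x y f. \<rho> > 0 \<Longrightarrow> f \<in> \<B> \<Longrightarrow> Lp_norm M r (trunc (ball x \<rho>) (T (\<rho>\<^sup>2) (trunc (ball y \<rho>) f)))
     \<le> ennreal (C2 * exp (- c2 * (dist x y / \<rho>)\<^sup>2) * vol x \<rho> powr ir * vol y \<rho> powr (- iq))
        * Lp_norm M q (trunc (ball y \<rho>) f)"
    unfolding gauss_bound_def iq_def[symmetric] ir_def[symmetric] mult_1_left by metis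
  define c where "c = min c1 c2"
  have c: "c > 0" "c \<le> c1" "c \<le> c2" using 1 2 by (auto simp: c_def)
  have c2': "c / 2 > 0" using c by simp
  obtain W where W: "W > 0" "\<And>\<rho> F (x::'a). \<rho> > 0 \<Longrightarrow> finite F \<Longrightarrow> separated \<rho> F \<Longrightarrow> (\<Sum>z\<in>F. exp (- (c / 2) * (dist x z / \<rho>)\<^sup>2)) \<le> W"
    using gauss_sum_bound[OF c2'] by metis
  define C where "C = C1 * C2 * W"
  have C: "C > 0" using 1 2 W by (simp add: C_def)
  show ?thesis
    unfolding gauss_bound_def ip_def[symmetric] ir_def[symmetric]
  \<comment> \<open>If d \<le> a + b for the scaled distances, then c (a^2 + b^2) dominates (c / 4)
    d^2 + (c / 2) a^2; the Gaussian of the last term is summed over the net.\<close>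
  proof (rule exI[of _ C], intro conjI exI[of _ "c / 4"] C allI impI ballI)
    show "c / 4 > 0" using c by simp
    fix \<rho> :: real and x y :: 'a and f0 assume \<rho>: "\<rho> > 0" and f0: "f0 \<in> \<B>"
    define f where "f = trunc (ball y \<rho>) f0"
    have f: "f \<in> \<B>" using f0 by (simp add: f_def trunc_closed)
    have fm: "f \<in> borel_measurable M" using f by (rule measurable)
    have ff: "trunc (ball y \<rho>) f = f" by (simp add: f_def trunc_trunc)
    define X where "X = Lp_norm M p f"
    have v: "vol z \<rho> > 0" for z using \<rho> by (rule vol_pos)
    define V where "V = vol x \<rho> powr ir * vol y \<rho> powr (- ip)"
    have V: "V > 0" using v[of x] v[of y] by (simp add: V_def)
    define e where "e = exp (- (c / 4) * (dist x y / \<rho>)\<^sup>2)"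
    have e: "e > 0" by (simp add: e_def)
    have t: "\<rho>\<^sup>2 > 0" "2 * \<rho>\<^sup>2 > 0" using \<rho> by auto
    have "Lp_norm M r (trunc (ball x \<rho>) (T (2 * \<rho>\<^sup>2) f)) \<le> ennreal (C * e * V) * X"
    proof (cases "X = \<infinity>")
      case True
      then show ?thesis using C V e by (simp add: ennreal_mult_top)
    next
      case False
      then have fL: "f \<in> \<B> \<inter> Lp M p" using f fm by (auto simp: Lp_def X_def less_top)
      define g where "g = T (\<rho>\<^sup>2) f"
      have g: "g \<in> \<B>" unfolding g_def using f t by (intro T_mem)
      have gm [measurable]: "g \<in> borel_measurable M" using g by (rule measurable)
      from pU obtain B :: real where "Lp_norm M p g \<le> ennreal B * Lp_norm M p f"
        unfolding uniformly_bounded_exponents_def g_def using t fL by blast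
      also have "ennreal B * Lp_norm M p f < \<infinity>"
        using False by (simp add: X_def ennreal_mult_less_top less_top)
      finally have "Lp_norm M p g < \<infinity>" .
      then have gL: "g \<in> Lp M p" by (simp add: Lp_def)
      have "Lp_norm M r (trunc (ball x \<rho>) (T (2 * \<rho>\<^sup>2) f)) = Lp_norm M r (trunc (ball x \<rho>) (T (\<rho>\<^sup>2) g))"
      proof (rule Lp_norm_cong_AE[OF r])
        show "AE z in M. trunc (ball x \<rho>) (T (2 * \<rho>\<^sup>2) f) z = trunc (ball x \<rho>) (T (\<rho>\<^sup>2) g) z"
          using semigroup[OF t(1,1) f] unfolding g_def mult_2 by eventually_elim (simp add: trunc_def)
      qed (use t f g in \<open>auto intro!: trunc_measurable T_measurable\<close>)
      also have "\<dots> \<le> ennreal (C * e * V) * X"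
      proof (rule Lp_norm_T_expansion_le[OF p r t(1) gL g \<rho>])
        show "emeasure M (ball x \<rho>) < \<infinity>" using \<rho> by (rule finite_ball)
        fix k
        have R: "2 ^ k * \<rho> > 0" using \<rho> by simp
        obtain F where F: "finite F" "separated \<rho> F" "F \<subseteq> ball x (2 ^ k * \<rho>)" "ball x (2 ^ k * \<rho>) \<subseteq> (\<Union>z\<in>F. ball z \<rho>)"
          using finite_net[OF \<rho> R] by metis
        obtain P where P: "\<And>z. z \<in> F \<Longrightarrow> P z \<in> sets M" "\<And>z. z \<in> F \<Longrightarrow> P z \<subseteq> ball z \<rho>"
          "disjoint_family_on P F" "(\<Union>z\<in>F. P z) = ball x (2 ^ k * \<rho>)"
          using disjoint_refinement[OF F(1) ball_sets F(4)] by metis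
        have piece: "Lp_norm M r (trunc (ball x \<rho>) (T (\<rho>\<^sup>2) (trunc (P z) g))) \<le> ennreal (C1 * C2 * e * V * exp (- (c / 2) * (dist x z / \<rho>)\<^sup>2)) * X"
          if z: "z \<in> F" for z
        proof -
          define e1 where "e1 = exp (- c1 * (dist z y / \<rho>)\<^sup>2)"
          define e2 where "e2 = exp (- c2 * (dist x z / \<rho>)\<^sup>2)"
          have eqt: "trunc (ball z \<rho>) (trunc (P z) g) = trunc (P z) g" using P(2)[OF z] by (simp add: trunc_trunc Int_absorb1)
          have "Lp_norm M r (trunc (ball x \<rho>) (T (\<rho>\<^sup>2) (trunc (P z) g)))
            \<le> ennreal (C2 * e2 * vol x \<rho> powr ir * vol z \<rho> powr (- iq)) * Lp_norm M q (trunc (P z) g)"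
            using est2[OF \<rho> trunc_closed[OF g P(1)[OF z]], of x z] by (simp add: eqt e2_def)
          also have "\<dots> \<le> ennreal (C2 * e2 * vol x \<rho> powr ir * vol z \<rho> powr (- iq)) * Lp_norm M q (trunc (ball z \<rho>) g)"
            using P z by (intro mult_left_mono Lp_norm_trunc_mono q) auto
          also have "\<dots> \<le> ennreal (C2 * e2 * vol x \<rho> powr ir * vol z \<rho> powr (- iq)) * (ennreal (C1 * e1 * vol z \<rho> powr iq * vol y \<rho> powr (- ip)) * X)"
            using est1[OF \<rho> f, of z y] by (intro mult_left_mono) (auto simp: ff g_def e1_def X_def)
          also have "\<dots> = ennreal (C2 * e2 * vol x \<rho> powr ir * vol z \<rho> powr (- iq) * (C1 * e1 * vol z \<rho> powr iq * vol y \<rho> powr (- ip))) * X"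
            using 1 2 by (simp add: e1_def e2_def ennreal_mult mult.assoc)
          also have "C2 * e2 * vol x \<rho> powr ir * vol z \<rho> powr (- iq) * (C1 * e1 * vol z \<rho> powr iq * vol y \<rho> powr (- ip)) = C1 * C2 * (e1 * e2) * V"
            using v[of z] by (simp add: V_def powr_minus field_simps)
          also have "ennreal (C1 * C2 * (e1 * e2) * V) * X \<le> ennreal (C1 * C2 * (e * exp (- (c / 2) * (dist x z / \<rho>)\<^sup>2)) * V) * X"
          proof (intro mult_right_mono ennreal_leI mult_left_mono)
            define a b where "a = dist x z / \<rho>" and "b = dist z y / \<rho>"
            have ab: "a \<ge> 0" "b \<ge> 0" using \<rho> by (auto simp: a_def b_def)
            have "dist x y / \<rho> \<le> a + b" using dist_triangle[of x y z] \<rho>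
              by (simp add: a_def b_def add_divide_distrib[symmetric] divide_right_mono)
            then have "(dist x y / \<rho>)\<^sup>2 \<le> (a + b)\<^sup>2" using \<rho> by (intro power_mono) auto
            also have "\<dots> \<le> 2 * (a\<^sup>2 + b\<^sup>2)" using sum_squares_ge_zero[of "a - b" 0] by (simp add: power2_eq_square algebra_simps)
            finally have "(c / 4) * (dist x y / \<rho>)\<^sup>2 \<le> (c / 4) * (2 * (a\<^sup>2 + b\<^sup>2))" using c by (intro mult_left_mono) auto
            moreover have "c * a\<^sup>2 \<le> c2 * a\<^sup>2" "c * b\<^sup>2 \<le> c1 * b\<^sup>2" "0 \<le> c * b\<^sup>2" using c by (auto intro!: mult_right_mono)
            ultimately have "- c1 * b\<^sup>2 + - c2 * a\<^sup>2 \<le> - (c / 4) * (dist x y / \<rho>)\<^sup>2 + - (c / 2) * a\<^sup>2"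
              by (simp add: algebra_simps)
            then show "e1 * e2 \<le> e * exp (- (c / 2) * (dist x z / \<rho>)\<^sup>2)"
              unfolding e1_def e2_def e_def a_def b_def by (simp only: exp_add[symmetric] exp_le_cancel_iff)
          qed (use 1 2 V in auto)
          finally show ?thesis by (simp add: mult_ac)
        qed
        have "Lp_norm M r (trunc (ball x \<rho>) (T (\<rho>\<^sup>2) (trunc (ball x (2 ^ k * \<rho>)) g)))
          \<le> (\<Sum>z\<in>F. Lp_norm M r (trunc (ball x \<rho>) (T (\<rho>\<^sup>2) (trunc (P z) g))))"
          unfolding P(4)[symmetric] using P F t g by (intro Lp_norm_T_disjoint_le[OF r]) auto
        also have "\<dots> \<le> (\<Sum>z\<in>F. ennreal (C1 * C2 * e * V * exp (- (c / 2) * (dist x z / \<rho>)\<^sup>2)) * X)"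
          by (intro sum_mono piece)
        also have "\<dots> = ennreal (\<Sum>z\<in>F. C1 * C2 * e * V * exp (- (c / 2) * (dist x z / \<rho>)\<^sup>2)) * X"
          unfolding sum_distrib_right[symmetric] using 1 2 e V by (subst sum_ennreal) auto
        also have "\<dots> \<le> ennreal (C * e * V) * X"
        proof (intro mult_right_mono ennreal_leI)
          have "(\<Sum>z\<in>F. C1 * C2 * e * V * exp (- (c / 2) * (dist x z / \<rho>)\<^sup>2)) = C1 * C2 * e * V * (\<Sum>z\<in>F. exp (- (c / 2) * (dist x z / \<rho>)\<^sup>2))"
            by (simp only: sum_distrib_left)
          also have "\<dots> \<le> C1 * C2 * e * V * W"
            using 1 2 e V by (intro mult_left_mono W(2) \<rho> F) auto
          finally show "(\<Sum>z\<in>F. C1 * C2 * e * V * exp (- (c / 2) * (dist x z / \<rho>)\<^sup>2)) \<le> C * e * V"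
            by (simp add: C_def mult_ac)
        qed simp
        finally show "Lp_norm M r (trunc (ball x \<rho>) (T (\<rho>\<^sup>2) (trunc (ball x (2 ^ k * \<rho>)) g))) \<le> ennreal (C * e * V) * X" .
      qed auto
      finally show ?thesis .
    qed
    then show "Lp_norm M r (trunc (ball x \<rho>) (T (2 * \<rho>\<^sup>2) (trunc (ball y \<rho>) f0)))
      \<le> ennreal (C * exp (- (c / 4) * (dist x y / \<rho>)\<^sup>2) * vol x \<rho> powr ir * vol y \<rho> powr (- ip)) * Lp_norm M p (trunc (ball y \<rho>) f0)"
      by (simp add: f_def X_def V_def e_def mult.assoc)
  qed
qed

end

section \<open>Interpolation\<close>

text \<open>On H one has |f|^m \<le> h^(m - p) |f|^p. For levels h growing geometrically the part of
  f above h thus decays geometrically in the lower exponent m.\<close>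

lemma Lp_norm_tail_le:
  assumes m: "1 \<le> m" "m < p" and [measurable]: "f \<in> borel_measurable M" "H \<in> sets M" and h: "h > 0"
    and b: "b \<ge> 0" "Lp_norm M (ereal p) f \<le> ennreal b" and H: "\<And>x. x \<in> H \<Longrightarrow> h \<le> norm (f x)"
  shows "Lp_norm M (ereal m) (trunc H f) \<le> ennreal (b powr (p / m) * h powr (- ((p - m) / m)))"
proof -
  have "(\<integral>\<^sup>+x. ennreal (norm (trunc H f x) powr m) \<partial>M) \<le> (\<integral>\<^sup>+x. ennreal (h powr (m - p)) * ennreal (norm (f x) powr p) \<partial>M)"
  proof (rule nn_integral_mono)
    fix x
    show "ennreal (norm (trunc H f x) powr m) \<le> ennreal (h powr (m - p)) * ennreal (norm (f x) powr p)"
    proof (cases "x \<in> H")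
      case True
      have "norm (f x) powr m = norm (f x) powr (m - p) * norm (f x) powr p"
        by (simp only: powr_add[symmetric]) simp
      also have "\<dots> \<le> h powr (m - p) * norm (f x) powr p"
        using H[OF True] h m by (intro mult_right_mono powr_mono2') auto
      finally show ?thesis using True by (simp add: trunc_def ennreal_mult[symmetric] ennreal_leI)
    next
      case False
      then show ?thesis using m by (simp add: trunc_def)
    qed
  qed
  also have "\<dots> = ennreal (h powr (m - p)) * (\<integral>\<^sup>+x. ennreal (norm (f x) powr p) \<partial>M)"
    by (simp add: nn_integral_cmult)
  also have "\<dots> \<le> ennreal (h powr (m - p)) * ennreal (b powr p)"
    using b m by (intro mult_left_mono) (auto simp: Lp_norm_real_le_iff)
  also have "\<dots> = ennreal ((b powr (p / m) * h powr (- ((p - m) / m))) powr m)"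
    using m by (simp add: powr_mult powr_powr ennreal_mult mult.commute)
  finally show ?thesis using m by (subst Lp_norm_real_le_iff) auto
qed

text \<open>Chebyshev's inequality; it bounds the measures of the level sets in the
  interpolation.\<close>

lemma emeasure_superlevel_le:
  assumes p: "1 \<le> p" and [measurable]: "f \<in> borel_measurable M" "H \<in> sets M" and h: "h > 0"
    and b: "b \<ge> 0" "Lp_norm M (ereal p) f \<le> ennreal b" and H: "\<And>x. x \<in> H \<Longrightarrow> h \<le> norm (f x)"
  shows "emeasure M H \<le> ennreal ((b / h) powr p)"
proof -
  have "ennreal (h powr p) * emeasure M H = (\<integral>\<^sup>+x. ennreal (h powr p) * indicator H x \<partial>M)"
    by (simp add: nn_integral_cmult_indicator)
  also have "\<dots> \<le> (\<integral>\<^sup>+x. ennreal (norm (f x) powr p) \<partial>M)"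
    using H h p by (intro nn_integral_mono) (auto simp: indicator_def intro!: ennreal_leI powr_mono2)
  also have "\<dots> \<le> ennreal (b powr p)" using b p by (simp add: Lp_norm_real_le_iff)
  finally have *: "ennreal (h powr p) * emeasure M H \<le> ennreal (b powr p)" .
  have "emeasure M H = ennreal (inverse (h powr p)) * (ennreal (h powr p) * emeasure M H)"
    using h by (simp add: mult.assoc[symmetric] ennreal_mult[symmetric])
  also have "\<dots> \<le> ennreal (inverse (h powr p)) * ennreal (b powr p)" by (intro mult_left_mono *) simp
  also have "\<dots> = ennreal ((b / h) powr p)"
    unfolding powr_divide using b h by (simp add: ennreal_mult[symmetric] divide_inverse mult.commute)
  finally show ?thesis .
qed

context doubling_semigroup
begin

text \<open>Real interpolation without Lorentz spaces: on a ball, split \<open>f\<close> into the dyadic level pieces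
  \<open>f\<^sub>n\<close> where \<open>\<bar>f\<bar>\<close> is comparable to \<open>2\<^sup>n\<close> times its average. The log-convexity of the norms of \<open>T f\<^sub>n\<close>
  gives the critical exponent, and the strict inequality for \<open>1 / p'\<close> makes the sum over \<open>n\<close> geometric.\<close>

lemma gauss_bound_interpolation:
  fixes p q p' q' \<theta> \<sigma> :: real and s :: ereal
  assumes pq: "1 \<le> p" "1 \<le> q" "1 \<le> p'" "1 \<le> q'" and s: "s \<in> {1..\<infinity>}" and \<theta>: "0 < \<theta>" "\<theta> < 1"
    and \<sigma>: "\<sigma> = 1 / real_of_ereal s"
    and q': "1 / q' = (1 - \<theta>) / q + \<theta> * \<sigma>" and p': "1 / p' < (1 - \<theta>) / p + \<theta> * \<sigma>"
    and G: "gauss_bound 1 (ereal p) (ereal q)" and sU: "s \<in> uniformly_bounded_exponents M \<B> T"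
  shows "gauss_bound 1 (ereal p') (ereal q')"
proof -
  have mem: "ereal p \<in> {1..\<infinity>}" "ereal q \<in> {1..\<infinity>}" "ereal p' \<in> {1..\<infinity>}" "ereal q' \<in> {1..\<infinity>}"
    using pq by auto
  have \<sigma>01: "0 \<le> \<sigma>" "\<sigma> \<le> 1" using recip_exponent_bounds[OF s] by (auto simp: \<sigma>)
  from G obtain C c where Cc: "C > 0" "c > 0" and
    est: "\<And>\<rho> x y f. \<rho> > 0 \<Longrightarrow> f \<in> \<B> \<Longrightarrow> Lp_norm M (ereal q) (trunc (ball x \<rho>) (T (\<rho>\<^sup>2) (trunc (ball y \<rho>) f)))
     \<le> ennreal (C * exp (- c * (dist x y / \<rho>)\<^sup>2) * vol x \<rho> powr (1 / q) * vol y \<rho> powr (- (1 / p)))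
        * Lp_norm M (ereal p) (trunc (ball y \<rho>) f)"
    unfolding gauss_bound_def mult_1_left real_of_ereal.simps by metis
  from sU obtain S0 :: real where S0: "\<And>t f. t > 0 \<Longrightarrow> f \<in> \<B> \<inter> Lp M s \<Longrightarrow> Lp_norm M s (T t f) \<le> ennreal S0 * Lp_norm M s f"
    unfolding uniformly_bounded_exponents_def by blast
  define S where "S = max 1 S0"
  have S1: "S \<ge> 1" by (simp add: S_def)
  have S: "Lp_norm M s (T t f) \<le> ennreal S * Lp_norm M s f" if "t > 0" "f \<in> \<B>" "Lp_norm M s f < \<infinity>" for t f
  proof -
    have "f \<in> \<B> \<inter> Lp M s" using that by (auto simp: Lp_def measurable)
    from S0[OF that(1) this] show ?thesis
      by (rule order_trans) (auto intro!: mult_right_mono ennreal_leI simp: S_def)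
  qed
  \<comment> \<open>The reciprocal exponent between the sources p and s; it is the power of the
    support's measure in the bound for one level piece.\<close>
  define \<tau> where "\<tau> = (1 - \<theta>) / p + \<theta> * \<sigma>"
  \<comment> \<open>Ratio between consecutive levels: the height doubles, while the measure bound
    shrinks by 2^(-p') and enters with power \<tau>. The strict hypothesis on 1 / p' says that this
    is below 1.\<close>
  define lam where "lam = 2 powr (1 - p' * \<tau>)"
  have "1 < p' * \<tau>" using p' pq by (simp add: \<tau>_def field_simps)
  then have lam: "0 < lam" "lam < 1" using powr_less_mono[of "1 - p' * \<tau>" 0 2] by (auto simp: lam_def)
  \<comment> \<open>The interpolated bound carries the rate c (1 - \<theta>) = 2 c'; half of it pays
    for exchanging the volumes at y and x.\<close>
  define c' where "c' = c * (1 - \<theta>) / 2"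
  have c': "c' > 0" using Cc \<theta> by (simp add: c'_def)
  have \<theta>\<sigma>: "\<theta> * \<sigma> \<ge> 0" using \<theta> \<sigma>01 by simp
  obtain K where K: "K \<ge> 1" "\<And>x y \<rho>. \<rho> > 0 \<Longrightarrow> vol x \<rho> powr (\<theta> * \<sigma>) \<le> K * exp (c' * (dist x y / \<rho>)\<^sup>2) * vol y \<rho> powr (\<theta> * \<sigma>)"
    using volume_comparison_gauss[OF \<theta>\<sigma> c'] by metis
  define D where "D = C powr (1 - \<theta>) * S powr \<theta> * K * 2 powr (p' * \<tau>)"
  have D: "D > 0" using Cc S1 K by (simp add: D_def)
  define D' where "D' = D / (1 - lam)"
  have D': "D' > 0" using D lam by (simp add: D'_def)
  show ?thesis
    unfolding gauss_bound_def real_of_ereal.simps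
  proof (rule exI[of _ D'], intro conjI exI[of _ c'] D' c' allI impI ballI)
    fix \<rho> :: real and x y :: 'a and f0 assume \<rho>: "\<rho> > 0" and f0: "f0 \<in> \<B>"
    define f where "f = trunc (ball y \<rho>) f0"
    have f: "f \<in> \<B>" using f0 by (simp add: f_def trunc_closed)
    have fm [measurable]: "f \<in> borel_measurable M" using f by (rule measurable)
    define u where "u = dist x y / \<rho>"
    define Vx Vy where "Vx = vol x \<rho>" and "Vy = vol y \<rho>"
    have V: "Vx > 0" "Vy > 0" using \<rho> by (auto simp: Vx_def Vy_def intro: vol_pos)
    define t where "t = \<rho>\<^sup>2"
    have t: "t > 0" using \<rho> by (simp add: t_def)
    define k where "k = D' * exp (- c' * u\<^sup>2) * Vx powr (1 / q') * Vy powr (- (1 / p'))"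
    have k: "k > 0" using D' V by (simp add: k_def)
    have trunc_f: "trunc (ball y \<rho>) (trunc E f) = trunc E f" for E
      by (auto simp: f_def trunc_def indicator_def fun_eq_iff)
    have est': "Lp_norm M (ereal q) (trunc (ball x \<rho>) (T t (trunc E f)))
        \<le> ennreal (C * exp (- c * u\<^sup>2) * Vx powr (1 / q) * Vy powr (- (1 / p))) * Lp_norm M (ereal p) (trunc E f)"
      if "E \<in> sets M" for E
      using est[OF \<rho> trunc_closed[OF f that], of x y] unfolding trunc_f by (simp only: u_def Vx_def Vy_def t_def)
    have "Lp_norm M (ereal q') (trunc (ball x \<rho>) (T t f)) \<le> ennreal k * Lp_norm M (ereal p') f"
    proof (cases "Lp_norm M (ereal p') f" rule: ennreal_cases)
      case top
      then show ?thesis using k by (simp add: ennreal_mult_top)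
    next
      case a0: (real a0)
      \<comment> \<open>A1 is any positive upper bound of the norm, so that the threshold A below is
        positive also for f = 0.\<close>
      have main: "Lp_norm M (ereal q') (trunc (ball x \<rho>) (T t f)) \<le> ennreal (k * A1)" if A1: "A1 > 0" "a0 \<le> A1" for A1
      proof -
        \<comment> \<open>The average of order p' that corresponds to A1 on the source ball.\<close>
        define A where "A = A1 * Vy powr (- (1 / p'))"
        have A: "A > 0" using A1 V by (simp add: A_def)
        have fA1: "Lp_norm M (ereal p') f \<le> ennreal A1" using a0 A1 by (simp add: ennreal_leI)
        have A1_eq: "A1 powr p' = A powr p' * Vy"
        proof -
          have "A powr p' = A1 powr p' * Vy powr (- (1 / p') * p')"
            unfolding A_def by (simp only: powr_mult powr_powr)
          also have "- (1 / p') * p' = - 1" using pq by simp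
          finally show ?thesis using V by (simp add: powr_minus)
        qed
        define Gs where "Gs n = {z \<in> ball y \<rho>. norm (f z) < A * 2 ^ n}" for n :: nat
        have Gs_sets [measurable]: "Gs n \<in> sets M" for n
        proof -
          have "space M = UNIV" using sets_eq_imp_space_eq[OF sets_borel] by simp
          then have "Gs n = ball y \<rho> \<inter> {z \<in> space M. norm (f z) < A * 2 ^ n}" by (auto simp: Gs_def)
          also have "\<dots> \<in> sets M" by measurable
          finally show ?thesis .
        qed
        have Gs_mono: "Gs n \<subseteq> Gs (Suc n)" for n
        proof -
          have "A * 2 ^ n \<le> A * 2 ^ Suc n" using A by (intro mult_left_mono power_increasing) auto
          then show ?thesis by (auto simp: Gs_def)
        qed
        define Es where "Es n = (case n of 0 \<Rightarrow> Gs 0 | Suc k \<Rightarrow> Gs (Suc k) - Gs k)" for n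
        have Es_sets [measurable]: "Es n \<in> sets M" for n by (cases n) (auto simp: Es_def)
        have Es_sub: "Es n \<subseteq> Gs n" for n by (cases n) (auto simp: Es_def)
        \<comment> \<open>Chebyshev: |f| is at least A 2^(n-1) on Es n for n \<ge> 1. Writing 1 - n
          over the reals lets one formula serve n = 0 too, where it is at least the volume of the
          ball.\<close>
        define mn where "mn n = 2 powr (p' * (1 - real n)) * Vy" for n :: nat
        have mn: "mn n > 0" for n using V by (simp add: mn_def)
        have Es_vol: "emeasure M (Es n) \<le> ennreal (mn n)" for n
        proof (cases n)
          case 0
          have "emeasure M (Es n) \<le> emeasure M (ball y \<rho>)"
            using Es_sub[of n] by (intro emeasure_mono) (auto simp: Gs_def)
          also have "\<dots> = ennreal Vy" using \<rho> by (simp add: emeasure_ball Vy_def)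
          also have "\<dots> \<le> ennreal (mn n)"
          proof (rule ennreal_leI)
            have "1 * Vy \<le> 2 powr p' * Vy" using V pq by (intro mult_right_mono ge_one_powr_ge_zero) auto
            then show "Vy \<le> mn n" by (simp add: mn_def 0)
          qed
          finally show ?thesis .
        next
          case (Suc j)
          have "emeasure M (Es n) \<le> ennreal ((A1 / (A * 2 ^ j)) powr p')"
            using A1 A fA1 by (intro emeasure_superlevel_le[OF pq(3) fm Es_sets]) (auto simp: Suc Es_def Gs_def)
          also have "(A1 / (A * 2 ^ j)) powr p' = mn n"
          proof -
            have "(2 ^ j) powr p' = 2 powr (p' * real j)"
              by (simp add: powr_realpow[symmetric] powr_powr mult.commute)
            moreover have "p' * (1 - real n) = - (p' * real j)" by (simp add: Suc)
            moreover have "(A1 / (A * 2 ^ j)) powr p' = (A powr p' * Vy) / (A powr p' * (2 ^ j) powr p')"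
              by (simp only: powr_divide powr_mult A1_eq)
            ultimately show ?thesis using A by (simp add: mn_def powr_minus divide_inverse mult.commute)
          qed
          finally show ?thesis .
        qed
        have Es_bound: "norm (f z) \<le> A * 2 ^ n" if "z \<in> Es n" for n z using that Es_sub[of n] by (auto simp: Gs_def)
        have piece: "Lp_norm M (ereal q') (trunc (ball x \<rho>) (T t (trunc (Es n) f))) \<le> ennreal (D * exp (- c' * u\<^sup>2) * Vx powr (1 / q') * A * lam ^ n)" for n
        proof -
          define g where "g = trunc (ball x \<rho>) (T t (trunc (Es n) f))"
          have En: "trunc (Es n) f \<in> \<B>" using f by (intro trunc_closed) auto
          have Tm: "T t (trunc (Es n) f) \<in> borel_measurable M" using t En by (rule T_measurable)
          then have gm: "g \<in> borel_measurable M" by (simp add: g_def)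
          define h where "h = A * 2 ^ n"
          have h: "h > 0" using A by (simp add: h_def)
          define a where "a = C * exp (- c * u\<^sup>2) * Vx powr (1 / q) * Vy powr (- (1 / p)) * (h * mn n powr (1 / p))"
          define b where "b = S * (h * mn n powr \<sigma>)"
          have ab: "a > 0" "b > 0" using Cc V h mn[of n] S1 by (simp_all add: a_def b_def)
          have fp: "Lp_norm M (ereal p) (trunc (Es n) f) \<le> ennreal (h * mn n powr (1 / p))"
            using Lp_norm_bounded_support[OF mem(1) fm Es_sets, of h n "mn n"] h mn Es_vol Es_bound by (simp add: h_def)
          have fs: "Lp_norm M s (trunc (Es n) f) \<le> ennreal (h * mn n powr \<sigma>)"
            using Lp_norm_bounded_support[OF s fm Es_sets, of h n "mn n"] h mn Es_vol Es_bound by (simp add: h_def \<sigma>)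
          have ga: "Lp_norm M (ereal q) g \<le> ennreal a"
          proof -
            have "Lp_norm M (ereal q) g \<le> ennreal (C * exp (- c * u\<^sup>2) * Vx powr (1 / q) * Vy powr (- (1 / p))) * Lp_norm M (ereal p) (trunc (Es n) f)"
              unfolding g_def by (rule est'[OF Es_sets])
            also have "\<dots> \<le> ennreal (C * exp (- c * u\<^sup>2) * Vx powr (1 / q) * Vy powr (- (1 / p))) * ennreal (h * mn n powr (1 / p))"
              by (intro mult_left_mono fp) simp
            also have "\<dots> = ennreal a" unfolding a_def using Cc h by (intro ennreal_mult[symmetric]) auto
            finally show ?thesis .
          qed
          have gb: "Lp_norm M s g \<le> ennreal b"
          proof -
            have "Lp_norm M s g \<le> Lp_norm M s (T t (trunc (Es n) f))"
              unfolding g_def using Tm by (intro Lp_norm_trunc_le s) auto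
            also have "\<dots> \<le> ennreal S * Lp_norm M s (trunc (Es n) f)"
              using fs by (intro S t En) (auto simp: less_top[symmetric] top_unique)
            also have "\<dots> \<le> ennreal S * ennreal (h * mn n powr \<sigma>)" by (intro mult_left_mono fs) simp
            also have "\<dots> = ennreal b" unfolding b_def using S1 h by (intro ennreal_mult[symmetric]) auto
            finally show ?thesis .
          qed
          have "Lp_norm M (ereal q') g \<le> ennreal (a powr (1 - \<theta>) * b powr \<theta>)"
            using q' by (intro Lp_norm_interpolation[OF pq(2) s pq(4) \<theta> _ gm ab ga gb]) (simp add: \<sigma>)
          also have "a powr (1 - \<theta>) * b powr \<theta> \<le> D * exp (- c' * u\<^sup>2) * Vx powr (1 / q') * A * lam ^ n"
          proof -
            have e1: "mn n powr ((1 / p) * (1 - \<theta>)) * mn n powr (\<sigma> * \<theta>) = mn n powr \<tau>"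
            proof -
              have "(1 / p) * (1 - \<theta>) + \<sigma> * \<theta> = \<tau>" by (simp add: \<tau>_def mult.commute)
              then show ?thesis by (simp only: powr_add[symmetric])
            qed
            have e2: "h powr (1 - \<theta>) * h powr \<theta> = h" using h by (simp add: powr_add[symmetric])
            have e3: "exp (- c * u\<^sup>2) powr (1 - \<theta>) = exp (- c' * u\<^sup>2) * exp (- c' * u\<^sup>2)"
              by (simp add: powr_def c'_def exp_add[symmetric])
            have "a powr (1 - \<theta>) * b powr \<theta> =
              C powr (1 - \<theta>) * exp (- c * u\<^sup>2) powr (1 - \<theta>) * Vx powr ((1 / q) * (1 - \<theta>)) * Vy powr (- (1 / p) * (1 - \<theta>))
                * (h powr (1 - \<theta>) * mn n powr ((1 / p) * (1 - \<theta>))) * (S powr \<theta> * (h powr \<theta> * mn n powr (\<sigma> * \<theta>)))"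
              unfolding a_def b_def by (simp only: powr_mult powr_powr)
            also have "\<dots> = C powr (1 - \<theta>) * S powr \<theta> * exp (- c * u\<^sup>2) powr (1 - \<theta>) * Vx powr ((1 / q) * (1 - \<theta>)) * Vy powr (- (1 / p) * (1 - \<theta>))
                * (h powr (1 - \<theta>) * h powr \<theta>) * (mn n powr ((1 / p) * (1 - \<theta>)) * mn n powr (\<sigma> * \<theta>))"
              by (simp only: mult_ac)
            also have "\<dots> = C powr (1 - \<theta>) * S powr \<theta> * (exp (- c' * u\<^sup>2) * exp (- c' * u\<^sup>2)) * Vx powr ((1 / q) * (1 - \<theta>)) * Vy powr (- (1 / p) * (1 - \<theta>))
                * h * mn n powr \<tau>"
              by (simp only: e1 e2 e3)
            also have "mn n powr \<tau> = 2 powr (p' * \<tau>) * 2 powr (- (p' * \<tau> * real n)) * Vy powr \<tau>"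
            proof -
              have "mn n powr \<tau> = 2 powr (p' * (1 - real n) * \<tau>) * Vy powr \<tau>" by (simp only: mn_def powr_mult powr_powr)
              also have "p' * (1 - real n) * \<tau> = p' * \<tau> + (- (p' * \<tau> * real n))" by (simp add: algebra_simps)
              finally show ?thesis by (simp only: powr_add)
            qed
            also have "C powr (1 - \<theta>) * S powr \<theta> * (exp (- c' * u\<^sup>2) * exp (- c' * u\<^sup>2)) * Vx powr ((1 / q) * (1 - \<theta>)) * Vy powr (- (1 / p) * (1 - \<theta>))
                * h * (2 powr (p' * \<tau>) * 2 powr (- (p' * \<tau> * real n)) * Vy powr \<tau>)
              = C powr (1 - \<theta>) * S powr \<theta> * 2 powr (p' * \<tau>) * (exp (- c' * u\<^sup>2) * exp (- c' * u\<^sup>2)) * Vx powr ((1 / q) * (1 - \<theta>))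
                * (Vy powr (- (1 / p) * (1 - \<theta>)) * Vy powr \<tau>) * (A * (2 ^ n * 2 powr (- (p' * \<tau> * real n))))"
              by (simp add: h_def mult_ac)
            also have "2 ^ n * 2 powr (- (p' * \<tau> * real n)) = lam ^ n"
            proof -
              have "lam ^ n = 2 powr ((1 - p' * \<tau>) * real n)" by (simp add: lam_def powr_power mult.commute)
              also have "(1 - p' * \<tau>) * real n = real n + (- (p' * \<tau> * real n))" by (simp add: algebra_simps)
              finally show ?thesis by (simp only: powr_add) (simp add: powr_realpow)
            qed
            \<comment> \<open>The bound on L^s carries no volumes, so a power \<theta> \<sigma> of
              Vy is left over; replacing Vy by Vx there completes the power 1 / q'.\<close>
            also have "Vy powr (- (1 / p) * (1 - \<theta>)) * Vy powr \<tau> = Vy powr (\<theta> * \<sigma>)"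
              by (simp add: powr_add[symmetric] \<tau>_def)
            also have "C powr (1 - \<theta>) * S powr \<theta> * 2 powr (p' * \<tau>) * (exp (- c' * u\<^sup>2) * exp (- c' * u\<^sup>2)) * Vx powr ((1 / q) * (1 - \<theta>))
                * Vy powr (\<theta> * \<sigma>) * (A * lam ^ n)
              \<le> C powr (1 - \<theta>) * S powr \<theta> * 2 powr (p' * \<tau>) * (exp (- c' * u\<^sup>2) * exp (- c' * u\<^sup>2)) * Vx powr ((1 / q) * (1 - \<theta>))
                * (K * exp (c' * u\<^sup>2) * Vx powr (\<theta> * \<sigma>)) * (A * lam ^ n)"
              using K(2)[OF \<rho>, of y x] A lam
              by (intro mult_right_mono mult_left_mono) (auto simp: u_def Vx_def Vy_def dist_commute)
            also have "\<dots> = D * (exp (- c' * u\<^sup>2) * exp (- c' * u\<^sup>2) * exp (c' * u\<^sup>2)) * (Vx powr ((1 / q) * (1 - \<theta>)) * Vx powr (\<theta> * \<sigma>)) * A * lam ^ n"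
              by (simp add: D_def mult_ac)
            also have "exp (- c' * u\<^sup>2) * exp (- c' * u\<^sup>2) * exp (c' * u\<^sup>2) = exp (- c' * u\<^sup>2)"
              by (simp only: exp_add[symmetric]) simp
            also have "Vx powr ((1 / q) * (1 - \<theta>)) * Vx powr (\<theta> * \<sigma>) = Vx powr (1 / q')"
              by (simp add: powr_add[symmetric] q')
            finally show ?thesis .
          qed
          finally show ?thesis using ennreal_leI order_trans unfolding g_def by blast
        qed
        define Z where "Z = D * exp (- c' * u\<^sup>2) * Vx powr (1 / q') * A"
        have Z: "Z > 0" using D V A by (simp add: Z_def)
        have partial: "Lp_norm M (ereal q') (trunc (ball x \<rho>) (T t (trunc (Gs N) f))) \<le> ennreal (\<Sum>n\<le>N. Z * lam ^ n)" for N
        proof (induction N)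
          case 0
          then show ?case using piece[of 0] by (simp add: Es_def Z_def)
        next
          case (Suc N)
          have "Gs (Suc N) = Gs N \<union> Es (Suc N)" using Gs_mono[of N] by (auto simp: Es_def)
          then have "Lp_norm M (ereal q') (trunc (ball x \<rho>) (T t (trunc (Gs (Suc N)) f)))
            \<le> Lp_norm M (ereal q') (trunc (ball x \<rho>) (T t (trunc (Gs N) f))) + Lp_norm M (ereal q') (trunc (ball x \<rho>) (T t (trunc (Es (Suc N)) f)))"
            using T_trunc_disjoint_Un_le[OF mem(4) t f ball_sets Gs_sets Es_sets, of N "Suc N" x \<rho>] by (auto simp: Es_def)
          also have "\<dots> \<le> ennreal (\<Sum>n\<le>N. Z * lam ^ n) + ennreal (Z * lam ^ Suc N)"
            using Suc piece[of "Suc N"] unfolding Z_def by (intro add_mono)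
          also have "\<dots> = ennreal (\<Sum>n\<le>Suc N. Z * lam ^ n)"
            using Z lam by (simp add: ennreal_plus[symmetric] sum_nonneg del: ennreal_plus)
          finally show ?case .
        qed
        have Zk: "Z / (1 - lam) = k * A1" by (simp add: Z_def k_def D'_def A_def)
        have partial': "Lp_norm M (ereal q') (trunc (ball x \<rho>) (T t (trunc (Gs N) f))) \<le> ennreal (k * A1)" for N
        proof -
          have "(\<Sum>n\<le>N. Z * lam ^ n) = Z * (\<Sum>n\<le>N. lam ^ n)" by (simp add: sum_distrib_left)
          also have "\<dots> \<le> Z * (\<Sum>n. lam ^ n)" using lam Z by (intro mult_left_mono sum_le_suminf summable_geometric) auto
          also have "\<dots> = k * A1" unfolding Zk[symmetric] using lam by (simp add: suminf_geometric)
          finally show ?thesis using partial[of N] ennreal_leI order_trans by blast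
        qed
        \<comment> \<open>The tails must be controlled because \<open>T t\<close> is not known to
          commute with the infinite sum of level pieces.\<close>
        define Hs where "Hs n = ball y \<rho> - Gs n" for n
        have Hs_sets [measurable]: "Hs n \<in> sets M" for n by (simp add: Hs_def)
        have tail: "Lp_norm M (ereal m) (trunc (Hs n) f) \<le> ennreal (A1 powr (p' / m) * A powr (- ((p' - m) / m)) * (2 powr (- ((p' - m) / m))) ^ n)"
          if m: "1 \<le> m" "m < p'" for m n
        proof -
          have "Lp_norm M (ereal m) (trunc (Hs n) f) \<le> ennreal (A1 powr (p' / m) * (A * 2 ^ n) powr (- ((p' - m) / m)))"
            using A A1 fA1 by (intro Lp_norm_tail_le[OF m fm Hs_sets]) (auto simp: Hs_def Gs_def)
          also have "(A * 2 ^ n) powr (- ((p' - m) / m)) = A powr (- ((p' - m) / m)) * (2 powr (- ((p' - m) / m))) ^ n"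
            by (simp add: powr_mult powr_power powr_realpow[symmetric] powr_powr mult.commute)
          finally show ?thesis by (simp add: mult.assoc)
        qed
        have geom: "0 \<le> (2::real) powr (- ((p' - m) / m))" "(2::real) powr (- ((p' - m) / m)) < 1" if "1 \<le> m" "m < p'" for m
          using that powr_less_mono[of "- ((p' - m) / m)" 0 2] by auto
        have tail_lim: "AE z in M. (\<lambda>n. trunc (ball x \<rho>) (T t (trunc (Hs n) f)) z) \<longlonglongrightarrow> 0"
        proof -
          have Tm: "trunc (ball x \<rho>) (T t (trunc (Hs n) f)) \<in> borel_measurable M" for n
            using t f by (intro trunc_measurable T_measurable trunc_closed) auto
          \<comment> \<open>A number below a convex combination of 1 / p and \<sigma> is below one
            of them. The corresponding exponent, p or s, is smaller than p' and controls both the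
            tails and \<open>T t\<close> on them.\<close>
          have "1 / p' < 1 / p \<or> 1 / p' < \<sigma>"
          proof (rule ccontr)
            assume "\<not> ?thesis"
            then have "(1 - \<theta>) * (1 / p) + \<theta> * \<sigma> \<le> (1 - \<theta>) * (1 / p') + \<theta> * (1 / p')"
              using \<theta> by (intro add_mono mult_left_mono) auto
            moreover have "(1 - \<theta>) * (1 / p') + \<theta> * (1 / p') = 1 / p'"
              by (simp only: distrib_right[symmetric]) simp
            ultimately have "(1 - \<theta>) / p + \<theta> * \<sigma> \<le> 1 / p'" by simp
            then show False using p' by linarith
          qed
          then show ?thesis
          proof
            assume "1 / p' < 1 / p"
            then have m: "1 \<le> p" "p < p'" using pq by (auto simp: field_simps)
            define B where "B = C * exp (- c * u\<^sup>2) * Vx powr (1 / q) * Vy powr (- (1 / p))"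
            have B: "B \<ge> 0" using Cc by (simp add: B_def)
            define B' where "B' = A1 powr (p' / p) * A powr (- ((p' - p) / p))"
            have "Lp_norm M (ereal q) (trunc (ball x \<rho>) (T t (trunc (Hs n) f))) \<le> ennreal (B * B' * (2 powr (- ((p' - p) / p))) ^ n)" for n
            proof -
              have "Lp_norm M (ereal q) (trunc (ball x \<rho>) (T t (trunc (Hs n) f))) \<le> ennreal B * Lp_norm M (ereal p) (trunc (Hs n) f)"
                unfolding B_def by (rule est'[OF Hs_sets])
              also have "\<dots> \<le> ennreal B * ennreal (B' * (2 powr (- ((p' - p) / p))) ^ n)"
                unfolding B'_def by (intro mult_left_mono tail m) simp
              finally show ?thesis using B by (simp add: ennreal_mult'[symmetric] mult.assoc)
            qed
            then show ?thesis
              using B by (intro AE_tendsto_0_if_Lp_norm_geometric[OF mem(2) Tm geom[OF m], of "B * B'"]) (auto simp: B'_def)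
          next
            assume *: "1 / p' < \<sigma>"
            then have "s \<noteq> \<infinity>" using pq by (auto simp: \<sigma>)
            then obtain r where r: "s = ereal r" "1 \<le> r"
              using s by (cases s) (auto simp: one_ereal_def)
            have m: "1 \<le> r" "r < p'" using * r pq by (auto simp: \<sigma> field_simps)
            define B' where "B' = A1 powr (p' / r) * A powr (- ((p' - r) / r))"
            have "Lp_norm M s (trunc (ball x \<rho>) (T t (trunc (Hs n) f))) \<le> ennreal (S * B' * (2 powr (- ((p' - r) / r))) ^ n)" for n
            proof -
              have Hn: "trunc (Hs n) f \<in> \<B>" using f by (intro trunc_closed) auto
              have tl: "Lp_norm M s (trunc (Hs n) f) \<le> ennreal (B' * (2 powr (- ((p' - r) / r))) ^ n)"
                unfolding r(1) B'_def by (rule tail[OF m])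
              have "Lp_norm M s (trunc (ball x \<rho>) (T t (trunc (Hs n) f))) \<le> Lp_norm M s (T t (trunc (Hs n) f))"
                using t Hn by (intro Lp_norm_trunc_le s T_measurable) auto
              also have "\<dots> \<le> ennreal S * Lp_norm M s (trunc (Hs n) f)"
                using tl by (intro S t Hn) (auto simp: less_top[symmetric] top_unique)
              also have "\<dots> \<le> ennreal S * ennreal (B' * (2 powr (- ((p' - r) / r))) ^ n)"
                by (intro mult_left_mono tl) simp
              finally show ?thesis using S1 by (simp add: ennreal_mult'[symmetric] mult.assoc)
            qed
            then show ?thesis
              using S1 by (intro AE_tendsto_0_if_Lp_norm_geometric[OF s Tm geom[OF m], of "S * B'"]) (auto simp: B'_def)
          qed
        qed
        have split: "AE z in M. \<forall>n. T t f z = T t (trunc (Gs n) f) z + T t (trunc (Hs n) f) z"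
        proof (subst AE_all_countable, rule allI)
          fix n
          have "f = (\<lambda>z. trunc (Gs n) f z + trunc (Hs n) f z)"
            by (auto simp: f_def trunc_def Hs_def Gs_def indicator_def fun_eq_iff)
          then have "T t f = T t (\<lambda>z. trunc (Gs n) f z + trunc (Hs n) f z)" by (rule arg_cong)
          then show "AE z in M. T t f z = T t (trunc (Gs n) f) z + T t (trunc (Hs n) f) z"
            using T_add_AE[OF t trunc_closed[OF f Gs_sets] trunc_closed[OF f Hs_sets], of n n] by simp
        qed
        show ?thesis
        proof (rule Lp_norm_le_of_AE_limit[OF mem(4) _ _ _ partial'])
          show "AE z in M. (\<lambda>n. trunc (ball x \<rho>) (T t (trunc (Gs n) f)) z) \<longlonglongrightarrow> trunc (ball x \<rho>) (T t f) z"
            using split tail_lim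
          proof eventually_elim
            fix z assume *: "\<forall>n. T t f z = T t (trunc (Gs n) f) z + T t (trunc (Hs n) f) z"
              and lim: "(\<lambda>n. trunc (ball x \<rho>) (T t (trunc (Hs n) f)) z) \<longlonglongrightarrow> 0"
            have "trunc (ball x \<rho>) (T t (trunc (Gs n) f)) z = trunc (ball x \<rho>) (T t f) z - trunc (ball x \<rho>) (T t (trunc (Hs n) f)) z" for n
              using spec[OF *, of n] by (simp add: trunc_def right_diff_distrib[symmetric])
            moreover have "(\<lambda>n. trunc (ball x \<rho>) (T t f) z - trunc (ball x \<rho>) (T t (trunc (Hs n) f)) z) \<longlonglongrightarrow> trunc (ball x \<rho>) (T t f) z - 0"
              by (intro tendsto_diff tendsto_const lim)
            ultimately show "(\<lambda>n. trunc (ball x \<rho>) (T t (trunc (Gs n) f)) z) \<longlonglongrightarrow> trunc (ball x \<rho>) (T t f) z" by simp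
          qed
        qed (use t f in \<open>auto intro!: trunc_measurable T_measurable trunc_closed\<close>)
      qed
      have "Lp_norm M (ereal q') (trunc (ball x \<rho>) (T t f)) \<le> ennreal (k * a0)"
      proof (rule le_if_le_real_upper_bounds)
        fix b assume b: "b > 0" "ennreal (k * a0) < ennreal b"
        then have "k * a0 < b" using k a0 by (simp add: ennreal_less_iff)
        then have "a0 \<le> b / k" using k by (simp add: field_simps)
        then show "Lp_norm M (ereal q') (trunc (ball x \<rho>) (T t f)) \<le> ennreal b"
          using main[of "b / k"] b k by simp
      qed
      then show ?thesis using a0 k by (simp add: ennreal_mult)
    qed
    then show "Lp_norm M (ereal q') (trunc (ball x \<rho>) (T (1 * \<rho>\<^sup>2) (trunc (ball y \<rho>) f0)))
       \<le> ennreal (D' * exp (- c' * (dist x y / \<rho>)\<^sup>2) * vol x \<rho> powr (1 / q') * vol y \<rho> powr (- (1 / p')))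
         * Lp_norm M (ereal p') (trunc (ball y \<rho>) f0)"
      by (simp only: f_def k_def u_def Vx_def Vy_def t_def mult_1_left)
  qed
qed

end

section \<open>The set of exponents\<close>

text \<open>Supplies the real exponents at which chains of estimates are joined when an endpoint may
  be \<infinity>.\<close>

lemma ereal_real_between_1:
  fixes a b :: ereal assumes "1 \<le> a" "a < b"
  obtains u :: real where "1 \<le> u" "a < ereal u" "ereal u < b"
proof -
  obtain u :: real where u: "a < ereal u" "ereal u < b" using assms(2) ereal_dense2 by blast
  then have "1 < ereal u" using assms(1) by (meson le_less_trans)
  then show ?thesis using that[of u] u by (simp add: one_ereal_def)
qed

context doubling_semigroup
begin

section \<open>Operations on pairs of exponents\<close>

abbreviation "off \<equiv> off_diagonal M \<B> T"
abbreviation "U \<equiv> uniformly_bounded_exponents M \<B> T"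

lemma off_iff_gauss_bound:
  "p \<in> {1..\<infinity>} \<Longrightarrow> q \<in> {1..\<infinity>} \<Longrightarrow> off p q \<longleftrightarrow> gauss_bound 1 p q"
  using gauss_bound_imp_off_diagonal[of 1 p q] off_diagonal_imp_gauss_bound[of p q] by auto

lemma off_restrict:
  assumes "off p q" "1 \<le> p" "1 \<le> q" "p \<le> p1" "1 \<le> q1" "q1 \<le> q"
  shows "off p1 q1"
proof -
  have "p \<in> {1..\<infinity>}" "q \<in> {1..\<infinity>}" "p1 \<in> {1..\<infinity>}" "q1 \<in> {1..\<infinity>}"
    using assms by auto
  then show ?thesis using assms gauss_bound_Jensen[of p p1 q q1 1] by (simp add: off_iff_gauss_bound)
qed

lemma off_imp_uniformly_bounded:
  assumes "off p q" "1 \<le> p" "p \<le> q"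
  shows "p \<in> U" "q \<in> U"
proof -
  have m: "p \<in> {1..\<infinity>}" "q \<in> {1..\<infinity>}" using assms by auto
  have "off p p" "off q q" using assms off_restrict[of p q p p] off_restrict[of p q q q] by auto
  then show "p \<in> U" "q \<in> U"
    using m gauss_bound_imp_uniformly_bounded by (auto simp: off_iff_gauss_bound)
qed

text \<open>Composition arrives at time 2 \<rho>^2; \<open>gauss_bound_imp_off_diagonal\<close> with
  a = 2 rescales this to all times.\<close>

lemma off_trans:
  assumes "off p q" "off q r" "1 \<le> p" "p \<le> q" "q \<le> r"
  shows "off p r"
proof -
  have m: "p \<in> {1..\<infinity>}" "q \<in> {1..\<infinity>}" "r \<in> {1..\<infinity>}" using assms by auto
  have "gauss_bound 2 p r"
    using m assms by (intro gauss_bound_compose[of p q r] off_imp_uniformly_bounded[of p q])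
      (auto simp: off_iff_gauss_bound)
  then show ?thesis using m gauss_bound_imp_off_diagonal[of 2 p r] by auto
qed

lemma off_interpolation:
  fixes p q p' q' \<theta> \<sigma> :: real
  assumes "off (ereal p) (ereal q)" "s \<in> U"
    and "1 \<le> p" "1 \<le> q" "1 \<le> p'" "1 \<le> q'" "0 < \<theta>" "\<theta> < 1" "\<sigma> = 1 / real_of_ereal s"
    and "1 / q' = (1 - \<theta>) / q + \<theta> * \<sigma>" "1 / p' < (1 - \<theta>) / p + \<theta> * \<sigma>"
  shows "off (ereal p') (ereal q')"
proof -
  have "s \<in> {1..\<infinity>}" using assms(2) by (simp add: uniformly_bounded_exponents_def)
  moreover have "ereal p \<in> {1..\<infinity>}" "ereal q \<in> {1..\<infinity>}" "ereal p' \<in> {1..\<infinity>}" "ereal q' \<in> {1..\<infinity>}"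
    using assms by auto
  ultimately show ?thesis
    using assms gauss_bound_interpolation[of p q p' q' s \<theta> \<sigma>] by (simp add: off_iff_gauss_bound)
qed

text \<open>Interpolating \<open>(p\<^sub>0, v)\<close> with \<open>(s, s)\<close> moves \<open>1 / v\<close> towards \<open>1 / s\<close> by a factor \<open>\<kappa>\<close> that does
  not depend on \<open>v\<close>, and composition restores the left endpoint; hence every exponent below \<open>s\<close> is reached.\<close>

lemma off_extend_right:
  assumes off: "off (ereal p0) q0" and p0: "1 \<le> p0" "ereal p0 < q0" and s: "s \<in> U" "q0 < s"
    and u: "q0 \<le> ereal u" "ereal u < s"
  shows "off (ereal p0) (ereal u)"
proof -
  obtain q1 where q1: "q0 = ereal q1" using p0 s by (cases q0) auto
  have pq: "p0 < q1" "1 \<le> q1" using p0 q1 by auto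
  define \<sigma> where "\<sigma> = 1 / real_of_ereal s"
  define a b where "a = 1 / p0" and "b = 1 / q1"
  have \<sigma>: "0 \<le> \<sigma>" "\<sigma> < b" "\<sigma> < 1 / u"
  proof -
    have "\<sigma> < 1 / w" if "q1 \<le> w" "ereal w < s" for w
    proof (cases s)
      case (real r)
      then have "w < r" "0 < w" using that pq by auto
      then show ?thesis by (simp add: \<sigma>_def real frac_less2)
    next
      case PInf
      then show ?thesis using that pq by (simp add: \<sigma>_def)
    next
      case MInf
      then show ?thesis using that by simp
    qed
    then show "\<sigma> < b" "\<sigma> < 1 / u" using s u q1 by (auto simp: b_def)
    show "0 \<le> \<sigma>" using s recip_exponent_bounds[of s] by (auto simp: \<sigma>_def uniformly_bounded_exponents_def)
  qed
  have ab: "b < a" "a \<le> 1" using p0 pq by (simp_all add: a_def b_def frac_less2)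
  \<comment> \<open>Below, (p0, v n) is interpolated with (s, s) at \<theta> = 1 - \<kappa>. The new
    source may be v n as soon as 1 / v n < \<kappa> a + (1 - \<kappa>) \<sigma>; since 1 / v n \<le>
    b, any \<kappa> strictly between \<kappa>0 and 1 works for every n.\<close>
  define \<kappa>0 where "\<kappa>0 = (b - \<sigma>) / (a - \<sigma>)"
  define \<kappa> where "\<kappa> = (\<kappa>0 + 1) / 2"
  have "\<kappa>0 < 1" "0 < \<kappa>0" using ab \<sigma> by (simp_all add: \<kappa>0_def)
  then have \<kappa>: "0 < \<kappa>" "\<kappa> < 1" "\<kappa>0 < \<kappa>" by (auto simp: \<kappa>_def)
  then have \<kappa>a: "b - \<sigma> < \<kappa> * (a - \<sigma>)" using ab \<sigma> by (simp add: \<kappa>0_def pos_divide_less_eq)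
  \<comment> \<open>1 / v n starts at b, and its distance to \<sigma> shrinks by the factor \<kappa>
    in each step.\<close>
  define v where "v n = 1 / (\<sigma> + \<kappa> ^ n * (b - \<sigma>))" for n :: nat
  have den: "\<sigma> + \<kappa> ^ n * (b - \<sigma>) > 0" "\<sigma> + \<kappa> ^ n * (b - \<sigma>) \<le> b" for n
  proof -
    show "\<sigma> + \<kappa> ^ n * (b - \<sigma>) > 0" using \<sigma> \<kappa> by (intro add_nonneg_pos) auto
    have "\<kappa> ^ n * (b - \<sigma>) \<le> 1 * (b - \<sigma>)" using \<sigma> \<kappa> by (intro mult_right_mono power_le_one) auto
    then show "\<sigma> + \<kappa> ^ n * (b - \<sigma>) \<le> b" by simp
  qed
  have iv: "1 / v n = \<sigma> + \<kappa> ^ n * (b - \<sigma>)" for n by (simp add: v_def)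
  have v1: "1 \<le> v n" for n using den[of n] ab by (simp add: v_def)
  have vq: "q1 \<le> v n" for n
  proof -
    have "1 / b \<le> v n" unfolding v_def using den[of n] by (intro divide_left_mono mult_pos_pos) auto
    then show ?thesis using pq by (simp add: b_def)
  qed
  have "off (ereal p0) (ereal (v n))" for n
  proof (induction n)
    case 0
    have "v 0 = q1" by (simp add: v_def b_def)
    then show ?case using off q1 by simp
  next
    case (Suc n)
    have dec: "1 / v (Suc n) = \<kappa> * (1 / v n) + (1 - \<kappa>) * \<sigma>" unfolding iv by (simp add: algebra_simps)
    have "off (ereal (v n)) (ereal (v (Suc n)))"
    proof (rule off_interpolation[OF Suc s(1) p0(1) v1 v1 v1 _ _ \<sigma>_def, where \<theta>="1 - \<kappa>"])
      show "0 < 1 - \<kappa>" "1 - \<kappa> < 1" using \<kappa> by simp_all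
      show "1 / v (Suc n) = (1 - (1 - \<kappa>)) / v n + (1 - \<kappa>) * \<sigma>" unfolding dec by simp
      have "1 / v n \<le> b" unfolding iv by (rule den)
      also have "b < \<sigma> + \<kappa> * (a - \<sigma>)" using \<kappa>a by simp
      also have "\<dots> = (1 - (1 - \<kappa>)) / p0 + (1 - \<kappa>) * \<sigma>" by (simp add: a_def algebra_simps)
      finally show "1 / v n < (1 - (1 - \<kappa>)) / p0 + (1 - \<kappa>) * \<sigma>" .
    qed
    moreover have "v n \<le> v (Suc n)"
    proof -
      have "\<kappa> ^ Suc n * (b - \<sigma>) \<le> \<kappa> ^ n * (b - \<sigma>)" using \<kappa> \<sigma> by (intro mult_right_mono power_decreasing) auto
      then show ?thesis unfolding v_def using den[of n] den[of "Suc n"] by (intro divide_left_mono mult_pos_pos) (simp_all del: power_Suc)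
    qed
    moreover have "p0 \<le> v n" using vq[of n] pq by simp
    ultimately show ?case using Suc p0 by - (rule off_trans[of "ereal p0" "ereal (v n)"], auto)
  qed
  then have off_v: "off (ereal p0) (ereal (v n))" for n .
  have "0 < (1 / u - \<sigma>) / (b - \<sigma>)" using \<sigma> by (intro divide_pos_pos) simp_all
  then obtain n where n: "\<kappa> ^ n < (1 / u - \<sigma>) / (b - \<sigma>)"
    using real_arch_pow_inv \<kappa>(2) by blast
  have u1: "1 \<le> u" using u q1 pq by simp
  have "\<kappa> ^ n * (b - \<sigma>) < 1 / u - \<sigma>" using n \<sigma> by (simp only: pos_less_divide_eq diff_gt_0_iff_gt)
  then have "1 / v n \<le> 1 / u" unfolding iv by linarith
  then have "u \<le> v n" using u1 v1[of n] by (simp add: field_simps)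
  then show ?thesis
    using off_restrict[OF off_v[of n], of "ereal p0" "ereal u"] p0(1) v1[of n] u1 by simp
qed

text \<open>The mirror image of \<open>off_extend_right\<close>: the sources v n descend towards s.
  The interpolated estimate starts at v (n + 1) and ends at some q' beyond v n, so it can be cut
  down to (v (n + 1), v n) and composed with (v n, q0).\<close>

lemma off_extend_left_finite:
  assumes off: "off (ereal p0) (ereal q0)" and p0: "1 \<le> p0" "p0 < q0" and s: "s \<in> U" "s < ereal p0"
    and u: "s < ereal u" "u \<le> p0"
  shows "off (ereal u) (ereal q0)"
proof -
  have s1: "1 \<le> s" using s by (simp add: uniformly_bounded_exponents_def)
  then obtain r where r: "s = ereal r" "1 \<le> r" using s by (cases s) auto
  define \<sigma> where "\<sigma> = 1 / r"
  define a b where "a = 1 / p0" and "b = 1 / q0"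
  have ab: "0 < b" "b < a" "a < \<sigma>" "\<sigma> \<le> 1" "1 / u < \<sigma>"
    using s r u p0 by (simp_all add: a_def b_def \<sigma>_def frac_less2)
  \<comment> \<open>\<kappa> > \<kappa>0 means 1 / q' < a: the interpolated target q' stays beyond
    p0 and hence beyond every v n.\<close>
  define \<kappa>0 where "\<kappa>0 = (\<sigma> - a) / (\<sigma> - b)"
  define \<kappa> where "\<kappa> = (\<kappa>0 + 1) / 2"
  have "\<kappa>0 < 1" "0 < \<kappa>0" using ab by (simp_all add: \<kappa>0_def)
  then have \<kappa>: "0 < \<kappa>" "\<kappa> < 1" "\<kappa>0 < \<kappa>" by (auto simp: \<kappa>_def)
  then have \<kappa>b: "\<sigma> - a < \<kappa> * (\<sigma> - b)" using ab by (simp add: \<kappa>0_def pos_divide_less_eq)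
  \<comment> \<open>The strict inequality on the source exponent in \<open>off_interpolation\<close>
    forces the sources to contract by a factor strictly larger than \<kappa>.\<close>
  define \<mu> where "\<mu> = (1 + \<kappa>) / 2"
  have \<mu>: "0 < \<mu>" "\<mu> < 1" "\<kappa> < \<mu>" using \<kappa> by (auto simp: \<mu>_def)
  define v where "v n = 1 / (\<sigma> - \<mu> ^ n * (\<sigma> - a))" for n :: nat
  have den: "\<sigma> - \<mu> ^ n * (\<sigma> - a) \<ge> a" "\<sigma> - \<mu> ^ n * (\<sigma> - a) \<le> \<sigma>" for n
  proof -
    have "\<mu> ^ n * (\<sigma> - a) \<le> 1 * (\<sigma> - a)" using ab \<mu> by (intro mult_right_mono power_le_one) auto
    then show "\<sigma> - \<mu> ^ n * (\<sigma> - a) \<ge> a" by simp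
    show "\<sigma> - \<mu> ^ n * (\<sigma> - a) \<le> \<sigma>" using ab \<mu> by simp
  qed
  have den0: "\<sigma> - \<mu> ^ n * (\<sigma> - a) > 0" for n using den(1)[of n] ab by linarith
  have iv: "1 / v n = \<sigma> - \<mu> ^ n * (\<sigma> - a)" for n by (simp add: v_def)
  have v1: "1 \<le> v n" for n using den[of n] den0[of n] ab by (simp add: v_def)
  have vp: "v n \<le> p0" for n
  proof -
    have "v n \<le> 1 / a" unfolding v_def using den[of n] den0[of n] ab by (intro divide_left_mono mult_pos_pos) auto
    then show ?thesis by (simp add: a_def)
  qed
  define q' where "q' = 1 / (\<kappa> * b + (1 - \<kappa>) * \<sigma>)"
  have iq': "1 / q' = \<kappa> * b + (1 - \<kappa>) * \<sigma>" by (simp add: q'_def)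
  have q'd: "\<kappa> * b + (1 - \<kappa>) * \<sigma> < a" "0 < \<kappa> * b + (1 - \<kappa>) * \<sigma>"
  proof -
    show "\<kappa> * b + (1 - \<kappa>) * \<sigma> < a" using \<kappa>b by (simp add: algebra_simps)
    show "0 < \<kappa> * b + (1 - \<kappa>) * \<sigma>" using \<kappa> ab by (intro add_pos_pos mult_pos_pos) simp_all
  qed
  have q'p: "p0 \<le> q'"
  proof -
    have "1 / a \<le> q'" unfolding q'_def using q'd ab by (intro divide_left_mono mult_pos_pos) auto
    then show ?thesis by (simp add: a_def)
  qed
  have "off (ereal (v n)) (ereal q0)" for n
  proof (induction n)
    case 0
    have "v 0 = p0" by (simp add: v_def a_def)
    then show ?case using off by simp
  next
    case (Suc n)
    have e: "\<mu> ^ n * (\<sigma> - a) > 0" using ab \<mu> by simp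
    have "off (ereal (v (Suc n))) (ereal q')"
    proof (rule off_interpolation[OF Suc s(1) v1 _ v1, where \<theta>="1 - \<kappa>" and \<sigma>=\<sigma>])
      show "0 < 1 - \<kappa>" "1 - \<kappa> < 1" using \<kappa> by simp_all
      show "1 \<le> q0" "1 \<le> q'" using q'p p0 by simp_all
      show "\<sigma> = 1 / real_of_ereal s" using r by (simp add: \<sigma>_def)
      have "\<kappa> * (\<mu> ^ n * (\<sigma> - a)) < \<mu> * (\<mu> ^ n * (\<sigma> - a))" using \<mu> e by (intro mult_strict_right_mono)
      then have "1 / v (Suc n) < \<kappa> * (1 / v n) + (1 - \<kappa>) * \<sigma>" unfolding iv by (simp add: algebra_simps)
      then show "1 / v (Suc n) < (1 - (1 - \<kappa>)) / v n + (1 - \<kappa>) * \<sigma>" by simp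
      show "1 / q' = (1 - (1 - \<kappa>)) / q0 + (1 - \<kappa>) * \<sigma>" unfolding iq' by (simp add: b_def)
    qed
    then have "off (ereal (v (Suc n))) (ereal (v n))"
      using v1[of "Suc n"] v1[of n] vp[of n] q'p p0 by - (rule off_restrict[of "ereal (v (Suc n))" "ereal q'"], auto)
    moreover have "v (Suc n) \<le> v n"
    proof -
      have "\<mu> ^ Suc n * (\<sigma> - a) \<le> \<mu> ^ n * (\<sigma> - a)" using \<mu> ab by (intro mult_right_mono power_decreasing) auto
      then show ?thesis unfolding v_def using den0[of n] den0[of "Suc n"] by (intro divide_left_mono mult_pos_pos) (simp_all del: power_Suc)
    qed
    ultimately show ?case
      using Suc v1 vp[of n] p0 by - (rule off_trans[of "ereal (v (Suc n))" "ereal (v n)"], auto)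
  qed
  then have off_v: "off (ereal (v n)) (ereal q0)" for n .
  have "0 < (\<sigma> - 1 / u) / (\<sigma> - a)" using ab by (intro divide_pos_pos) simp_all
  then obtain n where n: "\<mu> ^ n < (\<sigma> - 1 / u) / (\<sigma> - a)"
    using real_arch_pow_inv \<mu>(2) by blast
  have u0: "u > 0" using u r by simp
  have "\<mu> ^ n * (\<sigma> - a) < \<sigma> - 1 / u" using n ab by (simp only: pos_less_divide_eq diff_gt_0_iff_gt)
  then have "1 / u \<le> 1 / v n" unfolding iv by linarith
  then have "v n \<le> u" using u0 v1[of n] by (simp add: field_simps)
  then show ?thesis
    using off_restrict[OF off_v[of n], of "ereal u" "ereal q0"] p0 v1[of n] by simp
qed

text \<open>The target is first lowered to a real q1, since q0 may be \<infinity>, and restored by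
  composing with (q1, q0).\<close>

lemma off_extend_left:
  assumes off: "off p0 q0" and p0: "1 \<le> p0" "p0 < q0" and s: "s \<in> U" "s < p0"
    and u: "s < ereal u" "ereal u \<le> p0"
  shows "off (ereal u) q0"
proof -
  obtain p1 where p1: "p0 = ereal p1" using p0 by (cases p0) auto
  obtain q1 where q1: "1 \<le> q1" "p0 < ereal q1" "ereal q1 < q0" using ereal_real_between_1[OF p0] .
  have q0: "1 \<le> q0" using p0 by auto
  have "off (ereal p1) (ereal q1)" using off p0 q0 q1 p1 by - (rule off_restrict[of p0 q0 "ereal p1" "ereal q1"], auto)
  then have "off (ereal u) (ereal q1)" using p0 p1 q1 s u by - (rule off_extend_left_finite[of p1 q1 s u], auto)
  moreover have "off (ereal q1) q0" using off p0 q0 q1 by - (rule off_restrict[of p0 q0 "ereal q1" q0], auto)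
  moreover have "1 \<le> ereal u"
  proof -
    have "1 \<le> s" using s by (simp add: uniformly_bounded_exponents_def)
    then show ?thesis using u by (meson less_imp_le order_trans)
  qed
  moreover have "ereal u \<le> ereal q1" using u q1 by (meson less_imp_le order_trans)
  ultimately show ?thesis using u q1 by - (rule off_trans[of "ereal u" "ereal q1" q0], auto)
qed

text \<open>The least candidate: \<open>is_off_diagonal_set\<close> forces both exponents of every
  pair with an estimate into the set.\<close>

definition J :: "ereal set" where
  "J = {p \<in> {1..\<infinity>}. (\<exists>q. p < q \<and> off p q) \<or> (\<exists>q\<ge>1. q < p \<and> off q p)}"

text \<open>For p < p0, a witness (p, q) either overlaps the base pair, and then the two are
  composed, or leaves a gap. In the latter case p is in \<open>U\<close>, so the base pair extends
  across the gap to a real u inside the witness, where the two are joined. A witness (q, p) puts q <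
  p into \<open>U\<close>, so the base pair extends to p itself.\<close>

lemma J_left:
  assumes base: "1 \<le> p0" "p0 < q0" "off p0 q0" and p: "p \<in> J" "p < q0"
  shows "off p q0"
proof (cases "p0 \<le> p")
  case True
  then show ?thesis using base by - (rule off_restrict[of p0 q0 p q0], auto)
next
  case False
  have p1: "1 \<le> p" using p by (simp add: J_def)
  from p consider (right) q where "p < q" "off p q" | (left) q where "1 \<le> q" "q < p" "off q p"
    by (auto simp: J_def)
  then show ?thesis
  proof cases
    case right
    show ?thesis
    proof (cases "p0 \<le> q")
      case True
      define m where "m = min q q0"
      have m: "p0 \<le> m" "m \<le> q" "m \<le> q0" "p \<le> m" using True base False p1 by (auto simp: m_def)
      have "off p m" using right p1 m by - (rule off_restrict[of p q p m], auto)
      moreover have "off m q0" using base m by - (rule off_restrict[of p0 q0 m q0], auto)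
      ultimately show ?thesis using p1 m by - (rule off_trans[of p m q0], auto)
    next
      case q: False
      obtain u where u: "1 \<le> u" "p < ereal u" "ereal u < q" using ereal_real_between_1[OF p1 right(1)] .
      have "p \<in> U" using off_imp_uniformly_bounded[OF right(2) p1] right by auto
      then have "off (ereal u) q0" using base u q False by - (rule off_extend_left[of p0 q0 p u], auto)
      moreover have "off p (ereal u)" using right p1 u by - (rule off_restrict[of p q p "ereal u"], auto)
      moreover have "ereal u \<le> q0" using u q base by auto
      ultimately show ?thesis using p1 u by - (rule off_trans[of p "ereal u" q0], auto)
    qed
  next
    case left
    have "q \<in> U" using off_imp_uniformly_bounded[OF left(3,1)] left by auto
    moreover obtain u where "p = ereal u" using False p1 by (cases p) auto
    ultimately show ?thesis using base left False by - (rule off_extend_left[of p0 q0 q u, folded \<open>p = ereal u\<close>], auto)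
  qed
qed

text \<open>Mirror image of \<open>J_left\<close>, with \<open>off_extend_right\<close> bridging the
  gap.\<close>

lemma J_right:
  assumes base: "1 \<le> p0" "p0 < q0" "off p0 q0" and p: "p \<in> J" "p0 < p"
  shows "off p0 p"
proof (cases "p \<le> q0")
  case True
  then show ?thesis using base p by - (rule off_restrict[of p0 q0 p0 p], auto simp: J_def)
next
  case False
  have p1: "1 \<le> p" using p by (simp add: J_def)
  obtain r0 where r0: "p0 = ereal r0" using base by (cases p0) auto
  from p consider (right) q where "p < q" "off p q" | (left) q where "1 \<le> q" "q < p" "off q p"
    by (auto simp: J_def)
  then show ?thesis
  proof cases
    case left
    show ?thesis
    proof (cases "q \<le> q0")
      case True
      define m where "m = max q p0"
      have m: "p0 \<le> m" "q \<le> m" "m \<le> q0" "m \<le> p" using True base False p left by (auto simp: m_def)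
      have "off p0 m" using base m by - (rule off_restrict[of p0 q0 p0 m], auto)
      moreover have "off m p" using left m p1 by - (rule off_restrict[of q p m p], auto)
      ultimately show ?thesis using base m by - (rule off_trans[of p0 m p], auto)
    next
      case q: False
      obtain u where u: "1 \<le> u" "q < ereal u" "ereal u < p" using ereal_real_between_1[OF left(1,2)] .
      have "p \<in> U" using off_imp_uniformly_bounded[OF left(3,1)] left by auto
      then have "off p0 (ereal u)" using base u q False r0 by - (unfold r0, rule off_extend_right[of r0 q0 p u], auto)
      moreover have "off (ereal u) p" using left p1 u by - (rule off_restrict[of q p "ereal u" p], auto)
      moreover have "p0 \<le> ereal u" using u q base by auto
      ultimately show ?thesis using base u by - (rule off_trans[of p0 "ereal u" p], auto)
    qed
  next
    case right
    have "q \<in> U" using off_imp_uniformly_bounded[OF right(2) p1] right by auto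
    moreover obtain u where u: "p = ereal u" using right p1 by (cases p) auto
    ultimately show ?thesis using base right False r0 by - (unfold r0 u, rule off_extend_right[of r0 q0 q u], auto)
  qed
qed

text \<open>The base pair serves as a bridge: if p \<le> p0 and q > q0, then (p, q0) and (q0, q) are
  composed; in the other cases a longer estimate is restricted.\<close>

lemma J_iff:
  assumes base: "1 \<le> p0" "p0 < q0" "off p0 q0" and "1 \<le> p" "p < q"
  shows "off p q \<longleftrightarrow> p \<in> J \<and> q \<in> J"
proof
  assume "off p q"
  then show "p \<in> J \<and> q \<in> J" using assms by (auto simp: J_def)
next
  assume pq: "p \<in> J \<and> q \<in> J"
  have q1: "1 \<le> q" using assms by auto
  show "off p q"
  proof (cases "p \<le> p0")
    case True
    then have pq0: "off p q0" using J_left[OF base, of p] pq base by auto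
    show ?thesis
    proof (cases "q \<le> q0")
      case True
      then show ?thesis using pq0 assms q1 by - (rule off_restrict[of p q0 p q], auto)
    next
      case q: False
      then have "off p0 q" using J_right[OF base, of q] pq base by auto
      then have "off q0 q" using base q1 by - (rule off_restrict[of p0 q q0 q], auto)
      then show ?thesis using pq0 assms q True by - (rule off_trans[of p q0 q], auto)
    qed
  next
    case False
    then have "off p0 q" using J_right[OF base, of q] pq assms by auto
    then show ?thesis using assms q1 False by - (rule off_restrict[of p0 q p q], auto)
  qed
qed

lemma J_subset_U: "J \<subseteq> U"
  by (auto simp: J_def intro: off_imp_uniformly_bounded[OF _ _ less_imp_le])

lemma J_interval:
  assumes base: "1 \<le> p0" "p0 < q0" "off p0 q0" and "a \<in> J" "b \<in> J"
  shows "{a..b} \<subseteq> J"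
proof
  fix c assume c: "c \<in> {a..b}"
  show "c \<in> J"
  proof (cases "c = a \<or> c = b")
    case False
    then have lt: "a < c" "c < b" using c by auto
    have a1: "1 \<le> a" using assms by (simp add: J_def)
    then have "off a b" using J_iff[OF base, of a b] assms lt by auto
    then have "off a c" using a1 lt by - (rule off_restrict[of a b a c], auto)
    then show ?thesis using J_iff[OF base, of a c] a1 lt by auto
  qed (use assms in auto)
qed

text \<open>An exponent u strictly inside \<open>U\<close> has members of \<open>U\<close> on both
  sides. On each side, either the base endpoint already lies beyond u, or the base pair extends to
  an exponent w beyond u.\<close>

lemma J_interior:
  assumes base: "1 \<le> p0" "p0 < q0" "off p0 q0"
  shows "exponent_interior J = exponent_interior U"
proof (intro equalityI subsetI)
  fix u assume "u \<in> exponent_interior J"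
  then show "u \<in> exponent_interior U"
    unfolding exponent_interior_def using Inf_superset_mono[OF J_subset_U] Sup_subset_mono[OF J_subset_U]
    by (auto intro: le_less_trans less_le_trans)
next
  have J0: "p0 \<in> J" "q0 \<in> J" using base by (auto simp: J_def)
  fix u assume "u \<in> exponent_interior U"
  then obtain s1 s2 where s: "s1 \<in> U" "s1 < ereal u" "s2 \<in> U" "ereal u < s2"
    unfolding exponent_interior_def by (auto simp: Inf_less_iff less_Sup_iff)
  have s1: "1 \<le> s1" using s by (simp add: uniformly_bounded_exponents_def)
  have "\<exists>a\<in>J. a < ereal u"
  proof (cases "p0 \<le> s1")
    case True
    then show ?thesis using J0 s by (intro bexI[of _ p0]) auto
  next
    case False
    then have "s1 < min p0 (ereal u)" using s by auto
    then obtain w where w: "1 \<le> w" "s1 < ereal w" "ereal w < min p0 (ereal u)"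
      using ereal_real_between_1[OF s1] by blast
    have "off (ereal w) q0" using base w False s by - (rule off_extend_left[of p0 q0 s1 w], auto)
    moreover have "ereal w < q0" using w base by auto
    ultimately have "ereal w \<in> J" using w by (auto simp: J_def)
    then show ?thesis using w by (intro bexI[of _ "ereal w"]) auto
  qed
  moreover have "\<exists>a\<in>J. ereal u < a"
  proof (cases "s2 \<le> q0")
    case True
    then show ?thesis using J0 s by (intro bexI[of _ q0]) auto
  next
    case False
    then have "max q0 (ereal u) < s2" using s by auto
    moreover have "1 \<le> max q0 (ereal u)" using base by (intro max.coboundedI1) auto
    ultimately obtain w where w: "1 \<le> w" "max q0 (ereal u) < ereal w" "ereal w < s2"
      using ereal_real_between_1 by blast
    obtain r0 where r0: "p0 = ereal r0" using base by (cases p0) auto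
    have "off p0 (ereal w)" using base w False s r0 by - (unfold r0, rule off_extend_right[of r0 q0 s2 w], auto)
    moreover have "p0 < ereal w" using w base by auto
    ultimately have "ereal w \<in> J" using w base by (auto simp: J_def)
    then show ?thesis using w by (intro bexI[of _ "ereal w"]) auto
  qed
  ultimately show "u \<in> exponent_interior J"
    unfolding exponent_interior_def by (auto intro: Inf_lower Sup_upper le_less_trans less_le_trans)
qed

end

text \<open>Both sets contain p0, so any other p in J' forms with p0 a pair that has an estimate,
  and the exponents of this pair must lie in J. By symmetry one inclusion suffices.\<close>

lemma is_off_diagonal_set_unique:
  assumes pq: "1 \<le> p0" "p0 < q0" and off: "off_diagonal M \<B> T p0 q0"
    and J: "is_off_diagonal_set M \<B> T J" and J': "is_off_diagonal_set M \<B> T J'"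
  shows "J' \<subseteq> J"
proof
  fix p assume p: "p \<in> J'"
  have m: "p0 \<in> {1..\<infinity>}" "q0 \<in> {1..\<infinity>}" using pq by auto
  have p0: "p0 \<in> J" "p0 \<in> J'" using J J' m pq off unfolding is_off_diagonal_set_def by blast+
  have "p \<in> {1..\<infinity>}" using J' p unfolding is_off_diagonal_set_def by blast
  then show "p \<in> J"
    using p p0 J J' m unfolding is_off_diagonal_set_def by (metis linorder_neqE)
qed

section \<open>Degenerate measures\<close>

context homogeneous_type
begin

text \<open>Doubling makes all balls about x of radius 2^n r null, and they exhaust the space. The
  arbitrary \<open>P\<close> expresses nullity of the space in the form used for norms and
  averages.\<close>

lemma null_if_null_ball:
  assumes r: "r > 0" and null: "emeasure M (ball x r) = 0"
  shows "AE y in M. P y"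
proof -
  obtain C0 :: real where C0: "\<And>x r. r > 0 \<Longrightarrow> emeasure M (ball x (2 * r)) \<le> ennreal C0 * emeasure M (ball x r)"
    using doubling by auto
  have "emeasure M (ball x (2 ^ n * r)) = 0" for n
  proof (induction n)
    case 0
    show ?case using null by simp
  next
    case (Suc n)
    have "emeasure M (ball x (2 * (2 ^ n * r))) \<le> ennreal C0 * emeasure M (ball x (2 ^ n * r))"
      using r by (intro C0) simp
    then show ?case using Suc by (simp add: mult.assoc)
  qed
  then have "ball x (2 ^ n * r) \<in> null_sets M" for n
    by (simp add: null_sets_def sets_borel)
  then have "(\<Union>n. ball x (2 ^ n * r)) \<in> null_sets M" by (intro null_sets_UN)
  moreover have "(\<Union>n. ball x (2 ^ n * r)) = UNIV"
  proof (intro equalityI subsetI UNIV_I)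
    fix y
    obtain n where "dist x y / r < 2 ^ n" using real_arch_pow[of 2 "dist x y / r"] by auto
    then show "y \<in> (\<Union>n. ball x (2 ^ n * r))" using r by (auto simp: field_simps)
  qed
  ultimately show ?thesis by (intro AE_I'[of UNIV]) auto
qed

end

lemma nn_integral_zero_if_AE_all:
  assumes "\<And>P. AE x in M. P x"
  shows "(\<integral>\<^sup>+x. f x \<partial>M) = 0"
proof -
  have "(\<integral>\<^sup>+x. f x \<partial>M) = (\<integral>\<^sup>+x. 0 \<partial>M)" by (rule nn_integral_cong_AE) (rule assms)
  then show ?thesis by simp
qed

lemma Lp_avg_zero_if_AE_all:
  assumes null: "\<And>P. AE x in M. P x" and [measurable]: "f \<in> borel_measurable M" "E \<in> sets M"
  shows "Lp_avg M p A E f = 0"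
proof (cases "p = \<infinity>")
  case True
  have "esssup M (\<lambda>x. ennreal (norm (f x)) * indicator E x) \<le> 0"
    by (rule esssup_I) (measurable, rule null)
  then show ?thesis using True by (simp add: Lp_avg_def)
next
  case False
  then show ?thesis by (simp add: Lp_avg_def nn_integral_zero_if_AE_all[OF null] epowr_def)
qed

text \<open>All averages on the left-hand sides vanish, so the constants may all be 1.\<close>

lemma off_diagonal_if_AE_all:
  fixes M :: "'a::metric_space measure"
  assumes sg: "operator_semigroup M \<B> N T" and b: "sets M = sets borel" and null: "\<And>P. AE x in M. P x"
  shows "off_diagonal M \<B> T p q"
proof -
  interpret operator_semigroup M \<B> N T by (rule sg)
  have ann: "annulus j x r \<in> sets borel" for j and x :: 'a and r by (simp add: annulus_def)
  have zero: "Lp_avg M q A E (T t (trunc F f)) = 0"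
    if "t > 0" "f \<in> \<B>" "E \<in> sets M" "F \<in> sets M" for A E F t f
  proof (rule Lp_avg_zero_if_AE_all[OF null _ that(3)])
    have "trunc F f \<in> \<B>" using that by (intro trunc_closed)
    then have "T t (trunc F f) \<in> \<B>" using bounded[OF that(1)] unfolding bounded_operator_def by blast
    then show "T t (trunc F f) \<in> borel_measurable M" by (rule measurable)
  qed
  show ?thesis
    unfolding off_diagonal_def
    by (rule exI[of _ 1], rule conjI, simp, rule exI[of _ 1], rule conjI, simp, rule exI[of _ 1], rule conjI, simp,
        rule exI[of _ 1], rule conjI, simp) (auto simp: zero ann b)
qed

lemma uniformly_bounded_exponents_if_AE_all:
  assumes sg: "operator_semigroup M \<B> N T" and null: "\<And>P. AE x in M. P x"
  shows "uniformly_bounded_exponents M \<B> T = {1..\<infinity>}"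
proof -
  interpret operator_semigroup M \<B> N T by (rule sg)
  have "Lp_norm M p (T t f) = 0" if "p \<in> {1..\<infinity>}" "t > 0" "f \<in> \<B>" for p t f
  proof (rule Lp_norm_zero_AE[OF that(1) _ null])
    show "T t f \<in> borel_measurable M"
      using bounded[OF that(2)] that(3) measurable unfolding bounded_operator_def by blast
  qed
  then show ?thesis unfolding uniformly_bounded_exponents_def by auto
qed

theorem proposition4p1:
  fixes M :: "'a::metric_space measure"
    and \<B> :: "('a \<Rightarrow> complex) set"
    and N :: "('a \<Rightarrow> complex) \<Rightarrow> real"
    and T :: "real \<Rightarrow> ('a \<Rightarrow> complex) \<Rightarrow> 'a \<Rightarrow> complex"
    and p0 q0 :: ereal
  assumes "homogeneous_type M"
    and "operator_semigroup M \<B> N T"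
    and "annular_expansion M \<B> T"
    and "1 \<le> p0" and "p0 < q0" and "q0 \<le> \<infinity>"
    and "off_diagonal M \<B> T p0 q0"
  shows "\<exists>J. is_off_diagonal_set M \<B> T J \<and>
             (\<forall>J'. is_off_diagonal_set M \<B> T J' \<longrightarrow> J' = J) \<and>
             (\<forall>a\<in>J. \<forall>b\<in>J. {a..b} \<subseteq> J) \<and>
             {p0..q0} \<subseteq> J \<and>
             J \<subseteq> uniformly_bounded_exponents M \<B> T \<and>
             exponent_interior J = exponent_interior (uniformly_bounded_exponents M \<B> T)"
proof -
  let ?U = "uniformly_bounded_exponents M \<B> T"
  interpret homogeneous_type M by fact
  have "\<exists>J. is_off_diagonal_set M \<B> T J \<and> J \<subseteq> ?U \<and>
      exponent_interior J = exponent_interior ?U \<and> (\<forall>a\<in>J. \<forall>b\<in>J. {a..b} \<subseteq> J)"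
  \<comment> \<open>A null ball makes the whole space null; then every pair has an estimate and the
    set is all of {1..\<infinity>}.\<close>
  proof (cases "\<exists>x r. r > 0 \<and> emeasure M (ball x r) = 0")
    case True
    then have null: "AE x in M. P x" for P using null_if_null_ball by blast
    have "is_off_diagonal_set M \<B> T {1..\<infinity>}"
      unfolding is_off_diagonal_set_def using off_diagonal_if_AE_all[OF assms(2) sets_borel null] by auto
    then show ?thesis
      using uniformly_bounded_exponents_if_AE_all[OF assms(2) null] by (intro exI[of _ "{1..\<infinity>}"]) auto
  next
    case False
    interpret operator_semigroup M \<B> N T by fact
    interpret doubling_semigroup M \<B> N T
      by unfold_locales (use False assms(3) in auto)
    have "is_off_diagonal_set M \<B> T J"
      unfolding is_off_diagonal_set_def using J_iff[OF assms(4,5,7)] by (auto simp: J_def)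
    then show ?thesis using J_subset_U J_interior[OF assms(4,5,7)] J_interval[OF assms(4,5,7)] by blast
  qed
  then obtain J where J: "is_off_diagonal_set M \<B> T J" "J \<subseteq> ?U" "exponent_interior J = exponent_interior ?U"
    "\<forall>a\<in>J. \<forall>b\<in>J. {a..b} \<subseteq> J"
    by blast
  have "p0 \<in> {1..\<infinity>}" "q0 \<in> {1..\<infinity>}" using assms(4,5) by auto
  then have "p0 \<in> J" "q0 \<in> J" using J(1) assms(5,7) unfolding is_off_diagonal_set_def by blast+
  then have "{p0..q0} \<subseteq> J" using J(4) by blast
  moreover have "J' = J" if "is_off_diagonal_set M \<B> T J'" for J'
    using is_off_diagonal_set_unique[OF assms(4,5,7)] J(1) that by (intro equalityI)
  ultimately show ?thesis using J by blast
qed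

end
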